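(* Let $N\ge n\ge2$ be integers and let $\mathbf{z}=(z_1,\dots,z_N)\in\mathbb{R}^N$ satisfy $z_1\ge z_2\ge\cdots\ge z_N$ and $\sum_{i=1}^N z_i=0$. For $\mu$-almost every $\Lambda\in\mathcal{L}_N$, $$\frac{\rho_{\mathbf{z}}}{N}\le\liminf_{t\to\infty}\frac1t\log\mathrm{Max}_{\mathbf{z}}^t(\Lambda)\le\limsup_{t\to\infty}\frac1t\log\mathrm{Max}_{\mathbf{z}}^t(\Lambda)\le\frac{\delta_{\mathbf{z}}}{N},$$ where $$\rho_{\mathbf{z}}=nz_1-\sum_{i=1}^n z_i\qquad\text{and}\qquad\delta_{\mathbf{z}}=\sum_{1\le i<j\le n}(z_i-z_j).$$
   Context: $\mathcal{L}_N\cong\mathrm{SL}_N(\mathbb{R})/\mathrm{SL}_N(\mathbb{Z})$ is the space of unimodular (covolume one) lattices in $\mathbb{R}^N$, with $\mu$ its $\mathrm{SL}_N(\mathbb{R})$-invariant probability measure. The height function is $\alpha(\Lambda)=\sup\{1/\mathrm{Covol}_V(\Lambda\cap V)\}$, the supremum over all linear subspaces $V\subseteq\mathbb{R}^N$ of dimension $p$, $1\le p\le N-1$, such that $\Lambda\cap V$ is a lattice in $V$ (i.e. the inverse of the smallest covolume of a sublattice of $\Lambda$ of rank $1\le p\le N-1$). $H=\mathrm{SO}(n)\times\mathrm{Id}_{N-n}\le\mathrm{SL}_N(\mathbb{R})$ (block diagonal, acting on the first $n$ coordinates), $g^t=\exp(-t\,\mathrm{diag}(z_1,\dots,z_N))$,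 and $\mathrm{Max}_{\mathbf{z}}^t(\Lambda)=\sup_{h\in H}\alpha(g^th\Lambda)$. *)

theory Defs
  imports "HOL-Analysis.Analysis" "HOL-Probability.Probability_Measure"
begin

text \<open>
  The dimension \<open>N\<close> is \<open>CARD('N)\<close> for a finite well-ordered index type \<open>'N\<close>; the order of \<open>'N\<close> is
  the order of the coordinates \<open>1, \<dots>, N\<close>.
\<close>

subsection \<open>Lattices in subspaces and their covolumes\<close>

definition lattice_in :: "('a::euclidean_space) set \<Rightarrow> 'a set \<Rightarrow> bool" where
  "lattice_in V L \<longleftrightarrow>
     0 \<in> L \<and> (\<forall>x\<in>L. \<forall>y\<in>L. x - y \<in> L) \<and> discrete L \<and> span L = V"

definition orthonormal_basis :: "('a::euclidean_space) set \<Rightarrow> 'a set \<Rightarrow> bool" where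
  "orthonormal_basis V B \<longleftrightarrow>
     pairwise orthogonal B \<and> (\<forall>b\<in>B. norm b = 1) \<and> span B = V"

text \<open>
  Lebesgue measure of a subspace \<open>V\<close> with its induced Euclidean structure, built from an orthonormal
  basis of \<open>V\<close> as \<open>lborel\<close> is from \<open>Basis\<close>, and viewed as a Borel measure on the ambient space
  that is concentrated on \<open>V\<close>. It does not depend on the choice of the basis.
\<close>

definition lborel_subspace :: "('a::euclidean_space) set \<Rightarrow> 'a measure" where
  "lborel_subspace V =
     (let B = (SOME B. orthonormal_basis V B)
      in distr (\<Pi>\<^sub>M b\<in>B. (lborel :: real measure)) borel (\<lambda>f. \<Sum>b\<in>B. f b *\<^sub>R b))"

definition fundamental_domain :: "('a::euclidean_space) set \<Rightarrow> 'a set \<Rightarrow> 'a set \<Rightarrow> bool" where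
  "fundamental_domain V L F \<longleftrightarrow>
     F \<in> sets borel \<and> F \<subseteq> V \<and> (\<forall>x\<in>V. \<exists>!v. v \<in> L \<and> x - v \<in> F)"

text \<open>All Borel fundamental domains of a lattice in \<open>V\<close> have the same finite volume.\<close>

definition covol :: "('a::euclidean_space) set \<Rightarrow> 'a set \<Rightarrow> real" where
  "covol V L = measure (lborel_subspace V) (SOME F. fundamental_domain V L F)"

subsection \<open>The space of unimodular lattices\<close>

definition unimodular_lattices :: "(real^'N) set set" where
  "unimodular_lattices = {\<Lambda>. lattice_in UNIV \<Lambda> \<and> covol UNIV \<Lambda> = 1}"

definition SL :: "(real^'N^'N) set" where
  "SL = {A. det A = 1}"

definition act :: "real^'N^'N \<Rightarrow> (real^'N) set \<Rightarrow> (real^'N) set" where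
  "act g \<Lambda> = (\<lambda>v. g *v v) ` \<Lambda>"

definition integer_lattice :: "(real^'N) set" where
  "integer_lattice = {v. \<forall>i. v $ i \<in> \<int>}"

text \<open>
  \<open>SL\<close> acts transitively on unimodular lattices, and the stabiliser of the integer lattice consists
  of the integer matrices in \<open>SL\<close>. The topology of the space of lattices is the quotient topology of
  the orbit map, and the \<open>\<sigma>\<close>-algebra is the Borel one of this topology.
\<close>

definition open_in_lattices :: "(real^'N) set set \<Rightarrow> bool" where
  "open_in_lattices U \<longleftrightarrow>
     U \<subseteq> unimodular_lattices \<and>
     openin (top_of_set SL) {A \<in> SL. act A integer_lattice \<in> U}"

definition borel_lattices :: "(real^'N) set measure" where
  "borel_lattices = sigma unimodular_lattices {U. open_in_lattices U}"

text \<open>There is exactly one such measure.\<close>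

definition SL_invariant_prob_measure :: "(real^'N) set measure \<Rightarrow> bool" where
  "SL_invariant_prob_measure \<mu> \<longleftrightarrow>
     prob_space \<mu> \<and> sets \<mu> = sets borel_lattices \<and>
     (\<forall>g\<in>SL. \<forall>S\<in>sets \<mu>. emeasure \<mu> (act g ` S) = emeasure \<mu> S)"

subsection \<open>The height function and its maximum over the orbit\<close>

text \<open>
  For a lattice in the whole space and \<open>N \<ge> 2\<close> the set below is nonempty and bounded; the same is
  true of the heights in \<open>max_height\<close>, because \<open>block_SO n\<close> is compact. So both real-valued suprema
  are the true ones.
\<close>

definition height :: "(real^'N) set \<Rightarrow> real" where
  "height \<Lambda> = Sup {1 / covol V (\<Lambda> \<inter> V) | V.
     subspace V \<and> 1 \<le> dim V \<and> dim V \<le> CARD('N) - 1 \<and> lattice_in V (\<Lambda> \<inter> V)}"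

definition first_coords :: "nat \<Rightarrow> ('N::{finite,wellorder}) set" where
  "first_coords n = {i. card {j. j < i} < n}"

definition block_SO :: "nat \<Rightarrow> (real^'N::{finite,wellorder}^'N::_) set" where
  "block_SO n = {h. rotation_matrix h \<and>
     (\<forall>i j. \<not> (i \<in> first_coords n \<and> j \<in> first_coords n) \<longrightarrow> h $ i $ j = (if i = j then 1 else 0))}"

definition diag :: "real^'N \<Rightarrow> real^'N^'N" where
  "diag z = (\<chi> i j. if i = j then z $ i else 0)"

text \<open>
  The library's \<open>exp\<close> is not available here, since multiplication on \<open>real^'N^'N\<close> is componentwise.
\<close>

definition matrix_exp :: "real^'N^'N \<Rightarrow> real^'N^'N" where
  "matrix_exp A = (\<Sum>k. (1 / fact k) *\<^sub>R (((**) A ^^ k) (mat 1)))"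

definition flow :: "real^'N \<Rightarrow> real \<Rightarrow> real^'N^'N" where
  "flow z t = matrix_exp ((- t) *\<^sub>R diag z)"

definition max_height :: "nat \<Rightarrow> real^'N::{finite,wellorder} \<Rightarrow> real \<Rightarrow> (real^'N::_) set \<Rightarrow> real" where
  "max_height n z t \<Lambda> = (SUP h\<in>block_SO n. height (act (flow z t ** h) \<Lambda>))"

subsection \<open>The exponents\<close>

definition rho :: "nat \<Rightarrow> real^'N::{finite,wellorder} \<Rightarrow> real" where
  "rho n z = real n * z $ (Min UNIV) - (\<Sum>i\<in>first_coords n. z $ i)"

definition delta :: "nat \<Rightarrow> real^'N::{finite,wellorder} \<Rightarrow> real" where
  "delta n z =
     (\<Sum>(i, j) \<in> {(i, j). i \<in> first_coords n \<and> j \<in> first_coords n \<and> i < j}. z $ i - z $ j)"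

end

theory Submission
  imports Defs
begin

text \<open>
  Write \<open>N\<close> for the dimension and \<open>g\<close> for the flow at time \<open>t\<close>, which contracts the coordinate \<open>i\<close> by
  \<open>exp (- t * z $ i)\<close>. A lattice has a sublattice of small covolume if and only if, up to constants, it has
  linearly independent vectors with small product of lengths (\<open>reduced_le_covol\<close>, a form of Minkowski's
  second theorem). So the maximal height on the orbit is governed by such short systems of vectors in \<open>g h \<Lambda>\<close>,
  where \<open>h\<close> runs through the block group.

  The lower bound holds for every lattice (\<open>max_height_lower\<close>). Minkowski's theorem on linear forms gives a
  nonzero lattice vector in a long box. Some \<open>h\<close> turns its block component to the first axis, which the flow
  contracts most. The best box makes the image of length about \<open>exp (- t * rho n z / N)\<close>.

  The upper bound is a Borel-Cantelli argument. It needs no integration theory on the space of lattices: instead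
  of a random lattice, take a fixed lattice \<open>\<Lambda>\<close> and a matrix \<open>A\<close> that is Lebesgue distributed in a small ball around
  the identity. Invariance of \<open>\<mu>\<close> and Fubini's theorem turn a null set of \<open>A\<close> for every \<open>\<Lambda>\<close> into a null set of
  lattices (\<open>AE_eventually_not_hitting\<close>).

  What has to be estimated is the volume of those \<open>A\<close> for which \<open>g h A \<Lambda>\<close> has, for some \<open>h\<close>, a short system of
  product less than \<open>\<tau>\<close> (\<open>short_system_measure\<close>). The continuum of \<open>h\<close> is replaced by a net that is fine
  enough for \<open>g\<close>; thickening the group to a set of matrices shows that about \<open>exp (t * delta n z)\<close> points
  suffice (\<open>near_block_net\<close>). A single \<open>h\<close> contributes about \<open>\<tau> ^ N\<close>, as for counting lattices with a small sublattice:
  the short vectors may be taken as images of a reduced system \<open>m\<close> of \<open>\<Lambda>\<close>, and the singular vectors of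
  \<open>g h A\<close> on the span of \<open>m\<close> are again taken from a net, now in the rotations of this span. With \<open>m\<close>, the singular
  vectors and the sizes \<open>exp (l k)\<close> of the singular values fixed, \<open>A\<close> is confined to a box. The number of
  net points times the volume of a box is bounded by \<open>exp (N * (\<Sum>k. l k))\<close> (\<open>spread_key\<close>), the number of \<open>m\<close>
  with given lengths by the \<open>N\<close>-th power of their product, and the product of both is at most \<open>\<tau> ^ N\<close> because the
  singular values times the lengths of \<open>m\<close> bound the volume spanned by the short system from below.

  The total \<open>exp (t * delta n z) * \<tau> ^ N\<close> is summable over integer times as soon as
  \<open>\<tau> = exp (- t * (delta n z / N + \<epsilon>))\<close> with \<open>\<epsilon> > 0\<close>, up to a polynomial factor, and between integer times the
  flow changes lengths by bounded factors only (\<open>covol_ge_of_no_short_system\<close>).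
\<close>

section \<open>Isometries, frames and packing\<close>

text \<open>
  Translation invariance determines the image measure up to a factor, which the unit ball, mapped onto itself
  by an isometry, shows to be one. The computation is Fubini's theorem for the integral over \<open>x\<close>
  and \<open>y\<close> of \<open>indicator (ball 0 1) y * indicator S (f x + y)\<close>.
\<close>

lemma distr_lborel_linear_isometry:
  fixes f :: "'a::euclidean_space \<Rightarrow> 'a"
  assumes f: "linear f" and iso: "\<And>x. norm (f x) = norm x"
  shows "distr lborel borel f = lborel"
proof (rule measure_eqI)
  fix S :: "'a set" assume "S \<in> sets (distr lborel borel f)"
  then have S[measurable]: "S \<in> sets borel" by simp
  have [measurable]: "f \<in> borel_measurable borel"
    using f by (intro borel_measurable_continuous_onI linear_continuous_on) (simp add: linear_conv_bounded_linear)
  have "inj f" using f iso by (metis linear_injective_0 norm_eq_zero)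
  then have "surj f" using f linear_injective_imp_surjective by blast
  define b where "b = emeasure lborel (ball (0::'a) 1)"
  have b: "b \<noteq> 0" "b < \<infinity>"
  proof -
    have "unit_ball_vol (real DIM('a)) \<noteq> 0"
      by (metis less_irrefl of_nat_0_le_iff unit_ball_vol_pos)
    then show "b \<noteq> 0" by (simp add: b_def emeasure_ball)
    show "b < \<infinity>" unfolding b_def by (rule emeasure_lborel_ball_finite)
  qed
  have bt: "emeasure lborel (ball (x::'a) 1) = b" for x
    unfolding b_def by (simp add: emeasure_ball)
  let ?B = "ball (0::'a) 1"
  have [measurable]: "(\<lambda>x. indicator A (g x) :: ennreal) \<in> borel_measurable M"
    if "A \<in> sets borel" "g \<in> borel_measurable M" for A :: "'a set" and g and M :: "'a measure"
    using that by (intro measurable_compose[OF that(2)]) simp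
  have [measurable]: "(\<lambda>x. indicator A (g x) :: ennreal) \<in> borel_measurable M"
    if "A \<in> sets borel" "g \<in> borel_measurable M" for A :: "'a set" and g and M :: "('a \<times> 'a) measure"
    using that by (intro measurable_compose[OF that(2)]) simp
  have [measurable]: "?B \<in> sets borel" by simp
  have shift: "(\<integral>\<^sup>+x. indicator S (f x + y) \<partial>lborel) = (\<integral>\<^sup>+x. indicator S (f x) \<partial>lborel)" for y :: 'a
  proof -
    obtain w where w: "y = f w" using \<open>surj f\<close> by (metis surjD)
    have "(\<integral>\<^sup>+x. indicator S (f x) \<partial>lborel) = (\<integral>\<^sup>+x. indicator S (f x) \<partial>(distr lborel borel ((+) w)))"
      by (simp add: lborel_distr_plus)
    also have "\<dots> = (\<integral>\<^sup>+x. indicator S (f (w + x)) \<partial>lborel)"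
      by (rule nn_integral_distr) measurable
    finally show ?thesis using w f by (simp add: linear_add add.commute)
  qed
  have shift2: "(\<integral>\<^sup>+y. indicator ?B y * indicator S (u + y) \<partial>lborel) =
    (\<integral>\<^sup>+y. indicator ?B (y - u) * indicator S y \<partial>lborel)" for u :: 'a
  proof -
    have "(\<integral>\<^sup>+y. indicator ?B (y - u) * indicator S y \<partial>lborel) =
       (\<integral>\<^sup>+y. indicator ?B (y - u) * indicator S y \<partial>(distr lborel borel ((+) u)))"
      by (simp add: lborel_distr_plus)
    also have "\<dots> = (\<integral>\<^sup>+y. indicator ?B ((u + y) - u) * indicator S (u + y) \<partial>lborel)"
      by (rule nn_integral_distr) measurable
    finally show ?thesis by simp
  qed
  have ball: "(\<integral>\<^sup>+x. indicator ?B (y - f x) \<partial>lborel) = b" for y :: 'a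
  proof -
    obtain w where w: "y = f w" using \<open>surj f\<close> by (metis surjD)
    have "y - f x \<in> ?B \<longleftrightarrow> x \<in> ball w 1" for x
      using f iso[of "w - x"] by (simp add: w dist_norm linear_diff[symmetric])
    then have "(\<lambda>x. indicator ?B (y - f x) :: ennreal) = indicator (ball w 1)"
      by (auto simp: indicator_def)
    then show ?thesis using bt[of w] by simp
  qed
  have "emeasure (distr lborel borel f) S * b = (\<integral>\<^sup>+x. indicator S (f x) \<partial>lborel) * b"
  proof -
    have "emeasure (distr lborel borel f) S = (\<integral>\<^sup>+x. indicator S x \<partial>distr lborel borel f)" by simp
    also have "\<dots> = (\<integral>\<^sup>+x. indicator S (f x) \<partial>lborel)" by (rule nn_integral_distr) measurable
    finally show ?thesis by simp
  qed
  also have "\<dots> = (\<integral>\<^sup>+y. indicator ?B y * (\<integral>\<^sup>+x. indicator S (f x + y) \<partial>lborel) \<partial>lborel)"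
    unfolding shift b_def by (simp add: nn_integral_multc mult.commute)
  also have "\<dots> = (\<integral>\<^sup>+y. (\<integral>\<^sup>+x. indicator ?B y * indicator S (f x + y) \<partial>lborel) \<partial>lborel)"
    by (subst nn_integral_cmult) auto
  also have "\<dots> = (\<integral>\<^sup>+x. (\<integral>\<^sup>+y. indicator ?B y * indicator S (f x + y) \<partial>lborel) \<partial>lborel)"
    by (rule lborel_pair.Fubini') measurable
  also have "\<dots> = (\<integral>\<^sup>+x. (\<integral>\<^sup>+y. indicator ?B (y - f x) * indicator S y \<partial>lborel) \<partial>lborel)"
    unfolding shift2 ..
  also have "\<dots> = (\<integral>\<^sup>+y. (\<integral>\<^sup>+x. indicator ?B (y - f x) * indicator S y \<partial>lborel) \<partial>lborel)"
    by (rule lborel_pair.Fubini') measurable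
  also have "\<dots> = (\<integral>\<^sup>+y. indicator S y * (\<integral>\<^sup>+x. indicator ?B (y - f x) \<partial>lborel) \<partial>lborel)"
    by (subst nn_integral_multc) (auto simp: mult.commute)
  also have "\<dots> = emeasure lborel S * b"
    unfolding ball by (simp add: nn_integral_multc)
  finally show "emeasure (distr lborel borel f) S = emeasure lborel S"
    using b by (metis ennreal_mult_cancel_left infinity_ennreal_def less_irrefl mult.commute)
qed simp

lemma emeasure_lborel_isometry:
  fixes f :: "'a::euclidean_space \<Rightarrow> 'a"
  assumes f: "linear f" and iso: "\<And>x. norm (f x) = norm x" and S: "S \<in> sets borel"
  shows "emeasure lborel {x. f x \<in> S} = emeasure lborel S"
proof -
  have [measurable]: "f \<in> borel_measurable borel"
    using f by (intro borel_measurable_continuous_onI linear_continuous_on) (simp add: linear_conv_bounded_linear)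
  have "emeasure lborel S = emeasure (distr lborel borel f) S"
    using distr_lborel_linear_isometry[OF f iso] by simp
  also have "\<dots> = emeasure lborel {x. f x \<in> S}"
    using S by (simp add: emeasure_distr vimage_def)
  finally show ?thesis ..
qed

text \<open>
  The volume comparison behind every covolume estimate below: cut \<open>F\<close> into countably many Borel
  pieces, move each piece into \<open>S\<close> by an element of \<open>L\<close>, and note that the moved
  pieces stay disjoint because \<open>F\<close> meets every coset at most once.
\<close>

lemma packing_le_covering:
  fixes L :: "('a::euclidean_space) set"
  assumes L: "countable L" "L \<noteq> {}" "\<And>x y. x \<in> L \<Longrightarrow> y \<in> L \<Longrightarrow> x - y \<in> L"
    and F[measurable]: "F \<in> sets borel" and S[measurable]: "S \<in> sets borel"
    and pack: "\<And>x y. x \<in> F \<Longrightarrow> y \<in> F \<Longrightarrow> x - y \<in> L \<Longrightarrow> x = y"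
    and cov: "\<And>x. x \<in> F \<Longrightarrow> \<exists>v\<in>L. x - v \<in> S"
  shows "emeasure lborel F \<le> emeasure lborel S"
proof -
  \<comment> \<open>An enumeration, possibly with repetitions, also if the group is finite.\<close>
  define e where "e = from_nat_into L"
  have e: "range e = L" unfolding e_def using L by (simp add: range_from_nat_into)
  define C where "C n = F \<inter> {x. x - e n \<in> S}" for n
  \<comment> \<open>Assign each point of \<open>F\<close> to the first translate that works for it.\<close>
  define D where "D = disjointed C"
  have [measurable]: "C n \<in> sets borel" for n
    unfolding C_def by measurable
  have Dm[measurable]: "D n \<in> sets borel" for n
    unfolding D_def disjointed_def by measurable
  have UD: "(\<Union>n. D n) = F"
  proof -
    have "(\<Union>n. D n) = (\<Union>n. C n)" unfolding D_def by (rule UN_disjointed_eq)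
    also have "\<dots> = F" unfolding C_def using cov e by blast
    finally show ?thesis .
  qed
  have DC: "D n \<subseteq> C n" for n unfolding D_def by (rule disjointed_subset)
  define G where "G n = {x. x + e n \<in> D n}" for n
  have [measurable]: "G n \<in> sets borel" for n unfolding G_def by measurable
  have GD: "emeasure lborel (G n) = emeasure lborel (D n)" for n
  proof -
    have "emeasure lborel (D n) = emeasure (distr lborel borel ((+) (e n))) (D n)"
      by (simp add: lborel_distr_plus)
    also have "\<dots> = emeasure lborel (G n)"
      by (simp add: emeasure_distr G_def vimage_def add.commute)
    finally show ?thesis ..
  qed
  have disjG: "disjoint_family G"
    unfolding disjoint_family_on_def
  proof (intro ballI impI)
    fix m n :: nat assume mn: "m \<noteq> n"
    show "G m \<inter> G n = {}"
    proof (rule ccontr)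
      assume "G m \<inter> G n \<noteq> {}"
      then obtain x where x: "x + e m \<in> D m" "x + e n \<in> D n" unfolding G_def by blast
      then have "x + e m \<in> F" "x + e n \<in> F" using UD by blast+
      moreover have "(x + e m) - (x + e n) \<in> L" using L(3)[of "e m" "e n"] e by auto
      ultimately have "x + e m = x + e n" by (rule pack)
      then have "x + e m \<in> D m \<inter> D n" using x by simp
      moreover have "disjoint_family D" unfolding D_def by (rule disjoint_family_disjointed)
      ultimately show False using mn by (auto simp: disjoint_family_on_def)
    qed
  qed
  have "emeasure lborel F = (\<Sum>n. emeasure lborel (D n))"
    unfolding UD[symmetric] D_def
    by (rule suminf_emeasure[symmetric]) (use Dm in \<open>auto simp: D_def disjoint_family_disjointed\<close>)
  also have "\<dots> = (\<Sum>n. emeasure lborel (G n))" by (simp add: GD)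
  also have "\<dots> = emeasure lborel (\<Union>n. G n)"
    by (rule suminf_emeasure) (auto simp: disjG)
  also have "\<dots> \<le> emeasure lborel S"
  proof (rule emeasure_mono)
    show "(\<Union>n. G n) \<subseteq> S" using DC unfolding G_def C_def by fastforce
  qed simp
  finally show ?thesis .
qed

lemma orthogonal_matrix_rows:
  fixes F :: "real^'n^'n"
  shows "orthogonal_matrix F \<longleftrightarrow> (\<forall>i j. F $ i \<bullet> F $ j = (if i = j then 1 else 0))"
proof -
  have "orthogonal_matrix F \<longleftrightarrow> F ** transpose F = mat 1"
    using orthogonal_matrix[of "transpose F"] orthogonal_matrix_transpose[of F] by (metis transpose_transpose)
  also have "\<dots> \<longleftrightarrow> (\<forall>i j. F $ i \<bullet> F $ j = (if i = j then 1 else 0))"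
    by (simp add: vec_eq_iff matrix_matrix_mult_def transpose_def mat_def inner_vec_def)
  finally show ?thesis .
qed

lemma matrix_vector_mult_row: "(F *v x) $ i = F $ i \<bullet> (x::real^'n)"
  by (simp add: matrix_vector_mult_def inner_vec_def)

lemma orthogonal_matrix_norm:
  fixes F :: "real^'n^'n"
  assumes "orthogonal_matrix F" shows "norm (F *v x) = norm x"
  using assms by (metis orthogonal_transformation_matrix orthogonal_transformation_norm matrix_of_matrix_vector_mul matrix_vector_mul_linear)

lemma orthogonal_matrix_expand:
  fixes F :: "real^'n^'n"
  assumes "orthogonal_matrix F" shows "x = (\<Sum>i\<in>UNIV. (F $ i \<bullet> x) *\<^sub>R F $ i)"
proof -
  have "x = transpose F *v (F *v x)"
    using assms by (simp add: matrix_vector_mul_assoc orthogonal_matrix_def)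
  also have "\<dots> = (\<Sum>i\<in>UNIV. (F $ i \<bullet> x) *\<^sub>R F $ i)"
    by (simp add: vec_eq_iff matrix_vector_mult_def transpose_def inner_vec_def mult.commute)
  finally show ?thesis .
qed

lemma orthogonal_matrix_parseval:
  fixes F :: "real^'n^'n"
  assumes "orthogonal_matrix F" shows "(norm x)\<^sup>2 = (\<Sum>i\<in>UNIV. (F $ i \<bullet> x)\<^sup>2)"
proof -
  have "(norm x)\<^sup>2 = (norm (F *v x))\<^sup>2" by (simp add: orthogonal_matrix_norm[OF assms])
  also have "\<dots> = (\<Sum>i\<in>UNIV. (F $ i \<bullet> x)\<^sup>2)"
    by (simp add: norm_vec_def L2_set_def sum_nonneg matrix_vector_mult_row)
  finally show ?thesis .
qed

lemma emeasure_orthogonal_matrix: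
  fixes F :: "real^'n^'n"
  assumes "orthogonal_matrix F" "S \<in> sets borel"
  shows "emeasure lborel {x. F *v x \<in> S} = emeasure lborel S"
  by (rule emeasure_lborel_isometry) (auto simp: assms orthogonal_matrix_norm)

lemma emeasure_box_vec:
  fixes a b :: "real^'n"
  assumes "\<And>i. a $ i \<le> b $ i"
  shows "emeasure lborel (box a b) = ennreal (\<Prod>i\<in>UNIV. b $ i - a $ i)"
    and "emeasure lborel (cbox a b) = ennreal (\<Prod>i\<in>UNIV. b $ i - a $ i)"
proof -
  have B: "(\<Prod>u\<in>Basis. (b - a) \<bullet> u) = (\<Prod>i\<in>UNIV. b $ i - a $ i)"
  proof -
    have B1: "(Basis :: (real^'n) set) = (\<lambda>i. axis i 1) ` UNIV" by (auto simp: Basis_vec_def)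
    have "inj (\<lambda>i. axis i (1::real) :: real^'n)" by (auto simp: inj_def axis_eq_axis)
    then have "(\<Prod>u\<in>Basis. (b - a) \<bullet> u) = (\<Prod>i\<in>UNIV. (b - a) \<bullet> axis i 1)"
      unfolding B1 by (subst prod.reindex) simp_all
    then show ?thesis by (simp add: inner_axis)
  qed
  have le: "a \<bullet> u \<le> b \<bullet> u" if "u \<in> Basis" for u
    using that assms by (auto simp: Basis_vec_def inner_axis)
  show "emeasure lborel (box a b) = ennreal (\<Prod>i\<in>UNIV. b $ i - a $ i)"
    using le B by (subst emeasure_lborel_box) auto
  show "emeasure lborel (cbox a b) = ennreal (\<Prod>i\<in>UNIV. b $ i - a $ i)"
    using le B by (subst emeasure_lborel_cbox) auto
qed

text \<open>
  Subspaces are handled through orthogonal matrices indexed by the ambient coordinates: the rows with index in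
  \<open>P\<close> are an orthonormal basis of \<open>V\<close> and the other rows one of its orthogonal
  complement. A system of vectors indexed by \<open>P\<close> can then be completed to a square matrix, and
  its volume in \<open>V\<close> is a determinant.
\<close>

definition frame :: "'n set \<Rightarrow> (real^'n) set \<Rightarrow> real^'n^'n \<Rightarrow> bool" where
  "frame P V F \<longleftrightarrow> orthogonal_matrix F \<and> (\<forall>i\<in>P. F $ i \<in> V) \<and> (\<forall>i. i \<notin> P \<longrightarrow> (\<forall>v\<in>V. F $ i \<bullet> v = 0))"

lemma frame_expand:
  assumes "frame P V F" "v \<in> V" shows "v = (\<Sum>i\<in>P. (F $ i \<bullet> v) *\<^sub>R F $ i)"
proof -
  have "v = (\<Sum>i\<in>UNIV. (F $ i \<bullet> v) *\<^sub>R F $ i)"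
    using assms by (intro orthogonal_matrix_expand) (auto simp: frame_def)
  also have "\<dots> = (\<Sum>i\<in>P. (F $ i \<bullet> v) *\<^sub>R F $ i)"
    using assms by (intro sum.mono_neutral_right) (auto simp: frame_def)
  finally show ?thesis .
qed

lemma frame_exists:
  fixes V :: "(real^'n) set"
  assumes V: "subspace V" and P: "card P = dim V"
  shows "\<exists>F. frame P V F"
proof -
  obtain B where B: "B \<subseteq> V" "pairwise orthogonal B" "\<And>x. x \<in> B \<Longrightarrow> norm x = 1" "independent B" "card B = dim V" "span B = V"
    using orthonormal_basis_subspace[OF V] by metis
  let ?W = "V\<^sup>\<bottom>"
  obtain C where C: "C \<subseteq> ?W" "pairwise orthogonal C" "\<And>x. x \<in> C \<Longrightarrow> norm x = 1" "independent C" "card C = dim ?W" "span C = ?W"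
    using orthonormal_basis_subspace[OF subspace_orthogonal_comp[of V]] by metis
  have dW: "dim V + dim ?W = CARD('n)"
    using dim_subspace_orthogonal_to_vectors[of V UNIV] V
    by (simp add: orthogonal_comp_def orthogonal_commute)
  have fin: "finite B" "finite C" using B C independent_imp_finite by blast+
  have cP: "card (-P) = card C" using dW C(5) P
    by (simp add: Compl_eq_Diff_UNIV card_Diff_subset)
  obtain f where f: "bij_betw f P B" using finite_same_card_bij[of P B] fin B P by auto
  obtain g where g: "bij_betw g (-P) C" using finite_same_card_bij[of "-P" C] fin cP by auto
  define F where "F = (\<chi> i. if i \<in> P then f i else g i)"
  have FB: "F $ i \<in> B" if "i \<in> P" for i using f that by (auto simp: F_def bij_betw_def)
  have FC: "F $ i \<in> C" if "i \<notin> P" for i using g that by (auto simp: F_def bij_betw_def)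
  have o: "F $ i \<bullet> v = 0" if "i \<notin> P" "v \<in> V" for i v
    using FC[OF that(1)] C(1) that(2) by (auto simp: orthogonal_comp_def orthogonal_def inner_commute)
  have "F $ i \<bullet> F $ j = (if i = j then 1 else 0)" for i j
  proof (cases "i = j")
    case True
    have "norm (F $ i) = 1" using FB FC B(3) C(3) by (cases "i \<in> P") auto
    then show ?thesis using True by (simp add: dot_square_norm)
  next
    case False
    consider "i \<in> P" "j \<in> P" | "i \<notin> P" "j \<notin> P" | "i \<in> P" "j \<notin> P" | "i \<notin> P" "j \<in> P" by blast
    then show ?thesis
    proof cases
      case 1
      then have "F $ i \<noteq> F $ j" using f False by (auto simp: F_def bij_betw_def inj_on_def)
      then show ?thesis using B(2) FB 1 False by (auto simp: pairwise_def orthogonal_def)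
    next
      case 2
      then have "F $ i \<noteq> F $ j" using g False by (auto simp: F_def bij_betw_def inj_on_def)
      then show ?thesis using C(2) FC 2 False by (auto simp: pairwise_def orthogonal_def)
    next
      case 3 then show ?thesis using o[of j "F $ i"] FB[of i] B(1) False by (auto simp: inner_commute)
    next
      case 4 then show ?thesis using o[of i "F $ j"] FB[of j] B(1) False by auto
    qed
  qed
  then have "orthogonal_matrix F" by (simp add: orthogonal_matrix_rows)
  then have "frame P V F" using o FB B(1) by (auto simp: frame_def)
  then show ?thesis ..
qed

section \<open>Discrete subgroups and Lebesgue measure on subspaces\<close>

definition discrete_subgroup :: "('a::euclidean_space) set \<Rightarrow> bool" where
  "discrete_subgroup L \<longleftrightarrow>
     0 \<in> L \<and> (\<forall>x\<in>L. \<forall>y\<in>L. x - y \<in> L) \<and> (\<exists>r>0. \<forall>x\<in>L. x \<noteq> 0 \<longrightarrow> r \<le> norm x)"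

lemma lattice_in_iff: "lattice_in V L \<longleftrightarrow> discrete_subgroup L \<and> span L = V"
proof -
  have "discrete L \<longleftrightarrow> (\<exists>r>0. \<forall>x\<in>L. x \<noteq> 0 \<longrightarrow> r \<le> norm x)"
    if 0: "0 \<in> L" and d: "\<forall>x\<in>L. \<forall>y\<in>L. x - y \<in> L"
  proof
    assume "discrete L"
    then have "0 isolated_in L" using 0 by (rule discreteD)
    then obtain r where "r > 0" "\<forall>y\<in>L. dist 0 y < r \<longrightarrow> y = 0"
      unfolding isolated_in_dist_Ex_iff by blast
    then show "\<exists>r>0. \<forall>x\<in>L. x \<noteq> 0 \<longrightarrow> r \<le> norm x" by (metis dist_0_norm not_le)
  next
    assume "\<exists>r>0. \<forall>x\<in>L. x \<noteq> 0 \<longrightarrow> r \<le> norm x"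
    then obtain r where r: "r > 0" "\<forall>x\<in>L. x \<noteq> 0 \<longrightarrow> r \<le> norm x" by blast
    show "discrete L"
    proof (rule discreteI)
      fix x assume x: "x \<in> L"
      show "x isolated_in L"
        unfolding isolated_in_dist_Ex_iff
      proof (intro conjI exI[of _ r] ballI impI)
        fix y assume "y \<in> L" "dist x y < r"
        then show "y = x" using r d x by (metis dist_norm not_le right_minus_eq)
      qed (use x r in auto)
    qed
  qed
  then show ?thesis unfolding lattice_in_def discrete_subgroup_def by blast
qed

context
  fixes L :: "('a::euclidean_space) set"
  assumes L: "discrete_subgroup L"
begin

lemma discrete_subgroup_0: "0 \<in> L"
  and discrete_subgroup_diff: "x \<in> L \<Longrightarrow> y \<in> L \<Longrightarrow> x - y \<in> L"
  using L by (auto simp: discrete_subgroup_def)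

lemma discrete_subgroup_minus: "x \<in> L \<Longrightarrow> - x \<in> L"
  using discrete_subgroup_diff[OF discrete_subgroup_0] by fastforce

lemma discrete_subgroup_add: "x \<in> L \<Longrightarrow> y \<in> L \<Longrightarrow> x + y \<in> L"
  using discrete_subgroup_diff[of x "- y"] discrete_subgroup_minus by simp

lemma discrete_subgroup_scale: "x \<in> L \<Longrightarrow> of_int k *\<^sub>R x \<in> L"
proof (induction k rule: int_induct[where k=0])
  case base then show ?case by (simp add: discrete_subgroup_0)
next
  case (step1 i) then show ?case using discrete_subgroup_add by (simp add: scaleR_add_left)
next
  case (step2 i) then show ?case using discrete_subgroup_diff by (simp add: scaleR_diff_left)
qed

lemma discrete_subgroup_sum: "finite I \<Longrightarrow> (\<And>i. i \<in> I \<Longrightarrow> f i \<in> L) \<Longrightarrow> sum f I \<in> L"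
  by (induction I rule: finite_induct) (auto simp: discrete_subgroup_0 discrete_subgroup_add)

lemma discrete_subgroup_finite: "finite (L \<inter> cball 0 R)"
proof -
  obtain r where r: "r > 0" "\<forall>x\<in>L. x \<noteq> 0 \<longrightarrow> r \<le> norm x"
    using L by (auto simp: discrete_subgroup_def)
  have "uniform_discrete L"
    unfolding uniform_discrete_def using r discrete_subgroup_diff by (metis dist_norm not_le right_minus_eq)
  then have "uniform_discrete (L \<inter> cball 0 R)" by (rule uniform_discrete_subset) blast
  then show ?thesis using uniform_discrete_finite_iff by (metis bounded_Int bounded_cball)
qed

lemma discrete_subgroup_countable: "countable L"
proof -
  have "L = (\<Union>n. L \<inter> cball 0 (real n))"
    using real_arch_simple by fastforce
  moreover have "countable (\<Union>n. L \<inter> cball 0 (real n))"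
    using discrete_subgroup_finite by (intro countable_UN) (auto intro: countable_finite)
  ultimately show ?thesis by simp
qed

text \<open>
  Intersect balls of radius less than half the shortest length in \<open>L\<close>, centred at a countable
  dense set, with \<open>V\<close>; keep of each piece only what is not an \<open>L\<close>-translate of an
  earlier piece. Every orbit is met, by minimality of the index, and met only once, by the choice of the
  radius.
\<close>

lemma fundamental_domain_exists:
  assumes V: "subspace V" "L \<subseteq> V"
  shows "\<exists>F. fundamental_domain V L F"
proof -
  obtain r where r: "r > 0" "\<And>x. x \<in> L \<Longrightarrow> x \<noteq> 0 \<Longrightarrow> r \<le> norm x"
    using L by (auto simp: discrete_subgroup_def)
  obtain D :: "'a set" where D: "countable D" "D \<noteq> {}" "\<And>U. open U \<Longrightarrow> U \<noteq> {} \<Longrightarrow> \<exists>y \<in> D. y \<in> U"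
    using countable_dense_exists by blast
  define q where "q = from_nat_into D"
  have q: "range q = D" unfolding q_def using D by (simp add: range_from_nat_into)
  have [measurable]: "V \<in> sets borel" using closed_subspace[OF V(1)] by (rule borel_closed)
  define B where "B n = ball (q n) (r/2) \<inter> V" for n
  have [measurable]: "B n \<in> sets borel" for n unfolding B_def by measurable
  define T where "T n = (\<Union>v\<in>L. {x. x - v \<in> B n})" for n
  have "{x. x - v \<in> B n} \<in> sets borel" for v n by measurable
  then have [measurable]: "T n \<in> sets borel" for n
    unfolding T_def by (intro sets.countable_UN'[OF discrete_subgroup_countable]) auto
  define F where "F = (\<Union>n. B n - (\<Union>j<n. T j))"
  have "F \<in> sets borel" unfolding F_def by measurable
  moreover have "F \<subseteq> V" unfolding F_def B_def by blast
  moreover have "\<exists>!v. v \<in> L \<and> x - v \<in> F" if x: "x \<in> V" for x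
  proof (rule ex_ex1I)
    obtain d where "d \<in> D" "d \<in> ball x (r/2)" using D(3)[of "ball x (r/2)"] r by auto
    then obtain n0 where "x \<in> B n0" using q x by (auto simp: B_def dist_commute)
    then have "\<exists>n. x \<in> T n" unfolding T_def using discrete_subgroup_0 by force
    then obtain n where n: "x \<in> T n" "\<And>j. j < n \<Longrightarrow> x \<notin> T j"
      using exists_least_iff[of "\<lambda>n. x \<in> T n"] by blast
    then obtain v where v: "v \<in> L" "x - v \<in> B n" unfolding T_def by blast
    have "x - v \<notin> T j" if "j < n" for j
    proof
      assume "x - v \<in> T j"
      then obtain w where "w \<in> L" "x - v - w \<in> B j" unfolding T_def by blast
      then have "x \<in> T j" unfolding T_def
        using discrete_subgroup_add[OF v(1)] by (auto simp: diff_diff_eq)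
      then show False using n(2) that by blast
    qed
    then show "\<exists>v. v \<in> L \<and> x - v \<in> F" using v unfolding F_def by blast
  next
    fix v w assume vw: "v \<in> L \<and> x - v \<in> F" "w \<in> L \<and> x - w \<in> F"
    then obtain n m where n: "x - v \<in> B n" "\<And>j. j < n \<Longrightarrow> x - v \<notin> T j"
      and m: "x - w \<in> B m" "\<And>j. j < m \<Longrightarrow> x - w \<notin> T j" unfolding F_def by blast
    have "x - w \<in> T n" unfolding T_def
      using n(1) discrete_subgroup_diff[of v w] vw by force
    moreover have "x - v \<in> T m" unfolding T_def
      using m(1) discrete_subgroup_diff[of w v] vw by force
    ultimately have "n = m" using n(2) m(2) by (meson nat_neq_iff)
    then have "dist (q n) (x - v) < r/2" "dist (q n) (x - w) < r/2" using n m by (auto simp: B_def)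
    then have "dist (x - v) (x - w) < r" by (rule dist_triangle_half_r)
    then have "norm (v - w) < r" by (simp add: dist_norm norm_minus_commute)
    then show "v = w" using r(2)[of "v - w"] discrete_subgroup_diff[of v w] vw by force
  qed
  ultimately have "fundamental_domain V L F"
    unfolding fundamental_domain_def by (intro conjI ballI)
  then show ?thesis ..
qed

end

lemma lborel_eq_distr_PiM:
  fixes e :: "'n::finite \<Rightarrow> 'b"
  assumes e: "inj e"
  shows "(lborel :: (real^'n) measure) = distr (\<Pi>\<^sub>M b\<in>range e. lborel) borel (\<lambda>f. \<chi> i. f (e i))"
    (is "_ = ?M")
proof (rule lborel_eqI)
  interpret product_sigma_finite "\<lambda>_::'b. lborel::real measure" ..
  have meas: "(\<lambda>f. \<chi> i. f (e i) :: real^'n) \<in> borel_measurable (\<Pi>\<^sub>M b\<in>range e. (lborel::real measure))"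
    by (subst borel_measurable_euclidean_space) (auto simp: Basis_vec_def inner_axis)
  show "sets ?M = sets borel" by simp
  fix l u :: "real^'n" assume lu: "\<And>b. b \<in> Basis \<Longrightarrow> l \<bullet> b \<le> u \<bullet> b"
  have le: "l $ i \<le> u $ i" for i
    using lu[of "axis i 1"] by (auto simp: inner_axis axis_in_Basis_iff)
  have "emeasure ?M (box l u) = emeasure (\<Pi>\<^sub>M b\<in>range e. lborel)
      (PiE (range e) (\<lambda>b. {l $ (inv e b) <..< u $ (inv e b)}))"
    by (subst emeasure_distr[OF meas]) (auto simp: space_PiM mem_box_cart PiE_iff e intro!: arg_cong2[where f=emeasure])
  also have "\<dots> = (\<Prod>b\<in>range e. emeasure lborel {l $ (inv e b) <..< u $ (inv e b)})"
    by (rule emeasure_PiM) auto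
  also have "\<dots> = (\<Prod>i\<in>UNIV. ennreal (u $ i - l $ i))"
    using e le by (subst prod.reindex) auto
  also have "\<dots> = ennreal (\<Prod>i\<in>UNIV. u $ i - l $ i)"
    using le by (subst prod_ennreal) auto
  also have "\<dots> = emeasure lborel (box l u)"
    using le by (simp add: emeasure_box_vec)
  also have "\<dots> = (\<Prod>b\<in>Basis. (u - l) \<bullet> b)"
    using lu by (subst emeasure_lborel_box) auto
  finally show "emeasure ?M (box l u) = (\<Prod>b\<in>Basis. (u - l) \<bullet> b)" .
qed

lemma frame_replace:
  assumes V: "frame P V F" and e: "\<And>i. i \<in> P \<Longrightarrow> e i \<in> V"
    and o: "\<And>i j. i \<in> P \<Longrightarrow> j \<in> P \<Longrightarrow> e i \<bullet> e j = (if i = j then 1 else 0)"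
  shows "frame P V (\<chi> i. if i \<in> P then e i else F $ i)"
proof -
  have F: "F $ i \<bullet> F $ j = (if i = j then 1 else 0)" for i j
    using V by (auto simp: frame_def orthogonal_matrix_rows)
  have "F $ i \<bullet> e j = 0" "e j \<bullet> F $ i = 0" if "i \<notin> P" "j \<in> P" for i j
    using V e that by (auto simp: frame_def inner_commute)
  then have "orthogonal_matrix (\<chi> i. if i \<in> P then e i else F $ i)"
    using o F by (auto simp: orthogonal_matrix_rows)
  then show ?thesis using V e by (auto simp: frame_def)
qed

text \<open>
  Both sides are the orthogonal projection of \<open>x\<close> along the common rows outside \<open>P\<close>.
\<close>

lemma frame_proj_eq:
  fixes F E :: "real^'n^'n"
  assumes F: "orthogonal_matrix F" and E: "orthogonal_matrix E" and eq: "\<And>i. i \<notin> P \<Longrightarrow> E $ i = F $ i"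
  shows "(\<Sum>i\<in>P. (F $ i \<bullet> x) *\<^sub>R F $ i) = (\<Sum>i\<in>P. (E $ i \<bullet> x) *\<^sub>R E $ i)"
proof -
  have *: "x = (\<Sum>i\<in>P. (G $ i \<bullet> x) *\<^sub>R G $ i) + (\<Sum>i\<in>-P. (G $ i \<bullet> x) *\<^sub>R G $ i)"
    if "orthogonal_matrix G" for G
  proof -
    have "x = (\<Sum>i\<in>UNIV. (G $ i \<bullet> x) *\<^sub>R G $ i)" by (rule orthogonal_matrix_expand[OF that])
    also have "\<dots> = (\<Sum>i\<in>P \<union> (-P). (G $ i \<bullet> x) *\<^sub>R G $ i)" by simp
    also have "\<dots> = (\<Sum>i\<in>P. (G $ i \<bullet> x) *\<^sub>R G $ i) + (\<Sum>i\<in>-P. (G $ i \<bullet> x) *\<^sub>R G $ i)"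
      by (rule sum.union_disjoint) auto
    finally show ?thesis .
  qed
  have "(\<Sum>i\<in>P. (F $ i \<bullet> x) *\<^sub>R F $ i) = x - (\<Sum>i\<in>-P. (F $ i \<bullet> x) *\<^sub>R F $ i)"
    unfolding eq_diff_eq by (rule *[OF F, symmetric])
  also have "(\<Sum>i\<in>-P. (F $ i \<bullet> x) *\<^sub>R F $ i) = (\<Sum>i\<in>-P. (E $ i \<bullet> x) *\<^sub>R E $ i)"
    by (rule sum.cong) (auto simp: eq)
  also have "x - \<dots> = (\<Sum>i\<in>P. (E $ i \<bullet> x) *\<^sub>R E $ i)"
    unfolding diff_eq_eq by (rule *[OF E])
  finally show ?thesis .
qed

lemma frame_card:
  fixes F :: "real^'n^'n"
  assumes V: "subspace V" and F: "frame P V F"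
  shows "inj_on (\<lambda>i. F $ i) P" "span ((\<lambda>i. F $ i) ` P) = V" "independent ((\<lambda>i. F $ i) ` P)" "card P = dim V"
proof -
  have o: "F $ i \<bullet> F $ j = (if i = j then 1 else 0)" for i j
    using F by (auto simp: frame_def orthogonal_matrix_rows)
  show inj: "inj_on (\<lambda>i. F $ i) P" using o by (metis inj_onI zero_neq_one)
  show sp: "span ((\<lambda>i. F $ i) ` P) = V"
  proof
    show "span ((\<lambda>i. F $ i) ` P) \<subseteq> V"
      using F V by (intro span_minimal) (auto simp: frame_def)
    show "V \<subseteq> span ((\<lambda>i. F $ i) ` P)"
    proof
      fix v assume "v \<in> V"
      then have "v = (\<Sum>i\<in>P. (F $ i \<bullet> v) *\<^sub>R F $ i)" by (rule frame_expand[OF F])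
      moreover have "(\<Sum>i\<in>P. (F $ i \<bullet> v) *\<^sub>R F $ i) \<in> span ((\<lambda>i. F $ i) ` P)"
        by (intro span_sum span_scale span_base) auto
      ultimately show "v \<in> span ((\<lambda>i. F $ i) ` P)" by simp
    qed
  qed
  show ind: "independent ((\<lambda>i. F $ i) ` P)"
  proof (rule pairwise_orthogonal_independent)
    show "pairwise orthogonal ((\<lambda>i. F $ i) ` P)"
      using o by (auto simp: pairwise_def orthogonal_def split: if_splits)
    show "0 \<notin> (\<lambda>i. F $ i) ` P" using o by (metis imageE inner_zero_left zero_neq_one)
  qed
  have "dim V = card ((\<lambda>i. F $ i) ` P)"
    using sp ind V by (intro dim_eq_card) (simp_all add: span_eq_iff[THEN iffD2])
  then show "card P = dim V" using inj by (simp add: card_image)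
qed

text \<open>
  The product structure of Lebesgue measure: thickening a subset of \<open>V\<close> by a unit cube in the
  orthogonal complement turns volume in \<open>V\<close> into volume in the ambient space. From here on only
  \<open>lborel\<close> is used.
\<close>

lemma emeasure_lborel_subspace:
  fixes F :: "real^'n^'n"
  assumes V: "subspace V" and F: "frame P V F" and S[measurable]: "S \<in> sets borel"
  shows "emeasure (lborel_subspace V) S =
    emeasure lborel {x. (\<Sum>i\<in>P. (F $ i \<bullet> x) *\<^sub>R F $ i) \<in> S \<and> (\<forall>i\<in>-P. 0 \<le> F $ i \<bullet> x \<and> F $ i \<bullet> x < 1)}"
proof -
  define B where "B = (SOME B. orthonormal_basis V B)"
  have "\<exists>B. orthonormal_basis V B"
    unfolding orthonormal_basis_def using orthonormal_basis_subspace[OF V] by metis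
  then have B: "orthonormal_basis V B" unfolding B_def by (rule someI_ex)
  have Bo: "b \<bullet> c = (if b = c then 1 else 0)" if "b \<in> B" "c \<in> B" for b c
    using B that by (auto simp: orthonormal_basis_def pairwise_def orthogonal_def dot_square_norm)
  have "0 \<notin> B" using B by (auto simp: orthonormal_basis_def)
  then have indB: "independent B" using B by (intro pairwise_orthogonal_independent) (auto simp: orthonormal_basis_def)
  have finB: "finite B" using indB independent_imp_finite by blast
  have "dim V = card B" using indB B by (intro dim_eq_card) (auto simp: orthonormal_basis_def span_span)
  then have "card P = card B" using frame_card(4)[OF V F] by simp
  then obtain f where f: "bij_betw f P B" using finite_same_card_bij[of P B] finB by auto
  have BV: "B \<subseteq> V" using B span_superset by (auto simp: orthonormal_basis_def)
  define E where "E = (\<chi> i. if i \<in> P then f i else F $ i)"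
  have "frame P V E" unfolding E_def
  proof (rule frame_replace[OF F])
    show "f i \<in> V" if "i \<in> P" for i using f that BV by (auto simp: bij_betw_def)
    show "f i \<bullet> f j = (if i = j then 1 else 0)" if "i \<in> P" "j \<in> P" for i j
      using Bo[of "f i" "f j"] f that by (auto simp: bij_betw_def inj_on_def)
  qed
  then have E: "orthogonal_matrix E" and Ef: "frame P V E" by (auto simp: frame_def)
  have Eo: "E $ i \<bullet> E $ j = (if i = j then 1 else 0)" for i j
    using E by (auto simp: orthogonal_matrix_rows)
  have injE: "inj (\<lambda>i. E $ i)" using Eo by (metis injI zero_neq_one)
  have imP: "(\<lambda>i. E $ i) ` P = B" using f by (auto simp: E_def bij_betw_def)
  define C where "C = (\<lambda>i. E $ i) ` (-P)"
  have R: "range (\<lambda>i. E $ i) = B \<union> C" unfolding C_def imP[symmetric] by (metis image_Un Compl_partition)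
  have BC: "B \<inter> C = {}" unfolding C_def imP[symmetric] using injE by (auto simp: inj_def)
  define T :: "(real^'n) set" where "T = {y. (\<Sum>i\<in>P. y $ i *\<^sub>R E $ i) \<in> S \<and> (\<forall>i\<in>-P. 0 \<le> y $ i \<and> y $ i < 1)}"
  have [measurable]: "(\<lambda>y::real^'n. y $ i) \<in> borel_measurable borel" for i
    by (intro borel_measurable_continuous_onI continuous_intros)
  have T[measurable]: "T \<in> sets borel" unfolding T_def by measurable
  have "{x. (\<Sum>i\<in>P. (F $ i \<bullet> x) *\<^sub>R F $ i) \<in> S \<and> (\<forall>i\<in>-P. 0 \<le> F $ i \<bullet> x \<and> F $ i \<bullet> x < 1)} = {x. E *v x \<in> T}"
    using frame_proj_eq[of F E P] F E by (auto simp: T_def matrix_vector_mult_row E_def frame_def)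
  then have "emeasure lborel {x. (\<Sum>i\<in>P. (F $ i \<bullet> x) *\<^sub>R F $ i) \<in> S \<and> (\<forall>i\<in>-P. 0 \<le> F $ i \<bullet> x \<and> F $ i \<bullet> x < 1)}
    = emeasure lborel T" using emeasure_orthogonal_matrix[OF E T] by simp
  also have "\<dots> = emeasure (distr (\<Pi>\<^sub>M b\<in>B \<union> C. lborel) borel (\<lambda>f. \<chi> i. f (E $ i))) T"
    using lborel_eq_distr_PiM[OF injE] unfolding R by simp
  also have "\<dots> = emeasure (\<Pi>\<^sub>M b\<in>B \<union> C. lborel) ((\<lambda>f. \<chi> i. f (E $ i)) -` T \<inter> space (\<Pi>\<^sub>M b\<in>B \<union> C. (lborel::real measure)))"
  proof (rule emeasure_distr)
    have "E $ i \<in> B \<union> C" for i using R by blast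
    then show "(\<lambda>f. \<chi> i. f (E $ i) :: real^'n) \<in> borel_measurable (\<Pi>\<^sub>M b\<in>B \<union> C. (lborel::real measure))"
      by (subst borel_measurable_euclidean_space) (auto simp: Basis_vec_def inner_axis)
  qed simp
  also have "\<dots> = emeasure ((\<Pi>\<^sub>M b\<in>B. (lborel::real measure)) \<Otimes>\<^sub>M (\<Pi>\<^sub>M b\<in>C. (lborel::real measure)))
    ({f \<in> space (\<Pi>\<^sub>M b\<in>B. (lborel::real measure)). (\<Sum>b\<in>B. f b *\<^sub>R b) \<in> S} \<times> (PiE C (\<lambda>_. {0..<1})))" (is "emeasure ?M1 ?S1 = emeasure ?M2 ?S2")
  proof -
    interpret product_sigma_finite "\<lambda>_::real^'n. lborel::real measure" ..
    have S1: "?S1 \<in> sets ?M1"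
    proof (rule measurable_sets[where A=borel])
      have "E $ i \<in> B \<union> C" for i using R by blast
      then show "(\<lambda>f. \<chi> i. f (E $ i) :: real^'n) \<in> borel_measurable (\<Pi>\<^sub>M b\<in>B \<union> C. (lborel::real measure))"
        by (subst borel_measurable_euclidean_space) (auto simp: Basis_vec_def inner_axis)
    qed simp
    have fC: "finite C" unfolding C_def by simp
    have "emeasure ?M1 ?S1 = emeasure (distr ?M2 ?M1 (merge B C)) ?S1"
      using distr_merge[OF BC finB fC] by simp
    also have "\<dots> = emeasure ?M2 (merge B C -` ?S1 \<inter> space ?M2)"
      using S1 by (intro emeasure_distr) auto
    also have "merge B C -` ?S1 \<inter> space ?M2 = ?S2"
    proof -
      have sum: "(\<Sum>i\<in>P. merge B C p (E $ i) *\<^sub>R E $ i) = (\<Sum>b\<in>B. fst p b *\<^sub>R b)" for p :: "(real^'n \<Rightarrow> real) \<times> (real^'n \<Rightarrow> real)"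
      proof -
        have "(\<Sum>b\<in>B. fst p b *\<^sub>R b) = (\<Sum>i\<in>P. fst p (E $ i) *\<^sub>R E $ i)"
          unfolding imP[symmetric] using injE by (subst sum.reindex) (auto simp: inj_on_def inj_def)
        also have "\<dots> = (\<Sum>i\<in>P. merge B C p (E $ i) *\<^sub>R E $ i)"
          using imP by (intro sum.cong) (auto simp: merge_def split: prod.splits)
        finally show ?thesis ..
      qed
      have mc: "merge B C p (E $ i) = snd p (E $ i)" if "i \<notin> P" for i and p :: "(real^'n \<Rightarrow> real) \<times> (real^'n \<Rightarrow> real)"
        using that BC by (auto simp: merge_def C_def split: prod.splits)
      have sp: "merge B C p \<in> space ?M1" if "p \<in> space ?M2" for p
        using that by (auto simp: space_pair_measure space_PiM)
      show ?thesis
      proof (rule set_eqI)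
        fix p :: "(real^'n \<Rightarrow> real) \<times> (real^'n \<Rightarrow> real)"
        have 1: "merge B C p \<in> ?S1 \<longleftrightarrow> (\<Sum>b\<in>B. fst p b *\<^sub>R b) \<in> S \<and> (\<forall>i\<in>-P. 0 \<le> snd p (E $ i) \<and> snd p (E $ i) < 1)"
          if "p \<in> space ?M2"
          using sp[OF that] mc[of _ p] by (simp add: T_def sum)
        have 2: "p \<in> space ?M2 \<longleftrightarrow> fst p \<in> extensional B \<and> snd p \<in> extensional C"
          by (cases p) (simp add: space_pair_measure space_PiM PiE_def)
        have 3: "p \<in> ?S2 \<longleftrightarrow> fst p \<in> extensional B \<and> (\<Sum>b\<in>B. fst p b *\<^sub>R b) \<in> S \<and> snd p \<in> extensional C \<and> (\<forall>b\<in>C. 0 \<le> snd p b \<and> snd p b < 1)"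
          by (cases p) (auto simp: space_PiM PiE_def Pi_def)
        have 4: "(\<forall>b\<in>C. 0 \<le> snd p b \<and> snd p b < 1) \<longleftrightarrow> (\<forall>i\<in>-P. 0 \<le> snd p (E $ i) \<and> snd p (E $ i) < 1)"
          by (simp add: C_def)
        show "p \<in> merge B C -` ?S1 \<inter> space ?M2 \<longleftrightarrow> p \<in> ?S2"
        proof (cases "p \<in> space ?M2")
          case True
          then show ?thesis unfolding Int_iff[of p] vimage_eq[of p] 3 4 1[OF True] using 2 by blast
        next
          case False
          then show ?thesis unfolding Int_iff[of p] vimage_eq[of p] 3 using 2 by blast
        qed
      qed
    qed
    finally show ?thesis .
  qed
  also have "\<dots> = emeasure (\<Pi>\<^sub>M b\<in>B. (lborel::real measure)) {f \<in> space (\<Pi>\<^sub>M b\<in>B. (lborel::real measure)). (\<Sum>b\<in>B. f b *\<^sub>R b) \<in> S}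
     * emeasure (\<Pi>\<^sub>M b\<in>C. (lborel::real measure)) (PiE C (\<lambda>_. {0..<1}))"
  proof -
    interpret product_sigma_finite "\<lambda>_::real^'n. lborel::real measure" ..
    interpret C: finite_product_sigma_finite "\<lambda>_::real^'n. lborel::real measure" C
      by standard (simp add: C_def)
    show ?thesis by (intro C.emeasure_pair_measure_Times sets_PiM_I_finite) (measurable, auto simp: C_def)
  qed
  also have "emeasure (\<Pi>\<^sub>M b\<in>C. (lborel::real measure)) (PiE C (\<lambda>_. {0..<1})) = 1"
  proof -
    interpret product_sigma_finite "\<lambda>_::real^'n. lborel::real measure" ..
    show ?thesis by (subst emeasure_PiM) (auto simp: C_def)
  qed
  also have "emeasure (\<Pi>\<^sub>M b\<in>B. (lborel::real measure)) {f \<in> space (\<Pi>\<^sub>M b\<in>B. (lborel::real measure)). (\<Sum>b\<in>B. f b *\<^sub>R b) \<in> S}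
     = emeasure (lborel_subspace V) S"
    unfolding lborel_subspace_def B_def[symmetric] Let_def
    by (subst emeasure_distr) (auto simp: vimage_def Int_def conj_commute)
  finally show ?thesis by simp
qed

section \<open>Determinants, successive minima and coverings\<close>

lemma det_nz_kernel:
  fixes A :: "real^'n^'n"
  shows "det A \<noteq> 0 \<longleftrightarrow> (\<forall>x. A *v x = 0 \<longrightarrow> x = 0)"
  using invertible_det_nz[of A] invertible_left_inverse[of A] matrix_left_invertible_ker[of A] by metis

text \<open>
  A substitute for Hadamard's inequality that loses a factorial, a loss that exponential growth rates do not
  see.
\<close>

lemma det_leibniz_bound:
  fixes M :: "real^'n^'n"
  assumes "\<And>i j. \<bar>M $ i $ j\<bar> \<le> B i"
  shows "\<bar>det M\<bar> \<le> fact CARD('n) * (\<Prod>i\<in>UNIV. B i)"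
proof -
  let ?S = "{p. p permutes (UNIV :: 'n set)}"
  have "\<bar>det M\<bar> \<le> (\<Sum>p\<in>?S. \<bar>of_int (sign p) * (\<Prod>i\<in>UNIV. M $ i $ p i)\<bar>)"
    unfolding det_def by (rule sum_abs)
  also have "\<dots> \<le> (\<Sum>p\<in>?S. \<Prod>i\<in>UNIV. B i)"
  proof (rule sum_mono)
    fix p assume "p \<in> ?S"
    have "\<bar>of_int (sign p) * (\<Prod>i\<in>UNIV. M $ i $ p i)\<bar> = (\<Prod>i\<in>UNIV. \<bar>M $ i $ p i\<bar>)"
      by (simp add: abs_mult abs_prod sign_def)
    also have "\<dots> \<le> (\<Prod>i\<in>UNIV. B i)" using assms by (intro prod_mono) auto
    finally show "\<bar>of_int (sign p) * (\<Prod>i\<in>UNIV. M $ i $ p i)\<bar> \<le> (\<Prod>i\<in>UNIV. B i)" .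
  qed
  also have "\<dots> = fact CARD('n) * (\<Prod>i\<in>UNIV. B i)"
    by (simp add: card_permutations[of UNIV "CARD('n)"])
  finally show ?thesis .
qed

text \<open>
  One of the \<open>N!\<close> terms of the Leibniz formula is at least the average.
\<close>

lemma det_large_permutation:
  fixes M :: "real^'n^'n"
  shows "\<exists>p. p permutes UNIV \<and> \<bar>det M\<bar> \<le> fact CARD('n) * (\<Prod>i\<in>UNIV. \<bar>M $ i $ p i\<bar>)"
proof (rule ccontr)
  let ?S = "{p. p permutes (UNIV :: 'n set)}"
  assume "\<not> ?thesis"
  then have *: "fact CARD('n) * (\<Prod>i\<in>UNIV. \<bar>M $ i $ p i\<bar>) < \<bar>det M\<bar>" if "p \<in> ?S" for p
    using that by (auto simp: not_le)
  have "\<bar>det M\<bar> \<le> (\<Sum>p\<in>?S. \<bar>of_int (sign p) * (\<Prod>i\<in>UNIV. M $ i $ p i)\<bar>)"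
    unfolding det_def by (rule sum_abs)
  also have "\<dots> = (\<Sum>p\<in>?S. \<Prod>i\<in>UNIV. \<bar>M $ i $ p i\<bar>)"
    by (intro sum.cong) (auto simp: abs_mult abs_prod sign_def)
  also have "\<dots> < (\<Sum>p\<in>?S. \<bar>det M\<bar> / fact CARD('n))"
  proof (rule sum_strict_mono)
    show "finite ?S" by (simp add: finite_permutations)
    show "?S \<noteq> {}" using permutes_id by blast
    show "(\<Prod>i\<in>UNIV. \<bar>M $ i $ p i\<bar>) < \<bar>det M\<bar> / fact CARD('n)" if "p \<in> ?S" for p
      using *[OF that] by (simp add: field_simps)
  qed
  also have "\<dots> = \<bar>det M\<bar>"
    by (simp add: card_permutations[of UNIV "CARD('n)"])
  finally show False by simp
qed

text \<open>
  Matrices in which the rows in \<open>P\<close> are prescribed. Linear independence of the rows \<open>X $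
  i\<close>, \<open>i \<in> P\<close>, is expressed below by the existence of some \<open>Y\<close> with
  \<open>det (mix P X Y) \<noteq> 0\<close>, which is visibly an open condition on \<open>X\<close>.
\<close>

definition mix :: "'n set \<Rightarrow> real^'n^'n \<Rightarrow> real^'n^'n \<Rightarrow> real^'n^'n" where
  "mix P X Y = (\<chi> i. if i \<in> P then X $ i else Y $ i)"

lemma mix_nth [simp]: "mix P X Y $ i = (if i \<in> P then X $ i else Y $ i)"
  by (simp add: mix_def)

lemma det_mix_frame_nz:
  assumes F: "frame P (span ((\<lambda>i. X $ i) ` P)) F"
  shows "det (mix P X F) \<noteq> 0"
  unfolding det_nz_kernel
proof (intro allI impI)
  fix x assume x0: "mix P X F *v x = 0"
  have x: "(if i \<in> P then X $ i else F $ i) \<bullet> x = 0" for i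
    using arg_cong[OF x0, of "\<lambda>v. v $ i"] unfolding matrix_vector_mult_row mix_nth zero_index .
  have "orthogonal x v" if "v \<in> span ((\<lambda>i. X $ i) ` P)" for v
  proof (rule orthogonal_to_span[OF that])
    fix y assume "y \<in> (\<lambda>i. X $ i) ` P"
    then obtain i where "i \<in> P" "y = X $ i" by blast
    then show "orthogonal x y" using x[of i] by (simp add: orthogonal_def inner_commute)
  qed
  then have ortho: "v \<bullet> x = 0" if "v \<in> span ((\<lambda>i. X $ i) ` P)" for v
    using that by (metis orthogonal_def inner_commute)
  have "F $ i \<bullet> x = 0" for i
  proof (cases "i \<in> P")
    case True
    then show ?thesis using F by (intro ortho) (simp add: frame_def)
  next
    case False
    then show ?thesis using x[of i] by simp
  qed
  then have "(norm x)\<^sup>2 = 0"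
    using orthogonal_matrix_parseval[of F x] F by (simp add: frame_def)
  then show "x = 0" by simp
qed

lemma det_mix_independent:
  fixes X Y :: "real^'n^'n"
  assumes nz: "det (mix P X Y) \<noteq> 0"
  shows "dim (span ((\<lambda>i. X $ i) ` P)) = card P"
proof -
  let ?M = "mix P X Y"
  have sp: "span (range (\<lambda>i. ?M $ i)) = UNIV"
  proof (rule ccontr)
    assume "span (range (\<lambda>i. ?M $ i)) \<noteq> UNIV"
    then obtain a where a: "a \<noteq> 0" "span (range (\<lambda>i. ?M $ i)) \<subseteq> {x. a \<bullet> x = 0}"
      using span_not_univ_subset_hyperplane by blast
    have "a \<bullet> ?M $ i = 0" for i using a(2) span_base[of "?M $ i" "range (\<lambda>i. ?M $ i)"] by blast
    then have "?M *v a = 0" by (simp only: vec_eq_iff matrix_vector_mult_row inner_commute zero_index) simp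
    then show False using nz a(1) det_nz_kernel by blast
  qed
  have cd: "card (range (\<lambda>i. ?M $ i)) \<le> CARD('n)" by (rule card_image_le) simp
  have ind: "independent (range (\<lambda>i. ?M $ i))"
    by (rule card_le_dim_spanning[of _ UNIV]) (use sp cd in \<open>auto\<close>)
  have "card (range (\<lambda>i. ?M $ i)) = CARD('n)"
    using ind sp indep_card_eq_dim_span[OF ind] by (metis DIM_cart DIM_real dim_UNIV mult.right_neutral)
  then have inj: "inj (\<lambda>i. ?M $ i)" by (simp add: eq_card_imp_inj_on)
  have eq: "(\<lambda>i. X $ i) ` P = (\<lambda>i. ?M $ i) ` P" by auto
  have "independent ((\<lambda>i. X $ i) ` P)" unfolding eq by (rule independent_mono[OF ind]) auto
  then have "dim (span ((\<lambda>i. X $ i) ` P)) = card ((\<lambda>i. X $ i) ` P)" by (rule dim_span_eq_card_independent)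
  also have "\<dots> = card P" unfolding eq using inj by (intro card_image) (auto simp: inj_def inj_on_def)
  finally show ?thesis .
qed

text \<open>
  Induction on \<open>P\<close>, each step taking a shortest vector of \<open>L\<close> outside the span of
  the vectors already chosen and applying the Gram-Schmidt process. The last conjunct is the minimality: a
  vector of \<open>L\<close> lies in the span of those chosen vectors that are not longer than itself.
\<close>

lemma successive_minima:
  fixes L :: "(real^'n) set" and P :: "'n set"
  assumes L: "discrete_subgroup L" and P: "card P \<le> dim (span L)"
  shows "\<exists>f m. (\<forall>i\<in>P. m i \<in> L \<and> m i \<noteq> 0) \<and> (\<forall>i\<in>P. \<forall>j\<in>P. f i \<bullet> f j = (if i = j then 1 else 0))
    \<and> span (f ` P) = span (m ` P)
    \<and> (\<forall>x\<in>L. x \<in> span (f ` {i\<in>P. norm (m i) \<le> norm x}) \<or> (\<forall>i\<in>P. norm (m i) \<le> norm x))"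
proof -
  have "finite P" by simp
  then show ?thesis using P
  proof (induction P rule: finite_induct)
    case empty
    show ?case by auto
  next
    case (insert i0 P)
    then obtain f m where m: "\<forall>i\<in>P. m i \<in> L \<and> m i \<noteq> 0"
      and f: "\<forall>i\<in>P. \<forall>j\<in>P. f i \<bullet> f j = (if i = j then 1 else 0)"
      and sp: "span (f ` P) = span (m ` P)"
      and mn: "\<forall>x\<in>L. x \<in> span (f ` {i\<in>P. norm (m i) \<le> norm x}) \<or> (\<forall>i\<in>P. norm (m i) \<le> norm x)"
      by force
    have "dim (span (f ` P)) \<le> card (f ` P)" using insert.hyps by (simp add: dim_le_card')
    also have "\<dots> \<le> card P" using insert.hyps by (simp add: card_image_le)
    finally have "dim (span (f ` P)) < dim (span L)" using insert by simp
    then have "\<not> L \<subseteq> span (f ` P)" by (metis dim_span dim_subset not_le)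
    then obtain x0 where x0: "x0 \<in> L" "x0 \<notin> span (f ` P)" by blast
    \<comment> \<open>A shortest vector outside the span is found in a finite set, bounded by any one such vector.\<close>
    define A where "A = (L \<inter> cball 0 (norm x0)) - span (f ` P)"
    have "finite A" unfolding A_def using discrete_subgroup_finite[OF L] by blast
    moreover have "A \<noteq> {}" unfolding A_def using x0 by auto
    ultimately obtain m0 where m0: "m0 \<in> A" and "norm m0 = Min (norm ` A)"
      by (metis (no_types) Min_in finite_imageI image_iff image_is_empty)
    then have m0min: "norm m0 \<le> norm y" if "y \<in> A" for y
      using \<open>finite A\<close> that by simp
    have m0L: "m0 \<in> L" "m0 \<notin> span (f ` P)" "norm m0 \<le> norm x0" using m0 by (auto simp: A_def)
    define s where "s = (\<Sum>i\<in>P. (f i \<bullet> m0) *\<^sub>R f i)"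
    have s: "s \<in> span (f ` P)" unfolding s_def by (intro span_sum span_scale span_base) auto
    define u where "u = m0 - s"
    have u0: "u \<noteq> 0" using s m0L by (auto simp: u_def)
    have fu: "f j \<bullet> u = 0" if "j \<in> P" for j
    proof -
      have "f j \<bullet> s = (\<Sum>i\<in>P. (f i \<bullet> m0) * (f j \<bullet> f i))" unfolding s_def by (simp add: inner_sum_right)
      also have "\<dots> = (\<Sum>i\<in>P. (if i = j then f i \<bullet> m0 else 0))" using f that by (intro sum.cong) auto
      also have "\<dots> = f j \<bullet> m0" using that insert.hyps by simp
      finally show ?thesis by (simp add: u_def inner_diff_right)
    qed
    define f0 where "f0 = u /\<^sub>R norm u"
    have f00: "f0 \<bullet> f0 = 1" using u0 by (simp add: f0_def dot_square_norm power2_eq_square)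
    have ff0: "f j \<bullet> f0 = 0" if "j \<in> P" for j using fu[OF that] by (simp add: f0_def)
    let ?f = "f(i0 := f0)" and ?m = "m(i0 := m0)"
    have imf: "?f ` Q = f ` Q" "?m ` Q = m ` Q" if "Q \<subseteq> P" for Q using insert.hyps that by (auto intro!: image_cong)
    have imfi: "?f ` insert i0 P = insert f0 (f ` P)" "?m ` insert i0 P = insert m0 (m ` P)"
      using imf[of P] by auto
    have 1: "\<forall>i\<in>insert i0 P. ?m i \<in> L \<and> ?m i \<noteq> 0"
      using m m0L span_zero[of "f ` P"] by auto
    have 2: "\<forall>i\<in>insert i0 P. \<forall>j\<in>insert i0 P. ?f i \<bullet> ?f j = (if i = j then 1 else 0)"
      using f f00 ff0 insert.hyps by (auto simp: inner_commute)
    have 3: "span (?f ` insert i0 P) = span (?m ` insert i0 P)"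
      unfolding imfi
    proof (rule antisym; rule span_minimal)
      have s': "s \<in> span (insert m0 (m ` P))" using s sp span_mono[of "m ` P" "insert m0 (m ` P)"] by auto
      have "m0 \<in> span (insert m0 (m ` P))" by (rule span_base) simp
      then have "f0 \<in> span (insert m0 (m ` P))" unfolding f0_def u_def using s' by (intro span_scale span_diff)
      moreover have "f ` P \<subseteq> span (insert m0 (m ` P))"
        using span_superset[of "f ` P"] sp span_mono[of "m ` P" "insert m0 (m ` P)"] by auto
      ultimately show "insert f0 (f ` P) \<subseteq> span (insert m0 (m ` P))" by auto
      have s'': "s \<in> span (insert f0 (f ` P))" using s span_mono[of "f ` P" "insert f0 (f ` P)"] by auto
      have "f0 \<in> span (insert f0 (f ` P))" by (rule span_base) simp
      then have "norm u *\<^sub>R f0 + s \<in> span (insert f0 (f ` P))" using s'' by (intro span_add span_scale)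
      moreover have "norm u *\<^sub>R f0 + s = m0" using u0 by (simp add: f0_def u_def)
      moreover have "m ` P \<subseteq> span (insert f0 (f ` P))"
        using span_superset[of "m ` P"] sp span_mono[of "f ` P" "insert f0 (f ` P)"] by auto
      ultimately show "insert m0 (m ` P) \<subseteq> span (insert f0 (f ` P))" by auto
    qed (rule subspace_span)+
    have 4: "x \<in> span (?f ` {i\<in>insert i0 P. norm (?m i) \<le> norm x}) \<or> (\<forall>i\<in>insert i0 P. norm (?m i) \<le> norm x)"
      if x: "x \<in> L" for x
    proof (cases "\<forall>i\<in>P. norm (m i) \<le> norm x")
      case True
      show ?thesis
      proof (cases "norm m0 \<le> norm x")
        case True2: True
        then show ?thesis using True by auto
      next
        case False
        then have "x \<notin> A" using m0min by auto
        then have xs: "x \<in> span (f ` P)" using x False m0L by (auto simp: A_def)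
        have fP: "f ` P = ?f ` P" by (rule imf(1)[symmetric]) simp
        have sub: "P \<subseteq> {i\<in>insert i0 P. norm (?m i) \<le> norm x}" using True insert.hyps by auto
        have "span (f ` P) \<subseteq> span (?f ` {i\<in>insert i0 P. norm (?m i) \<le> norm x})"
          unfolding fP by (intro span_mono image_mono sub)
        then show ?thesis using xs by blast
      qed
    next
      case False
      then have *: "x \<in> span (f ` {i\<in>P. norm (m i) \<le> norm x})" using mn x by blast
      have fP: "f ` {i\<in>P. norm (m i) \<le> norm x} = ?f ` {i\<in>P. norm (m i) \<le> norm x}" by (rule imf(1)[symmetric]) blast
      have sub: "{i\<in>P. norm (m i) \<le> norm x} \<subseteq> {i\<in>insert i0 P. norm (?m i) \<le> norm x}" using insert.hyps by auto
      have "span (f ` {i\<in>P. norm (m i) \<le> norm x}) \<subseteq> span (?f ` {i\<in>insert i0 P. norm (?m i) \<le> norm x})"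
        unfolding fP by (intro span_mono image_mono sub)
      then show ?thesis using * by blast
    qed
    show ?case 
    proof (rule exI[of _ ?f], rule exI[of _ ?m], intro conjI)
      show "\<forall>i\<in>insert i0 P. ?m i \<in> L \<and> ?m i \<noteq> 0" by (rule 1)
      show "\<forall>i\<in>insert i0 P. \<forall>j\<in>insert i0 P. ?f i \<bullet> ?f j = (if i = j then 1 else 0)" by (rule 2)
      show "span (?f ` insert i0 P) = span (?m ` insert i0 P)" by (rule 3)
      show "\<forall>x\<in>L. x \<in> span (?f ` {i\<in>insert i0 P. norm (?m i) \<le> norm x}) \<or> (\<forall>i\<in>insert i0 P. norm (?m i) \<le> norm x)"
        by (rule ballI) (rule 4)
    qed
  qed
qed

text \<open>
  By minimality a nonzero \<open>x \<in> L\<close> lies in the span of the frame vectors whose \<open>m $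
  i\<close> is not longer than \<open>x\<close>, and by Pythagoras one of its at most \<open>N\<close>
  coordinates there is at least \<open>norm x / N\<close>. So the box with sides proportional to \<open>norm
  (m $ i)\<close> contains no nonzero lattice vector: this is the half of Minkowski's second theorem that
  bounds the product of the minima by the covolume.
\<close>

lemma reduced_basis:
  fixes L :: "(real^'n) set" and P :: "'n set"
  assumes L: "discrete_subgroup L" and P: "card P = dim (span L)"
  shows "\<exists>F m. frame P (span L) F \<and> (\<forall>i\<in>P. m $ i \<in> L \<and> m $ i \<noteq> 0)
    \<and> span ((\<lambda>i. m $ i) ` P) = span L
    \<and> (\<forall>x\<in>L. x \<noteq> 0 \<longrightarrow> (\<exists>i\<in>P. norm (m $ i) \<le> CARD('n) * \<bar>F $ i \<bullet> x\<bar>))"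
proof -
  obtain f m where m: "\<forall>i\<in>P. m i \<in> L \<and> m i \<noteq> 0"
    and f: "\<forall>i\<in>P. \<forall>j\<in>P. f i \<bullet> f j = (if i = j then 1 else 0)"
    and sp: "span (f ` P) = span (m ` P)"
    and mn: "\<forall>x\<in>L. x \<in> span (f ` {i\<in>P. norm (m i) \<le> norm x}) \<or> (\<forall>i\<in>P. norm (m i) \<le> norm x)"
    using successive_minima[OF L eq_refl[OF P]] by blast
  have "\<exists>F0. frame P (span L) F0" by (rule frame_exists[OF subspace_span P])
  then obtain F0 where F0: "frame P (span L) F0" by (elim exE)
  define F where "F = (\<chi> i. if i \<in> P then f i else F0 $ i)"
  have fL: "f i \<in> span L" if "i \<in> P" for i
  proof -
    have "f i \<in> span (f ` P)" by (rule span_base) (use that in simp)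
    also have "\<dots> = span (m ` P)" by (rule sp)
    also have "\<dots> \<subseteq> span L" using m by (intro span_mono) auto
    finally show ?thesis .
  qed
  have F: "frame P (span L) F" unfolding F_def by (rule frame_replace[OF F0]) (use f fL in auto)
  have Ff: "(\<lambda>i. F $ i) ` Q = f ` Q" if "Q \<subseteq> P" for Q using that by (auto simp: F_def intro!: image_cong)
  have spL: "span (f ` P) = span L" using frame_card(2)[OF subspace_span F] Ff[of P] by simp
  have orth: "F $ i \<bullet> F $ j = (if i = j then 1 else 0)" for i j
    using F by (auto simp: frame_def orthogonal_matrix_rows)
  have key: "\<exists>i\<in>P. norm (m i) \<le> CARD('n) * \<bar>F $ i \<bullet> x\<bar>" if x: "x \<in> L" "x \<noteq> 0" for x
  proof (rule ccontr)
    assume neg: "\<not> ?thesis"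
    define Q where "Q = {i\<in>P. norm (m i) \<le> norm x}"
    have "x \<in> span (f ` Q)"
    proof (cases "\<forall>i\<in>P. norm (m i) \<le> norm x")
      case True
      then have "Q = P" by (auto simp: Q_def)
      then show ?thesis using spL x span_base[of x L] by simp
    next
      case False
      then show ?thesis using mn x by (auto simp: Q_def)
    qed
    then have xQ: "x \<in> span ((\<lambda>i. F $ i) ` Q)" using Ff[of Q] by (simp add: Q_def)
    have "orthogonal (F $ j) x" if "j \<notin> Q" for j
      using xQ by (rule orthogonal_to_span) (use that orth in \<open>auto simp: orthogonal_def\<close>)
    then have "(norm x)\<^sup>2 = (\<Sum>i\<in>Q. (F $ i \<bullet> x)\<^sup>2)"
      using orthogonal_matrix_parseval[of F x] F
      by (subst sum.mono_neutral_left[of UNIV Q]) (auto simp: frame_def orthogonal_def)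
    also have "\<dots> < (norm x)\<^sup>2"
    proof (cases "Q = {}")
      case True then show ?thesis using x by simp
    next
      case False
      have "(\<Sum>i\<in>Q. (F $ i \<bullet> x)\<^sup>2) < (\<Sum>i\<in>Q. (norm x / CARD('n))\<^sup>2)"
      proof (rule sum_strict_mono)
        fix i assume i: "i \<in> Q"
        then have "CARD('n) * \<bar>F $ i \<bullet> x\<bar> < norm (m i)" using neg by (auto simp: Q_def not_le)
        also have "\<dots> \<le> norm x" using i by (auto simp: Q_def)
        finally have "\<bar>F $ i \<bullet> x\<bar> < norm x / CARD('n)" by (simp add: field_simps)
        then show "(F $ i \<bullet> x)\<^sup>2 < (norm x / CARD('n))\<^sup>2" by (metis abs_ge_zero power2_abs power_strict_mono zero_less_numeral)
      qed (use False in auto)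
      also have "\<dots> \<le> (\<Sum>i\<in>(UNIV::'n set). (norm x / CARD('n))\<^sup>2)" by (rule sum_mono2) auto
      also have "\<dots> = (norm x)\<^sup>2 / CARD('n)" by (simp add: power_divide power2_eq_square)
      also have "\<dots> \<le> (norm x)\<^sup>2"
      proof -
        have "1 \<le> real CARD('n)" by (simp add: Suc_leI)
        then show ?thesis using mult_left_mono[of 1 "real CARD('n)" "(norm x)\<^sup>2"] by (simp add: divide_le_eq)
      qed
      finally show ?thesis .
    qed
    finally show False by simp
  qed
  show ?thesis
  proof (intro exI conjI)
    show "frame P (span L) F" by (rule F)
    show "\<forall>i\<in>P. (\<chi> i. m i) $ i \<in> L \<and> (\<chi> i. m i) $ i \<noteq> 0" using m by simp
    show "span ((\<lambda>i. (\<chi> i. m i) $ i) ` P) = span L" using sp spL by simp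
    show "\<forall>x\<in>L. x \<noteq> 0 \<longrightarrow> (\<exists>i\<in>P. norm ((\<chi> i. m i) $ i) \<le> CARD('n) * \<bar>F $ i \<bullet> x\<bar>)" using key by simp
  qed
qed

text \<open>
  The sum of \<open>L\<close> and an orthonormal lattice in the complement; it has full rank if
  \<open>L\<close> spans \<open>V\<close>, and the same covolume.
\<close>

definition thicken :: "(real^'n) set \<Rightarrow> 'n set \<Rightarrow> real^'n^'n \<Rightarrow> (real^'n) set" where
  "thicken L P F = {y + (\<Sum>i\<in>-P. of_int (k i) *\<^sub>R F $ i) |y k. y \<in> L}"

lemma thicken_diff:
  assumes L: "discrete_subgroup L" and "x \<in> thicken L P F" "y \<in> thicken L P F"
  shows "x - y \<in> thicken L P F"
proof -
  obtain u k where x: "x = u + (\<Sum>i\<in>-P. of_int (k i) *\<^sub>R F $ i)" "u \<in> L" using assms by (auto simp: thicken_def)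
  obtain v l where y: "y = v + (\<Sum>i\<in>-P. of_int (l i) *\<^sub>R F $ i)" "v \<in> L" using assms by (auto simp: thicken_def)
  have "x - y = (u - v) + (\<Sum>i\<in>-P. of_int (k i - l i) *\<^sub>R F $ i)"
    by (simp add: x y scaleR_diff_left sum_subtractf)
  then show ?thesis using discrete_subgroup_diff[OF L x(2) y(2)] unfolding thicken_def by (intro CollectI exI conjI)
qed

lemma thicken_countable:
  fixes L :: "(real^'n) set"
  assumes L: "discrete_subgroup L" shows "countable (thicken L P F)"
proof -
  have "thicken L P F = (\<lambda>(y,k). y + (\<Sum>i\<in>-P. of_int (k i) *\<^sub>R F $ i)) ` (L \<times> (UNIV :: ('n \<Rightarrow> int) set))"
    by (auto simp: thicken_def)
  then show ?thesis using discrete_subgroup_countable[OF L] by simp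
qed

lemma frame_sum_coord:
  fixes F :: "real^'n^'n"
  assumes "orthogonal_matrix F"
  shows "F $ j \<bullet> (\<Sum>i\<in>Q. c i *\<^sub>R F $ i) = (if j \<in> Q then c j else 0)"
proof -
  have "F $ j \<bullet> (\<Sum>i\<in>Q. c i *\<^sub>R F $ i) = (\<Sum>i\<in>Q. c i * (F $ j \<bullet> F $ i))" by (simp add: inner_sum_right)
  also have "\<dots> = (\<Sum>i\<in>Q. if i = j then c i else 0)"
    using assms[unfolded orthogonal_matrix_rows] by (intro sum.cong) simp_all
  also have "\<dots> = (if j \<in> Q then c j else 0)" by simp
  finally show ?thesis .
qed

lemma thicken_coord:
  assumes F: "frame P V F" and y: "y \<in> V" and x: "x = y + (\<Sum>i\<in>-P. of_int (k i) *\<^sub>R F $ i)" and i: "i \<notin> P"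
  shows "F $ i \<bullet> x = of_int (k i)"
  using frame_sum_coord[where F=F and j=i and Q="-P" and c="\<lambda>i. of_int (k i)"] F y i by (simp add: x inner_add_right frame_def)

lemma emeasure_frame_box:
  fixes F :: "real^'n^'n"
  assumes F: "orthogonal_matrix F" and b: "\<And>i. 0 \<le> b i"
  shows "emeasure lborel {x. \<forall>i. \<bar>F $ i \<bullet> x\<bar> < b i} = ennreal (\<Prod>i\<in>UNIV. 2 * b i)"
    and "{x. \<forall>i. \<bar>F $ i \<bullet> x\<bar> < b i} \<in> sets borel"
proof -
  have eq: "{x. \<forall>i. \<bar>F $ i \<bullet> x\<bar> < b i} = {x. F *v x \<in> box (\<chi> i. - b i) (\<chi> i. b i)}"
    by (auto simp: mem_box_cart matrix_vector_mult_row abs_less_iff) (smt (verit))+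
  have "emeasure lborel (box (\<chi> i. - b i) (\<chi> i. b i) :: (real^'n) set) = ennreal (\<Prod>i\<in>UNIV. 2 * b i)"
    using b by (subst emeasure_box_vec(1)) (auto simp: add_increasing)
  then show "emeasure lborel {x. \<forall>i. \<bar>F $ i \<bullet> x\<bar> < b i} = ennreal (\<Prod>i\<in>UNIV. 2 * b i)"
    unfolding eq using emeasure_orthogonal_matrix[OF F, of "box (\<chi> i. - b i) (\<chi> i. b i)"] by simp
  have "open {x. \<bar>F $ i \<bullet> x\<bar> < b i}" for i
    by (intro open_Collect_less continuous_intros)
  then have "open (\<Inter>i. {x. \<bar>F $ i \<bullet> x\<bar> < b i})" by (intro open_INT) auto
  then have "open {x. \<forall>i. \<bar>F $ i \<bullet> x\<bar> < b i}" by (simp add: Collect_all_eq)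
  then show "{x. \<forall>i. \<bar>F $ i \<bullet> x\<bar> < b i} \<in> sets borel" by (rule borel_open)
qed

text \<open>
  The box of half this size is a packing for the thickened group, since a difference of two of its points has
  coordinates too small for a nonzero element.
\<close>

lemma box_le_covering:
  fixes L :: "(real^'n) set" and P :: "'n set"
  assumes L: "discrete_subgroup L" and F: "frame P (span L) F"
    and b: "\<And>i. i \<in> P \<Longrightarrow> 0 < b i"
    and m: "\<And>x. x \<in> L \<Longrightarrow> x \<noteq> 0 \<Longrightarrow> \<exists>i\<in>P. b i \<le> \<bar>F $ i \<bullet> x\<bar>"
    and S: "S \<in> sets borel" and cov: "\<And>x. \<exists>v\<in>thicken L P F. x - v \<in> S"
  shows "ennreal (\<Prod>i\<in>P. b i) \<le> emeasure lborel S"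
proof -
  define c where "c i = (if i \<in> P then b i / 2 else 1/2)" for i
  let ?B = "{x. \<forall>i. \<bar>F $ i \<bullet> x\<bar> < c i}"
  have oF: "orthogonal_matrix F" using F by (simp add: frame_def)
  have c: "0 \<le> c i" for i using b[of i] by (auto simp: c_def)
  have "emeasure lborel ?B \<le> emeasure lborel S"
  proof (rule packing_le_covering[of "thicken L P F"])
    show "countable (thicken L P F)" by (rule thicken_countable[OF L])
    show "thicken L P F \<noteq> {}" using cov by blast
    show "x - y \<in> thicken L P F" if "x \<in> thicken L P F" "y \<in> thicken L P F" for x y
      using thicken_diff[OF L that] .
    show "x = y" if x: "x \<in> ?B" and y: "y \<in> ?B" and d: "x - y \<in> thicken L P F" for x y
    proof -
      obtain u k where u: "x - y = u + (\<Sum>i\<in>-P. of_int (k i) *\<^sub>R F $ i)" "u \<in> L" using d by (auto simp: thicken_def)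
      have lt: "\<bar>F $ i \<bullet> (x - y)\<bar> < 2 * c i" for i
      proof -
        have "\<bar>F $ i \<bullet> x\<bar> < c i" "\<bar>F $ i \<bullet> y\<bar> < c i" using x y by auto
        then show ?thesis by (simp add: inner_diff_right)
      qed
      have "k i = 0" if "i \<notin> P" for i
      proof -
        have "F $ i \<bullet> (x - y) = of_int (k i)"
          by (rule thicken_coord[OF F _ u(1) that]) (use u(2) span_base in auto)
        then have "\<bar>of_int (k i) :: real\<bar> < 1" using lt[of i] that by (simp add: c_def)
        then show ?thesis by linarith
      qed
      then have "x - y = u" using u by simp
      moreover have "u = 0"
      proof (rule ccontr)
        assume "u \<noteq> 0"
        then obtain i where "i \<in> P" "b i \<le> \<bar>F $ i \<bullet> u\<bar>" using m u by blast
        then show False using lt[of i] \<open>x - y = u\<close> by (simp add: c_def)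
      qed
      ultimately show ?thesis by simp
    qed
  qed (use cov S emeasure_frame_box(2)[OF oF c] in auto)
  also have "emeasure lborel ?B = ennreal (\<Prod>i\<in>UNIV. 2 * c i)" by (rule emeasure_frame_box(1)[OF oF c])
  also have "(\<Prod>i\<in>UNIV. 2 * c i) = (\<Prod>i\<in>P. b i)"
    by (subst prod.mono_neutral_right[of UNIV P]) (auto simp: c_def)
  finally show ?thesis .
qed

lemma parallelepiped:
  fixes W :: "real^'n::{finite,wellorder}^'n::_"
  assumes W: "det W \<noteq> 0"
  obtains S where "S \<in> sets borel" "emeasure lborel S = ennreal \<bar>det W\<bar>"
    "\<And>x. \<exists>k. x - (\<Sum>i\<in>UNIV. of_int (k i) *\<^sub>R W $ i) \<in> S"
proof
  let ?f = "\<lambda>c. transpose W *v c"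
  let ?S = "?f ` cbox 0 1"
  have lin: "linear ?f" by (rule matrix_vector_mul_linear)
  have "compact ?S" by (rule compact_continuous_image[OF linear_continuous_on[OF linear_conv_bounded_linear[THEN iffD1, OF lin]]]) simp
  then show "?S \<in> sets borel" by (simp add: borel_compact)
  have lm: "cbox 0 (1::real^'n::_) \<in> lmeasurable" by simp
  have m: "?S \<in> lmeasurable" using measurable_linear_image[OF lin lm] .
  have "measure lebesgue (cbox 0 (1::real^'n::_)) = 1"
  proof -
    have "emeasure lborel (cbox 0 (1::real^'n::_)) = 1" by (subst emeasure_box_vec(2)) auto
    then show ?thesis by (simp add: measure_def)
  qed
  then have "measure lebesgue ?S = \<bar>det W\<bar>"
    unfolding measure_linear_image[OF lin lm] matrix_of_matrix_vector_mul det_transpose by simp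
  then have "emeasure lebesgue ?S = ennreal \<bar>det W\<bar>" using m by (simp add: emeasure_eq_measure2)
  then show "emeasure lborel ?S = ennreal \<bar>det W\<bar>" using \<open>?S \<in> sets borel\<close> by (simp add: emeasure_completion)
  fix x
  have "invertible (transpose W)" using W by (simp add: invertible_det_nz det_transpose)
  then obtain B where B: "transpose W ** B = mat 1" by (auto simp: invertible_def)
  define c where "c = B *v x"
  have c: "?f c = x" unfolding c_def matrix_vector_mul_assoc B by simp
  have f: "?f c = (\<Sum>i\<in>UNIV. c $ i *\<^sub>R W $ i)" for c
    by (simp add: vec_eq_iff matrix_vector_mult_def transpose_def mult.commute)
  show "\<exists>k. x - (\<Sum>i\<in>UNIV. of_int (k i) *\<^sub>R W $ i) \<in> ?S"
  proof (intro exI image_eqI)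
    \<comment> \<open>Subtract the integer parts of the coordinates.\<close>
    show "x - (\<Sum>i\<in>UNIV. of_int (floor (c $ i)) *\<^sub>R W $ i) = ?f (\<chi> i. frac (c $ i))"
      unfolding f using c[symmetric] unfolding f
      by (simp add: frac_def scaleR_diff_left sum_subtractf)
    show "(\<chi> i. frac (c $ i)) \<in> cbox 0 (1::real^'n::_)"
      by (auto simp: mem_box_cart frac_ge_0 less_imp_le[OF frac_lt_1])
  qed
qed

text \<open>
  The parallelepiped spanned by the \<open>w $ i\<close> and the frame vectors outside \<open>P\<close>.
\<close>

lemma parallelepiped_covers:
  fixes L :: "(real^'n::{finite,wellorder}) set"
  assumes L: "discrete_subgroup L" and w: "\<And>i. i \<in> P \<Longrightarrow> w $ i \<in> L" and nz: "det (mix P w F) \<noteq> 0"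
  obtains S where "S \<in> sets borel" "emeasure lborel S = ennreal \<bar>det (mix P w F)\<bar>"
    "\<And>x. \<exists>v\<in>thicken L P F. x - v \<in> S"
proof -
  obtain S where S: "S \<in> sets borel" "emeasure lborel S = ennreal \<bar>det (mix P w F)\<bar>"
    and c: "\<And>x. \<exists>k. x - (\<Sum>i\<in>UNIV. of_int (k i) *\<^sub>R mix P w F $ i) \<in> S"
    using parallelepiped[OF nz] by blast
  have "\<exists>v\<in>thicken L P F. x - v \<in> S" for x
  proof -
    obtain k where k: "x - (\<Sum>i\<in>UNIV. of_int (k i) *\<^sub>R mix P w F $ i) \<in> S" using c by blast
    have "(\<Sum>i\<in>UNIV. of_int (k i) *\<^sub>R mix P w F $ i) = (\<Sum>i\<in>P \<union> -P. of_int (k i) *\<^sub>R mix P w F $ i)" by simp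
    also have "\<dots> = (\<Sum>i\<in>P. of_int (k i) *\<^sub>R mix P w F $ i) + (\<Sum>i\<in>-P. of_int (k i) *\<^sub>R mix P w F $ i)"
      by (rule sum.union_disjoint) auto
    also have "\<dots> = (\<Sum>i\<in>P. of_int (k i) *\<^sub>R w $ i) + (\<Sum>i\<in>-P. of_int (k i) *\<^sub>R F $ i)" by simp
    also have "\<dots> \<in> thicken L P F"
    proof -
      have "(\<Sum>i\<in>P. of_int (k i) *\<^sub>R w $ i) \<in> L"
        by (rule discrete_subgroup_sum[OF L]) (auto intro: discrete_subgroup_scale[OF L] w)
      then show ?thesis unfolding thicken_def by blast
    qed
    finally show ?thesis using k by blast
  qed
  then show ?thesis using that S by blast
qed

section \<open>Covolumes\<close>

text \<open>
  A fundamental domain of the thickened group, made from one of \<open>L\<close> in \<open>V\<close>.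
\<close>

definition thick_dom :: "(real^'n) set \<Rightarrow> 'n set \<Rightarrow> real^'n^'n \<Rightarrow> (real^'n) set" where
  "thick_dom D P F = {x. (\<Sum>i\<in>P. (F $ i \<bullet> x) *\<^sub>R F $ i) \<in> D \<and> (\<forall>i\<in>-P. 0 \<le> F $ i \<bullet> x \<and> F $ i \<bullet> x < 1)}"

lemma thick_dom_borel:
  fixes F :: "real^'n^'n"
  assumes [measurable]: "D \<in> sets borel" shows "thick_dom D P F \<in> sets borel"
proof -
  have [measurable]: "(\<lambda>x. F $ i \<bullet> x) \<in> borel_measurable borel" for i
    by (intro borel_measurable_continuous_onI continuous_intros)
  have [measurable]: "(\<lambda>x. \<Sum>i\<in>P. (F $ i \<bullet> x) *\<^sub>R F $ i) \<in> borel_measurable borel"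
    by (intro borel_measurable_continuous_onI continuous_intros)
  show ?thesis unfolding thick_dom_def by measurable
qed

lemma thick_dom_covers:
  fixes L :: "(real^'n) set"
  assumes L: "discrete_subgroup L" and V: "subspace V" "L \<subseteq> V" and F: "frame P V F"
    and D: "fundamental_domain V L D"
  shows "\<exists>v\<in>thicken L P F. x - v \<in> thick_dom D P F"
proof -
  let ?p = "\<lambda>x. \<Sum>i\<in>P. (F $ i \<bullet> x) *\<^sub>R F $ i"
  have oF: "orthogonal_matrix F" using F by (simp add: frame_def)
  have "?p x \<in> V" using F V by (intro subspace_sum subspace_scale) (auto simp: frame_def)
  then obtain u where u: "u \<in> L" "?p x - u \<in> D" using D by (auto simp: fundamental_domain_def)
  define s where "s = (\<Sum>i\<in>-P. of_int (floor (F $ i \<bullet> x)) *\<^sub>R F $ i)"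
  have s: "F $ i \<bullet> s = (if i \<in> P then 0 else of_int (floor (F $ i \<bullet> x)))" for i
    unfolding s_def frame_sum_coord[OF oF] by simp
  have us: "u + s \<in> thicken L P F" unfolding thicken_def s_def by (intro CollectI exI conjI, rule refl, rule u(1))
  have "?p (x - (u + s)) = ?p x - ?p u - ?p s"
    by (simp add: inner_diff_right inner_add_right scaleR_diff_left scaleR_add_left sum_subtractf sum.distrib)
  also have "?p s = 0" by (simp add: s)
  also have "?p u = u" using frame_expand[OF F, of u] u V by auto
  finally have 1: "?p (x - (u + s)) \<in> D" using u by simp
  have 2: "0 \<le> F $ i \<bullet> (x - (u + s)) \<and> F $ i \<bullet> (x - (u + s)) < 1" if "i \<in> -P" for i
  proof -
    have "F $ i \<bullet> u = 0" using F u V that by (auto simp: frame_def)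
    then have "F $ i \<bullet> (x - (u + s)) = F $ i \<bullet> x - of_int (floor (F $ i \<bullet> x))"
      using s[of i] that by (simp add: inner_diff_right inner_add_right)
    then show ?thesis by linarith
  qed
  show ?thesis using us 1 2 unfolding thick_dom_def by blast
qed

lemma thick_dom_packs:
  fixes L :: "(real^'n) set"
  assumes L: "discrete_subgroup L" and V: "subspace V" "L \<subseteq> V" and F: "frame P V F"
    and D: "fundamental_domain V L D"
    and x: "x \<in> thick_dom D P F" and y: "y \<in> thick_dom D P F" and d: "x - y \<in> thicken L P F"
  shows "x = y"
proof -
  let ?p = "\<lambda>x. \<Sum>i\<in>P. (F $ i \<bullet> x) *\<^sub>R F $ i"
  obtain u k where u: "x - y = u + (\<Sum>i\<in>-P. of_int (k i) *\<^sub>R F $ i)" "u \<in> L" using d by (auto simp: thicken_def)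
  have "k i = 0" if i: "i \<notin> P" for i
  proof -
    have "F $ i \<bullet> (x - y) = of_int (k i)"
      by (rule thicken_coord[OF F _ u(1) i]) (use u(2) V in auto)
    moreover have "\<bar>F $ i \<bullet> (x - y)\<bar> < 1" using x y i by (auto simp: thick_dom_def inner_diff_right abs_less_iff) (smt (verit) ComplI)+
    ultimately have "\<bar>of_int (k i) :: real\<bar> < 1" by simp
    then show ?thesis by linarith
  qed
  then have xy: "x - y = u" using u by simp
  have "?p u = u" using frame_expand[OF F, of u] u V by auto
  moreover have "?p (x - y) = ?p x - ?p y" by (simp add: inner_diff_right scaleR_diff_left sum_subtractf)
  ultimately have pu: "?p x - u = ?p y" using xy by simp
  have px: "?p x \<in> V" using F V by (intro subspace_sum subspace_scale) (auto simp: frame_def)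
  have "\<exists>!v. v \<in> L \<and> ?p x - v \<in> D" using D px by (simp add: fundamental_domain_def)
  moreover have "0 \<in> L \<and> ?p x - 0 \<in> D" using x discrete_subgroup_0[OF L] by (simp add: thick_dom_def)
  moreover have "u \<in> L \<and> ?p x - u \<in> D" using y u unfolding pu by (simp add: thick_dom_def)
  ultimately have "u = 0" by blast
  then show ?thesis using xy by simp
qed

text \<open>
  The choice in \<open>covol\<close> is resolved once and for all: the chosen domain has finite volume because
  it packs and a parallelepiped covers, so \<open>measure\<close> and \<open>emeasure\<close> agree.
\<close>

lemma covol_thick_dom:
  fixes L :: "(real^'n::{finite,wellorder}) set"
  assumes L: "lattice_in V L" and F: "frame P V F"
  shows "\<exists>D. fundamental_domain V L D \<and> emeasure lborel (thick_dom D P F) = ennreal (covol V L)"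
proof -
  define D where "D = (SOME D. fundamental_domain V L D)"
  have dL: "discrete_subgroup L" and V: "span L = V" using L by (auto simp: lattice_in_iff)
  have sV: "subspace V" "L \<subseteq> V" unfolding V[symmetric] by (auto simp: span_superset)
  have D: "fundamental_domain V L D" unfolding D_def
    using fundamental_domain_exists[OF dL sV] by (rule someI_ex)
  have "card P = dim (span L)" using frame_card(4)[OF sV(1) F] V by simp
  then obtain m where m: "\<forall>i\<in>P. m $ i \<in> L \<and> m $ i \<noteq> 0" "span ((\<lambda>i. m $ i) ` P) = span L"
    using reduced_basis[OF dL] by metis
  have nz: "det (mix P m F) \<noteq> 0" using m(2) V F by (intro det_mix_frame_nz) simp
  obtain S where S: "S \<in> sets borel" "emeasure lborel S = ennreal \<bar>det (mix P m F)\<bar>"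
    "\<And>x. \<exists>v\<in>thicken L P F. x - v \<in> S"
    using parallelepiped_covers[OF dL _ nz] m(1) by metis
  have Db: "D \<in> sets borel" using D by (simp add: fundamental_domain_def)
  have "emeasure lborel (thick_dom D P F) \<le> emeasure lborel S"
  proof (rule packing_le_covering[of "thicken L P F"])
    show "countable (thicken L P F)" by (rule thicken_countable[OF dL])
    show "thicken L P F \<noteq> {}" using S(3) by blast
  qed (use S thick_dom_borel[OF Db] thicken_diff[OF dL] thick_dom_packs[OF dL sV F D] in auto)
  then have fin: "emeasure lborel (thick_dom D P F) < \<infinity>" using S(2) by (metis ennreal_less_top infinity_ennreal_def order_le_less_trans)
  have "emeasure (lborel_subspace V) D = emeasure lborel (thick_dom D P F)"
    unfolding thick_dom_def by (rule emeasure_lborel_subspace[OF sV(1) F Db])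
  then have "covol V L = measure lborel (thick_dom D P F)"
    by (simp add: covol_def D_def[symmetric] measure_def)
  then show ?thesis using D fin by (intro exI[of _ D]) (simp add: emeasure_eq_ennreal_measure)
qed

lemma covol_nonneg: "0 \<le> covol V L"
  by (simp add: covol_def)

text \<open>
  Independent lattice vectors generate a sublattice, whose parallelepiped covers.
\<close>

lemma covol_le_det:
  fixes L :: "(real^'n::{finite,wellorder}) set"
  assumes L: "lattice_in V L" and F: "frame P V F"
    and w: "\<And>i. i \<in> P \<Longrightarrow> w $ i \<in> L" and nz: "det (mix P w F) \<noteq> 0"
  shows "covol V L \<le> \<bar>det (mix P w F)\<bar>"
proof -
  have dL: "discrete_subgroup L" and V: "span L = V" using L by (auto simp: lattice_in_iff)
  have sV: "subspace V" "L \<subseteq> V" unfolding V[symmetric] by (auto simp: span_superset)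
  obtain D where D: "fundamental_domain V L D" "emeasure lborel (thick_dom D P F) = ennreal (covol V L)"
    using covol_thick_dom[OF L F] by blast
  have Db: "D \<in> sets borel" using D by (simp add: fundamental_domain_def)
  obtain S where S: "S \<in> sets borel" "emeasure lborel S = ennreal \<bar>det (mix P w F)\<bar>"
    "\<And>x. \<exists>v\<in>thicken L P F. x - v \<in> S"
    using parallelepiped_covers[OF dL w nz] by metis
  have "emeasure lborel (thick_dom D P F) \<le> emeasure lborel S"
  proof (rule packing_le_covering[of "thicken L P F"])
    show "countable (thicken L P F)" by (rule thicken_countable[OF dL])
    show "thicken L P F \<noteq> {}" using S(3) by blast
  qed (use S thick_dom_borel[OF Db] thicken_diff[OF dL] thick_dom_packs[OF dL sV F D(1)] in auto)
  then show ?thesis using S(2) D(2) by simp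
qed

text \<open>
  The two volume bounds for a reduced system \<open>m\<close>: its empty box is a packing, while a fundamental
  domain and the parallelepiped of any independent lattice vectors are coverings. The bound by determinants
  makes no reference to covolumes and is what the measure estimate uses.
\<close>

lemma reduced_le_covol:
  fixes L :: "(real^'n::{finite,wellorder}) set" and P :: "'n set"
  assumes L: "lattice_in V L" and P: "card P = dim V"
  shows "\<exists>F m. frame P V F \<and> (\<forall>i\<in>P. m $ i \<in> L \<and> m $ i \<noteq> 0) \<and> span ((\<lambda>i. m $ i) ` P) = V
    \<and> (\<Prod>i\<in>P. norm (m $ i)) \<le> real CARD('n) ^ CARD('n) * covol V L
    \<and> (\<forall>w. (\<forall>i\<in>P. w $ i \<in> L) \<longrightarrow> det (mix P w F) \<noteq> 0 \<longrightarrow>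
         (\<Prod>i\<in>P. norm (m $ i)) \<le> real CARD('n) ^ CARD('n) * \<bar>det (mix P w F)\<bar>)"
proof -
  have dL: "discrete_subgroup L" and V: "span L = V" using L by (auto simp: lattice_in_iff)
  have sV: "subspace V" "L \<subseteq> V" unfolding V[symmetric] by (auto simp: span_superset)
  obtain F m where F: "frame P (span L) F" and m: "\<forall>i\<in>P. m $ i \<in> L \<and> m $ i \<noteq> 0"
    and sp: "span ((\<lambda>i. m $ i) ` P) = span L"
    and mn: "\<forall>x\<in>L. x \<noteq> 0 \<longrightarrow> (\<exists>i\<in>P. norm (m $ i) \<le> CARD('n) * \<bar>F $ i \<bullet> x\<bar>)"
    using reduced_basis[OF dL, of P] P V by metis
  have FV: "frame P V F" using F V by simp
  let ?b = "\<lambda>i. norm (m $ i) / CARD('n)"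
  have cov: "(\<Prod>i\<in>P. norm (m $ i)) \<le> real CARD('n) ^ CARD('n) * c"
    if S: "S \<in> sets borel" "emeasure lborel S = ennreal c" "\<And>x. \<exists>v\<in>thicken L P F. x - v \<in> S" "c \<ge> 0" for S c
  proof -
    have "ennreal (\<Prod>i\<in>P. ?b i) \<le> emeasure lborel S"
    proof (rule box_le_covering[OF dL F])
      show "0 < ?b i" if "i \<in> P" for i using m that by simp
      show "\<exists>i\<in>P. ?b i \<le> \<bar>F $ i \<bullet> x\<bar>" if "x \<in> L" "x \<noteq> 0" for x
      proof -
        obtain i where "i \<in> P" "norm (m $ i) \<le> CARD('n) * \<bar>F $ i \<bullet> x\<bar>" using mn \<open>x \<in> L\<close> \<open>x \<noteq> 0\<close> by blast
        then show ?thesis by (intro bexI[of _ i]) (simp_all add: divide_le_eq mult.commute)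
      qed
    qed (use S in auto)
    then have "(\<Prod>i\<in>P. ?b i) \<le> c" using S by simp
    then have "(\<Prod>i\<in>P. norm (m $ i)) \<le> real CARD('n) ^ card P * c"
      by (simp add: prod_dividef divide_le_eq mult.commute)
    also have "\<dots> \<le> real CARD('n) ^ CARD('n) * c"
      using S(4) by (intro mult_right_mono power_increasing card_mono) (auto simp: Suc_leI)
    finally show ?thesis .
  qed
  show ?thesis
  proof (rule exI[of _ F], rule exI[of _ m], intro conjI allI impI)
    show "frame P V F" by (rule FV)
    show "\<forall>i\<in>P. m $ i \<in> L \<and> m $ i \<noteq> 0" by (rule m)
    show "span ((\<lambda>i. m $ i) ` P) = V" using sp V by simp
    obtain D where D: "fundamental_domain V L D" "emeasure lborel (thick_dom D P F) = ennreal (covol V L)"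
      using covol_thick_dom[OF L FV] by blast
    have Db: "D \<in> sets borel" using D by (simp add: fundamental_domain_def)
    show "(\<Prod>i\<in>P. norm (m $ i)) \<le> real CARD('n) ^ CARD('n) * covol V L"
      by (rule cov[OF thick_dom_borel[OF Db] D(2) thick_dom_covers[OF dL sV FV D(1)] covol_nonneg])
    fix w assume w: "\<forall>i\<in>P. w $ i \<in> L" and nz: "det (mix P w F) \<noteq> 0"
    obtain S where S: "S \<in> sets borel" "emeasure lborel S = ennreal \<bar>det (mix P w F)\<bar>"
      "\<And>x. \<exists>v\<in>thicken L P F. x - v \<in> S"
      using parallelepiped_covers[OF dL _ nz] w by metis
    show "(\<Prod>i\<in>P. norm (m $ i)) \<le> real CARD('n) ^ CARD('n) * \<bar>det (mix P w F)\<bar>"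
      by (rule cov[OF S]) simp
  qed
qed

lemma frame_UNIV: "frame UNIV UNIV (mat 1 :: real^'n^'n)"
  by (simp add: frame_def orthogonal_matrix_id)

lemma mat_1_inner: "(mat 1 :: real^'n^'n) $ i \<bullet> x = x $ i"
  by (metis matrix_vector_mul_lid matrix_vector_mult_row)

lemma thicken_UNIV: "thicken L UNIV F = L"
  by (simp add: thicken_def)

lemma thick_dom_UNIV: "thick_dom D UNIV (mat 1 :: real^'n^'n) = D"
  using orthogonal_matrix_expand[OF orthogonal_matrix_id, where 'n='n]
  by (auto simp: thick_dom_def)

lemma covol_UNIV:
  fixes L :: "(real^'n::{finite,wellorder}) set"
  assumes L: "lattice_in UNIV L" and D: "fundamental_domain UNIV L D"
  shows "emeasure lborel D = ennreal (covol UNIV L)"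
proof -
  have dL: "discrete_subgroup L" using L by (auto simp: lattice_in_iff)
  obtain E where E: "fundamental_domain UNIV L E" "emeasure lborel E = ennreal (covol UNIV L)"
    using covol_thick_dom[OF L frame_UNIV] by (auto simp: thick_dom_UNIV)
  have *: "emeasure lborel A \<le> emeasure lborel B"
    if A: "fundamental_domain UNIV L A" and B: "fundamental_domain UNIV L B" for A B
  proof (rule packing_le_covering[of L])
    show "countable L" by (rule discrete_subgroup_countable[OF dL])
    show "L \<noteq> {}" using discrete_subgroup_0[OF dL] by blast
    show "x = y" if "x \<in> A" "y \<in> A" "x - y \<in> L" for x y
    proof -
      have "\<exists>!v. v \<in> L \<and> x - v \<in> A" using A by (simp add: fundamental_domain_def)
      moreover have "0 \<in> L \<and> x - 0 \<in> A" using that discrete_subgroup_0[OF dL] by simp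
      moreover have "x - y \<in> L \<and> x - (x - y) \<in> A" using that by simp
      ultimately have "x - y = 0" by blast
      then show ?thesis by simp
    qed
    show "\<exists>v\<in>L. x - v \<in> B" for x using B by (auto simp: fundamental_domain_def)
  qed (use A B discrete_subgroup_diff[OF dL] in \<open>auto simp: fundamental_domain_def\<close>)
  show ?thesis using *[OF D E(1)] *[OF E(1) D] E(2) by simp
qed

text \<open>
  Minkowski's theorem on linear forms: a box without nonzero lattice vectors would be a packing of volume more
  than one.
\<close>

lemma minkowski:
  fixes \<Lambda> :: "(real^'n::{finite,wellorder}) set"
  assumes \<Lambda>: "\<Lambda> \<in> unimodular_lattices" and b: "\<And>i. 0 < b i" and p: "1 < (\<Prod>i\<in>UNIV. b i)"
  shows "\<exists>v\<in>\<Lambda>. v \<noteq> 0 \<and> (\<forall>i. \<bar>v $ i\<bar> < b i)"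
proof (rule ccontr)
  assume neg: "\<not> ?thesis"
  have L: "lattice_in UNIV \<Lambda>" "covol UNIV \<Lambda> = 1" using \<Lambda> by (auto simp: unimodular_lattices_def)
  then have dL: "discrete_subgroup \<Lambda>" and sp: "span \<Lambda> = UNIV" by (auto simp: lattice_in_iff)
  obtain D where D: "fundamental_domain UNIV \<Lambda> D" using fundamental_domain_exists[OF dL, of UNIV] by auto
  have "ennreal (\<Prod>i\<in>UNIV. b i) \<le> emeasure lborel D"
  proof (rule box_le_covering[OF dL])
    show "frame UNIV (span \<Lambda>) (mat 1)" unfolding sp by (rule frame_UNIV)
    show "\<exists>i\<in>UNIV. b i \<le> \<bar>(mat 1 :: real^'n::_^'n::_) $ i \<bullet> x\<bar>" if "x \<in> \<Lambda>" "x \<noteq> 0" for x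
      using neg that by (auto simp: mat_1_inner not_less)
    show "\<exists>v\<in>thicken \<Lambda> UNIV (mat 1). x - v \<in> D" for x
      using D by (auto simp: fundamental_domain_def thicken_UNIV)
  qed (use b D in \<open>auto simp: fundamental_domain_def\<close>)
  also have "\<dots> = 1" using covol_UNIV[OF L(1) D] L(2) by simp
  finally have "(\<Prod>i\<in>UNIV. b i) \<le> 1" by simp
  then show False using p by simp
qed

lemma act_mult: "act (A ** B) \<Lambda> = act A (act B \<Lambda>)"
  by (simp add: act_def image_image matrix_vector_mul_assoc)

lemma act_id: "act (mat 1) \<Lambda> = \<Lambda>"
  by (simp add: act_def)

lemma discrete_subgroup_act:
  fixes g :: "real^'n^'n"
  assumes L: "discrete_subgroup \<Lambda>" and g: "det g \<noteq> 0"
  shows "discrete_subgroup (act g \<Lambda>)"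
proof -
  have "inj ((*v) g)" 
    unfolding linear_injective_0[OF matrix_vector_mul_linear] using det_nz_kernel g by blast
  then obtain c where c: "c > 0" "\<And>x. c * norm x \<le> norm (g *v x)"
    using linear_inj_bounded_below_pos[OF matrix_vector_mul_linear] by metis
  obtain r where r: "r > 0" "\<And>x. x \<in> \<Lambda> \<Longrightarrow> x \<noteq> 0 \<Longrightarrow> r \<le> norm x"
    using L by (auto simp: discrete_subgroup_def)
  have "c * r \<le> norm y" if y: "y \<in> act g \<Lambda>" "y \<noteq> 0" for y
  proof -
    obtain x where x: "x \<in> \<Lambda>" "y = g *v x" using y by (auto simp: act_def)
    then have "x \<noteq> 0" using y by auto
    then have "c * r \<le> c * norm x" using r x c by simp
    also have "\<dots> \<le> norm y" using c x by simp
    finally show ?thesis .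
  qed
  moreover have "x - y \<in> act g \<Lambda>" if "x \<in> act g \<Lambda>" "y \<in> act g \<Lambda>" for x y
    using that discrete_subgroup_diff[OF L] by (auto simp: act_def matrix_vector_mult_diff_distrib[symmetric])
  moreover have "0 \<in> act g \<Lambda>"
    using discrete_subgroup_0[OF L] by (auto simp: act_def intro!: image_eqI[of _ _ 0])
  ultimately show ?thesis unfolding discrete_subgroup_def using c r by (metis mult_pos_pos)
qed

text \<open>
  A matrix of determinant one carries fundamental domains to fundamental domains of the same volume.
\<close>

lemma act_unimodular:
  fixes \<Lambda> :: "(real^'n::{finite,wellorder}) set"
  assumes \<Lambda>: "\<Lambda> \<in> unimodular_lattices" and g: "det g = 1"
  shows "act g \<Lambda> \<in> unimodular_lattices"
proof -
  have L: "lattice_in UNIV \<Lambda>" "covol UNIV \<Lambda> = 1" using \<Lambda> by (auto simp: unimodular_lattices_def)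
  then have dL: "discrete_subgroup \<Lambda>" and sp: "span \<Lambda> = UNIV" by (auto simp: lattice_in_iff)
  obtain h where h: "g ** h = mat 1" "h ** g = mat 1"
    using g invertible_det_nz[of g] by (auto simp: invertible_def)
  have gh: "g *v (h *v x) = x" "h *v (g *v x) = x" for x
    by (simp_all add: matrix_vector_mul_assoc h)
  have dg: "discrete_subgroup (act g \<Lambda>)" using discrete_subgroup_act[OF dL] g by simp
  have "span (act g \<Lambda>) = (*v) g ` span \<Lambda>"
    unfolding act_def by (rule linear_span_image) simp
  also have "\<dots> = UNIV" unfolding sp using gh(1) by (metis surjI)
  finally have lg: "lattice_in UNIV (act g \<Lambda>)" using dg by (simp add: lattice_in_iff)
  obtain D where D: "fundamental_domain UNIV \<Lambda> D" using fundamental_domain_exists[OF dL, of UNIV] by auto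
  have eD: "emeasure lborel D = 1" using covol_UNIV[OF L(1) D] L(2) by simp
  have Db[measurable]: "D \<in> sets borel" using D by (simp add: fundamental_domain_def)
  have im: "(*v) g ` D = {x. h *v x \<in> D}"
  proof (intro set_eqI iffI)
    fix x assume "x \<in> (*v) g ` D"
    then show "x \<in> {x. h *v x \<in> D}" by (auto simp: gh(2))
  next
    fix x assume "x \<in> {x. h *v x \<in> D}"
    then show "x \<in> (*v) g ` D" by (intro image_eqI[of _ _ "h *v x"]) (auto simp: gh(1))
  qed
  have [measurable]: "(\<lambda>x. h *v x) \<in> borel_measurable borel"
    by (intro borel_measurable_continuous_onI linear_continuous_on) (simp add: linear_conv_bounded_linear[symmetric])
  have gDb: "(*v) g ` D \<in> sets borel" unfolding im by measurable
  have fd: "fundamental_domain UNIV (act g \<Lambda>) ((*v) g ` D)"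
    unfolding fundamental_domain_def
  proof (intro conjI ballI gDb)
    fix x
    have ex: "\<exists>!v. v \<in> \<Lambda> \<and> h *v x - v \<in> D" using D by (simp add: fundamental_domain_def)
    have iff: "g *v v \<in> act g \<Lambda> \<and> x - g *v v \<in> (*v) g ` D \<longleftrightarrow> v \<in> \<Lambda> \<and> h *v x - v \<in> D" for v
      unfolding im act_def using gh(2) by (auto simp: matrix_vector_mult_diff_distrib) (metis gh(2))
    show "\<exists>!v. v \<in> act g \<Lambda> \<and> x - v \<in> (*v) g ` D"
      using ex iff gh(1) by metis
  qed simp
  have "D \<in> lmeasurable" using Db eD by (intro fmeasurableI) (auto simp: emeasure_completion)
  then have "measure lebesgue ((*v) g ` D) = \<bar>det (matrix ((*v) g))\<bar> * measure lebesgue D" and lm: "(*v) g ` D \<in> lmeasurable"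
    by (rule measure_linear_image[OF matrix_vector_mul_linear], rule measurable_linear_image[OF matrix_vector_mul_linear])
  moreover have "measure lebesgue D = 1" using eD Db by (simp add: measure_def emeasure_completion)
  ultimately have "measure lebesgue ((*v) g ` D) = 1" using g by (simp only: matrix_of_matrix_vector_mul)
  then have "emeasure lebesgue ((*v) g ` D) = 1" using lm by (simp add: emeasure_eq_measure2)
  then have "emeasure lborel ((*v) g ` D) = 1" using gDb by (simp add: emeasure_completion)
  then have "covol UNIV (act g \<Lambda>) = 1" using covol_UNIV[OF lg fd] covol_nonneg
    by (metis ennreal_1 ennreal_inj zero_le_one)
  then show ?thesis using lg by (simp add: unimodular_lattices_def)
qed

lemma integer_lattice_unimodular:
  "(integer_lattice :: (real^'n::{finite,wellorder}) set) \<in> unimodular_lattices"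
proof -
  let ?Z = "integer_lattice :: (real^'n::_) set"
  have dZ: "discrete_subgroup ?Z"
    unfolding discrete_subgroup_def
  proof (intro conjI ballI exI[of _ 1] impI)
    fix x :: "real^'n::_" assume "x \<in> ?Z" "x \<noteq> 0"
    then obtain i where "x $ i \<in> \<int>" "x $ i \<noteq> 0" by (auto simp: integer_lattice_def vec_eq_iff)
    then have "1 \<le> \<bar>x $ i\<bar>" using Ints_nonzero_abs_ge1 by blast
    also have "\<dots> \<le> norm x" by (rule component_le_norm_cart)
    finally show "1 \<le> norm x" .
  qed (auto simp: integer_lattice_def)
  have "Basis \<subseteq> ?Z" by (auto simp: integer_lattice_def Basis_vec_def axis_def)
  then have "span ?Z = UNIV" using span_mono span_Basis by (metis top.extremum_uniqueI)
  then have lZ: "lattice_in UNIV ?Z" using dZ by (simp add: lattice_in_iff)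
  let ?D = "{x::real^'n::_. \<forall>i. 0 \<le> x $ i \<and> x $ i < 1}"
  have [measurable]: "(\<lambda>x::real^'n::_. x $ i) \<in> borel_measurable borel" for i
    by (intro borel_measurable_continuous_onI continuous_intros)
  have Db: "?D \<in> sets borel" by measurable
  have fd: "fundamental_domain UNIV ?Z ?D"
    unfolding fundamental_domain_def
  proof (intro conjI ballI Db ex1I)
    fix x :: "real^'n::_"
    show "(\<chi> i. of_int \<lfloor>x $ i\<rfloor>) \<in> ?Z" by (simp add: integer_lattice_def)
    show "x - (\<chi> i. of_int \<lfloor>x $ i\<rfloor>) \<in> ?D" by (auto simp: frac_lt_1[unfolded frac_def])
    fix v assume v: "v \<in> ?Z \<and> x - v \<in> ?D"
    show "v = (\<chi> i. of_int \<lfloor>x $ i\<rfloor>)"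
    proof (simp add: vec_eq_iff, intro allI)
      fix i
      obtain k where k: "v $ i = of_int k" using v by (auto simp: integer_lattice_def Ints_def)
      have "0 \<le> x $ i - v $ i" "x $ i - v $ i < 1" using v by auto
      then have "\<lfloor>x $ i\<rfloor> = k" unfolding k by linarith
      then show "v $ i = of_int \<lfloor>x $ i\<rfloor>" using k by simp
    qed
  qed simp
  have "emeasure lborel ?D = 1"
  proof (rule antisym)
    have "emeasure lborel ?D \<le> emeasure lborel (cbox 0 (1::real^'n::_))"
      by (rule emeasure_mono) (auto simp: mem_box_cart less_imp_le)
    also have "\<dots> = 1" by (subst emeasure_box_vec(2)) auto
    finally show "emeasure lborel ?D \<le> 1" .
    have "1 = emeasure lborel (box 0 (1::real^'n::_))" by (subst emeasure_box_vec(1)) auto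
    also have "\<dots> \<le> emeasure lborel ?D" using Db by (intro emeasure_mono) (auto simp: mem_box_cart less_imp_le)
    finally show "1 \<le> emeasure lborel ?D" .
  qed
  then have "covol UNIV ?Z = 1" using covol_UNIV[OF lZ fd] covol_nonneg
    by (metis ennreal_1 ennreal_inj zero_le_one)
  then show ?thesis using lZ by (simp add: unimodular_lattices_def)
qed

section \<open>Frames adapted to a linear map\<close>

text \<open>
  The singular value decomposition of \<open>g\<close> restricted to \<open>V\<close>: a unit vector
  \<open>a\<close> that maximizes \<open>norm (g *v a)\<close> is a critical point, hence \<open>g\<close>
  keeps its orthogonal complement in \<open>V\<close> orthogonal to \<open>g *v a\<close>; then induct.
\<close>

lemma orthogonalizing_system:
  fixes g :: "real^'n^'n" and P :: "'n set"
  assumes "subspace V" "card P = dim V"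
  shows "\<exists>e. (\<forall>i\<in>P. e i \<in> V) \<and> (\<forall>i\<in>P. \<forall>j\<in>P. e i \<bullet> e j = (if i = j then 1 else 0))
     \<and> (\<forall>i\<in>P. \<forall>j\<in>P. i \<noteq> j \<longrightarrow> (g *v e i) \<bullet> (g *v e j) = 0)"
proof -
  have "finite P" by simp
  then show ?thesis using assms
  proof (induction P arbitrary: V rule: finite_induct)
    case empty
    show ?case by simp
  next
    case (insert i0 P)
    have sV: "subspace V" and dV: "dim V = Suc (card P)" using insert by auto
    have "\<not> V \<subseteq> {0}" using dV by (metis dim_eq_0 nat.distinct(1))
    then obtain v0 where v0: "v0 \<in> V" "v0 \<noteq> 0" by blast
    let ?S = "V \<inter> sphere 0 1"
    have "v0 /\<^sub>R norm v0 \<in> ?S" using v0 sV by (simp add: subspace_scale)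
    then have "?S \<noteq> {}" by blast
    moreover have "compact ?S" using closed_subspace[OF sV] by (intro closed_Int_compact) auto
    moreover have "continuous_on ?S (\<lambda>x. norm (g *v x))"
      by (intro continuous_on_norm linear_continuous_on linear_conv_bounded_linear[THEN iffD1] matrix_vector_mul_linear)
    ultimately obtain a where a: "a \<in> ?S" "\<And>x. x \<in> ?S \<Longrightarrow> norm (g *v x) \<le> norm (g *v a)"
      using continuous_attains_sup by metis
    have na: "norm a = 1" "a \<in> V" using a by auto
    define M where "M = norm (g *v a)"
    have bound: "norm (g *v x) \<le> M * norm x" if "x \<in> V" for x
    proof (cases "x = 0")
      case False
      then have "x /\<^sub>R norm x \<in> ?S" using that sV by (simp add: subspace_scale)
      then have "norm (g *v (x /\<^sub>R norm x)) \<le> M" unfolding M_def by (rule a(2))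
      then show ?thesis using False by (simp add: matrix_vector_mult_scaleR field_simps)
    qed simp
    have orth: "(g *v a) \<bullet> (g *v v) = 0" if v: "v \<in> V" "a \<bullet> v = 0" for v
    proof (rule ccontr)
      define c where "c = (g *v a) \<bullet> (g *v v)"
      define K where "K = M\<^sup>2 * (norm v)\<^sup>2"
      assume "\<not> ?thesis"
      then have c0: "c \<noteq> 0" by (simp add: c_def)
      have K0: "K \<ge> 0" by (simp add: K_def)
      \<comment> \<open>Maximality at \<open>a\<close>, tested on the vectors \<open>a + s *\<^sub>R v\<close>; a nonzero \<open>c\<close> violates it for small \<open>s\<close>.\<close>
      have ineq: "2 * s * c \<le> s\<^sup>2 * K" for s
      proof -
        have "a + s *\<^sub>R v \<in> V" using na v sV by (simp add: subspace_add subspace_scale)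
        then have "norm (g *v (a + s *\<^sub>R v)) \<le> M * norm (a + s *\<^sub>R v)" by (rule bound)
        then have "(norm (g *v (a + s *\<^sub>R v)))\<^sup>2 \<le> (M * norm (a + s *\<^sub>R v))\<^sup>2" by (rule power_mono) simp
        moreover have "(norm (g *v (a + s *\<^sub>R v)))\<^sup>2 = M\<^sup>2 + 2 * s * c + s\<^sup>2 * (norm (g *v v))\<^sup>2"
        proof -
          have gs: "g *v (a + s *\<^sub>R v) = g *v a + s *\<^sub>R (g *v v)"
            by (simp add: matrix_vector_right_distrib matrix_vector_mult_scaleR)
          show ?thesis unfolding gs M_def c_def power2_norm_eq_inner
            by (simp add: inner_add_left inner_add_right inner_commute power2_eq_square algebra_simps)
        qed
        moreover have "(M * norm (a + s *\<^sub>R v))\<^sup>2 = M\<^sup>2 * (1 + s\<^sup>2 * (norm v)\<^sup>2)"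
        proof -
          have "a \<bullet> a = 1" using na by (simp add: dot_square_norm)
          then have "(norm (a + s *\<^sub>R v))\<^sup>2 = 1 + s\<^sup>2 * (norm v)\<^sup>2"
            unfolding power2_norm_eq_inner using v
            by (simp add: inner_add_left inner_add_right inner_commute power2_eq_square)
          then show ?thesis by (simp add: power_mult_distrib)
        qed
        ultimately show ?thesis by (simp add: K_def algebra_simps) (smt (verit) zero_le_power2 mult_nonneg_nonneg)
      qed
      define u where "u = c / (K + 1)"
      have c: "c = u * (K + 1)" using K0 by (simp add: u_def)
      then have "u \<noteq> 0" using c0 by auto
      then have "0 < u\<^sup>2 * (K + 2)" using K0 by (intro mult_pos_pos) auto
      moreover have "2 * u * (u * (K + 1)) \<le> u\<^sup>2 * K" using ineq[of u] c by simp
      ultimately show False by (simp add: algebra_simps power2_eq_square)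
    qed
    define V' where "V' = {y \<in> V. \<forall>x\<in>span {a}. orthogonal x y}"
    have sV': "subspace V'" unfolding V'_def
      using subspace_inter[OF sV subspace_orthogonal_to_vectors[of "span {a}"]] by (simp add: Int_def)
    have "span {a} \<subseteq> V" using na sV by (simp add: span_minimal)
    then have "dim V' + dim (span {a}) = dim V"
      unfolding V'_def by (intro dim_subspace_orthogonal_to_vectors) (simp_all add: sV)
    moreover have "dim (span {a}) = 1" using na by (subst dim_span) (auto simp: dim_insert)
    ultimately have "card P = dim V'" using dV by simp
    then obtain e where e: "\<forall>i\<in>P. e i \<in> V'" "\<forall>i\<in>P. \<forall>j\<in>P. e i \<bullet> e j = (if i = j then 1 else 0)"
      "\<forall>i\<in>P. \<forall>j\<in>P. i \<noteq> j \<longrightarrow> (g *v e i) \<bullet> (g *v e j) = 0" using insert.IH[OF sV'] by metis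
    have ae: "a \<bullet> e i = 0" "e i \<in> V" if "i \<in> P" for i
      using e(1) that span_base[of a "{a}"] by (auto simp: V'_def orthogonal_def)
    have aa: "a \<bullet> a = 1" using na by (simp add: dot_square_norm)
    let ?e = "e(i0 := a)"
    show ?case
    proof (rule exI[of _ ?e], intro conjI ballI impI)
      show "?e i \<in> V" if "i \<in> insert i0 P" for i using that ae na by auto
      show "?e i \<bullet> ?e j = (if i = j then 1 else 0)" if "i \<in> insert i0 P" "j \<in> insert i0 P" for i j
        using that e(2) ae aa insert.hyps by (auto simp: inner_commute)
      show "(g *v ?e i) \<bullet> (g *v ?e j) = 0" if "i \<in> insert i0 P" "j \<in> insert i0 P" "i \<noteq> j" for i j
      proof -
        have "(g *v a) \<bullet> (g *v e k) = 0" "(g *v e k) \<bullet> (g *v a) = 0" if "k \<in> P" for k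
          using orth[OF ae(2)[OF that] ae(1)[OF that]] by (simp_all add: inner_commute)
        then show ?thesis using that e(3) insert.hyps by auto
      qed
    qed
  qed
qed

lemma orthogonalizing_frame:
  fixes g :: "real^'n^'n" and P :: "'n set"
  assumes V: "subspace V" "card P = dim V"
  shows "\<exists>E. frame P V E \<and> (\<forall>i\<in>P. \<forall>j\<in>P. i \<noteq> j \<longrightarrow> (g *v E $ i) \<bullet> (g *v E $ j) = 0)"
proof -
  obtain e where e: "\<forall>i\<in>P. e i \<in> V" "\<forall>i\<in>P. \<forall>j\<in>P. e i \<bullet> e j = (if i = j then 1 else 0)"
     "\<forall>i\<in>P. \<forall>j\<in>P. i \<noteq> j \<longrightarrow> (g *v e i) \<bullet> (g *v e j) = 0"
    using orthogonalizing_system[OF V] by metis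
  have "\<exists>F. frame P V F" by (rule frame_exists[OF V])
  then obtain F where F: "frame P V F" by (elim exE)
  have "frame P V (\<chi> i. if i \<in> P then e i else F $ i)"
    by (rule frame_replace[OF F]) (use e in auto)
  then show ?thesis using e(3) by (intro exI[of _ "\<chi> i. if i \<in> P then e i else F $ i"]) simp
qed

text \<open>
  The factor by which \<open>g\<close> changes volume in \<open>V\<close> is the product of the lengths
  \<open>norm (g *v E $ k)\<close>. So the left side is the volume of the parallelepiped spanned by the
  \<open>g *v w $ i\<close>, and the right side is Hadamard's bound for it. In coordinates: the matrix with
  entries \<open>w $ i \<bullet> E $ j\<close> times these lengths has rows no larger than \<open>norm (g *v w
  $ i)\<close>, by the Cauchy-Schwarz inequality.
\<close>

lemma prod_lengths_le:
  fixes g E w :: "real^'n^'n"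
  assumes E: "frame P V E" and o: "\<And>i j. i \<in> P \<Longrightarrow> j \<in> P \<Longrightarrow> i \<noteq> j \<Longrightarrow> (g *v E $ i) \<bullet> (g *v E $ j) = 0"
    and w: "\<And>i. i \<in> P \<Longrightarrow> w $ i \<in> V"
  shows "(\<Prod>k\<in>P. norm (g *v E $ k)) * \<bar>det (mix P w E)\<bar> \<le> fact CARD('n) * (\<Prod>i\<in>P. norm (g *v w $ i))"
proof -
  define d where "d k = (if k \<in> P then norm (g *v E $ k) else 1)" for k
  define B where "B k = (if k \<in> P then norm (g *v w $ k) else 1)" for k
  define M where "M = mix P w E ** transpose E"
  define C where "C = M ** (\<chi> i j. if i = j then d i else 0)"
  have oE: "orthogonal_matrix E" using E by (simp add: frame_def)
  have Mn: "M $ i $ j = mix P w E $ i \<bullet> E $ j" for i j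
    by (simp add: M_def matrix_matrix_mult_def transpose_def inner_vec_def)
  have Cn: "C $ i $ j = M $ i $ j * d j" for i j
    by (simp add: C_def matrix_matrix_mult_def if_distrib cong: if_cong)
  have "\<bar>det E\<bar> = 1" using det_orthogonal_matrix[OF oE] by auto
  then have dM: "\<bar>det M\<bar> = \<bar>det (mix P w E)\<bar>" by (simp add: M_def det_mul abs_mult)
  have dd: "det (\<chi> i j. if i = j then d i else 0) = (\<Prod>i\<in>UNIV. d i)"
    by (subst det_diagonal) auto
  have pd: "(\<Prod>i\<in>UNIV. d i) = (\<Prod>k\<in>P. norm (g *v E $ k))"
    by (subst prod.mono_neutral_right[of UNIV P]) (auto simp: d_def)
  have pB: "(\<Prod>i\<in>UNIV. B i) = (\<Prod>k\<in>P. norm (g *v w $ k))"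
    by (subst prod.mono_neutral_right[of UNIV P]) (auto simp: B_def)
  \<comment> \<open>For \<open>j \<in> P\<close> this is the Cauchy-Schwarz inequality divided by \<open>d j\<close>.\<close>
  have le: "\<bar>C $ i $ j\<bar> \<le> B i" for i j
  proof (cases "i \<in> P")
    case False
    then show ?thesis using oE by (auto simp: Cn Mn B_def d_def orthogonal_matrix_rows)
  next
    case i: True
    show ?thesis
    proof (cases "j \<in> P")
      case False
      then have "E $ j \<bullet> w $ i = 0" using E w i by (auto simp: frame_def)
      then show ?thesis using i by (simp add: Cn Mn B_def inner_commute)
    next
      case j: True
      have "g *v w $ i = g *v (\<Sum>k\<in>P. (E $ k \<bullet> w $ i) *\<^sub>R E $ k)"
        using frame_expand[OF E w[OF i]] by simp
      also have "\<dots> = (\<Sum>k\<in>P. (E $ k \<bullet> w $ i) *\<^sub>R (g *v E $ k))"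
        by (simp add: linear_sum[OF matrix_vector_mul_linear] matrix_vector_mult_scaleR)
      finally have "(g *v w $ i) \<bullet> (g *v E $ j) = (\<Sum>k\<in>P. (E $ k \<bullet> w $ i) * ((g *v E $ k) \<bullet> (g *v E $ j)))"
        by (simp add: inner_sum_left)
      also have "\<dots> = (\<Sum>k\<in>P. if k = j then (E $ k \<bullet> w $ i) * (d j)\<^sup>2 else 0)"
        using o j by (intro sum.cong) (auto simp: d_def dot_square_norm)
      also have "\<dots> = (E $ j \<bullet> w $ i) * (d j)\<^sup>2" using j by simp
      finally have eq: "(g *v w $ i) \<bullet> (g *v E $ j) = (E $ j \<bullet> w $ i) * (d j)\<^sup>2" .
      have "\<bar>(E $ j \<bullet> w $ i) * (d j)\<^sup>2\<bar> \<le> norm (g *v w $ i) * d j"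
        unfolding eq[symmetric] using Cauchy_Schwarz_ineq2[of "g *v w $ i" "g *v E $ j"] j by (simp add: d_def)
      then have "(\<bar>E $ j \<bullet> w $ i\<bar> * d j) * d j \<le> norm (g *v w $ i) * d j"
        by (simp add: abs_mult power2_eq_square mult.assoc)
      then have "\<bar>E $ j \<bullet> w $ i\<bar> * d j \<le> norm (g *v w $ i)"
        by (cases "d j = 0") (auto simp: d_def j)
      moreover have "d j \<ge> 0" by (simp add: d_def)
      ultimately show ?thesis using i by (simp add: Cn Mn B_def abs_mult inner_commute)
    qed
  qed
  have "\<bar>det C\<bar> \<le> fact CARD('n) * (\<Prod>i\<in>UNIV. B i)" by (rule det_leibniz_bound[OF le])
  moreover have "\<bar>det C\<bar> = \<bar>det (mix P w E)\<bar> * (\<Prod>k\<in>P. norm (g *v E $ k))"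
    by (simp add: C_def det_mul abs_mult dM dd pd abs_prod)
  ultimately show ?thesis by (simp add: pB mult.commute)
qed

section \<open>Nets in block orthogonal groups\<close>

definition block_orthogonal :: "'n set \<Rightarrow> (real^'n^'n) set" where
  "block_orthogonal P = {h. orthogonal_matrix h \<and> (\<forall>i j. \<not> (i \<in> P \<and> j \<in> P) \<longrightarrow> h $ i $ j = (if i = j then 1 else 0))}"

text \<open>
  For \<open>P = first_coords n\<close> and decreasing \<open>c\<close> this is the exponent
  \<open>delta\<close>: the logarithmic size of the orthogonal group of the block when points are identified
  whose quotient stays bounded under conjugation by \<open>diag (exp c)\<close>.
\<close>

definition spread :: "'n::{finite,wellorder} set \<Rightarrow> ('n \<Rightarrow> real) \<Rightarrow> real" where
  "spread P c = (\<Sum>(i, j) \<in> {(i, j). i \<in> P \<and> j \<in> P \<and> i < j}. \<bar>c i - c j\<bar>)"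

lemma spread_eq:
  fixes c :: "'n::{finite,wellorder} \<Rightarrow> real"
  shows "(\<Sum>i\<in>P. \<Sum>j\<in>P. max 0 (c j - c i)) = spread P c"
proof -
  let ?f = "\<lambda>(i, j). max 0 (c j - c i)"
  let ?A = "{(i, j). i \<in> P \<and> j \<in> P \<and> i < j}" and ?B = "{(i, j). i \<in> P \<and> j \<in> P \<and> j < i}"
    and ?D = "{(i, j). i \<in> P \<and> j \<in> P \<and> j = i}"
  have fin: "finite X" for X :: "('n \<times> 'n) set" by simp
  have "(\<Sum>i\<in>P. \<Sum>j\<in>P. max 0 (c j - c i)) = sum ?f (P \<times> P)" by (simp add: sum.cartesian_product)
  also have "P \<times> P = ?A \<union> (?B \<union> ?D)" by auto
  also have "sum ?f \<dots> = sum ?f ?A + sum ?f (?B \<union> ?D)"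
    by (rule sum.union_disjoint[OF fin fin]) auto
  also have "sum ?f (?B \<union> ?D) = sum ?f ?B + sum ?f ?D"
    by (rule sum.union_disjoint[OF fin fin]) auto
  also have "sum ?f ?D = 0" by (rule sum.neutral) auto
  also have "sum ?f ?B = (\<Sum>(i, j) \<in> ?A. max 0 (c i - c j))"
    by (rule sum.reindex_bij_witness[of _ "\<lambda>(i,j). (j,i)" "\<lambda>(i,j). (j,i)"]) auto
  also have "sum ?f ?A + ((\<Sum>(i, j) \<in> ?A. max 0 (c i - c j)) + 0) = spread P c"
    unfolding spread_def by (simp add: sum.distrib[symmetric]) (rule sum.cong, auto)
  finally show ?thesis .
qed

lemma emeasure_cbox_mat:
  fixes A B :: "real^'n^'m"
  assumes le: "\<And>i j. A $ i $ j \<le> B $ i $ j"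
  shows "emeasure lborel (cbox A B) = ennreal (\<Prod>i\<in>UNIV. \<Prod>j\<in>UNIV. B $ i $ j - A $ i $ j)"
proof -
  have B1: "(Basis :: (real^'n^'m) set) = (\<lambda>(i,j). axis i (axis j 1)) ` (UNIV \<times> UNIV)" by (auto simp: Basis_vec_def)
  have "inj (\<lambda>(i,j). axis i (axis j (1::real)) :: real^'n^'m)" by (auto simp: inj_def axis_eq_axis)
  then have "(\<Prod>u\<in>Basis. (B - A) \<bullet> u) = (\<Prod>(i,j)\<in>UNIV \<times> UNIV. (B - A) \<bullet> axis i (axis j 1))"
    unfolding B1 by (subst prod.reindex) (auto simp: case_prod_unfold)
  also have "\<dots> = (\<Prod>i\<in>UNIV. \<Prod>j\<in>UNIV. B $ i $ j - A $ i $ j)"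
    by (simp add: inner_axis prod.cartesian_product)
  finally have eq: "(\<Prod>u\<in>Basis. (B - A) \<bullet> u) = (\<Prod>i\<in>UNIV. \<Prod>j\<in>UNIV. B $ i $ j - A $ i $ j)" .
  have "A \<bullet> u \<le> B \<bullet> u" if "u \<in> Basis" for u
    using that le by (auto simp: Basis_vec_def inner_axis)
  then show ?thesis unfolding eq[symmetric] by (subst emeasure_lborel_cbox) auto
qed

lemma mem_cbox_mat: "X \<in> cbox A B \<longleftrightarrow> (\<forall>i j. A $ i $ j \<le> X $ i $ j \<and> X $ i $ j \<le> B $ i $ j)" for X :: "real^'n^'m"
  by (auto simp: mem_box Basis_vec_def inner_axis)

lemma norm_mult_orthogonal_right:
  fixes X y :: "real^'n^'n"
  assumes "orthogonal_matrix y" shows "norm (X ** transpose y) = norm X"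
proof -
  have "(X ** transpose y) $ i = y *v X $ i" for i
    by (simp add: vec_eq_iff matrix_matrix_mult_def matrix_vector_mult_def transpose_def mult.commute)
  then show ?thesis by (simp add: norm_vec_def[of "X ** transpose y"] norm_vec_def[of X] orthogonal_matrix_norm[OF assms] del: L2_set_def)
qed

lemma norm_transpose: "norm (transpose X) = norm (X :: real^'n^'m)"
proof -
  have "(\<Sum>i\<in>UNIV. \<Sum>j\<in>UNIV. (X $ j $ i)\<^sup>2) = (\<Sum>j\<in>UNIV. \<Sum>i\<in>UNIV. (X $ j $ i)\<^sup>2)" by (rule sum.swap)
  then show ?thesis
    by (simp add: norm_vec_def L2_set_def transpose_def sum_nonneg)
qed

lemma norm_mult_orthogonal_left:
  fixes X h :: "real^'n^'n"
  assumes "orthogonal_matrix h" shows "norm (h ** X) = norm X"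
proof -
  have "norm (h ** X) = norm (transpose X ** transpose h)" by (metis norm_transpose matrix_transpose_mul)
  also have "\<dots> = norm X" by (simp add: norm_mult_orthogonal_right[OF assms] norm_transpose)
  finally show ?thesis .
qed

text \<open>
  The weights are submultiplicative, so matrices close to the identity in the weighted sense behave like a
  neighbourhood of one in a group. Here this is used only in the form that a quotient of two of them is
  bounded: a largest weighted entry of \<open>R\<close> would reproduce itself with a factor less than one.
\<close>

lemma block_group_estimate:
  fixes S S' R :: "real^'n^'n"
  assumes eq: "S' ** R = S"
    and S: "\<And>i j. \<bar>S $ i $ j - mat 1 $ i $ j\<bar> \<le> (1 / (4 * CARD('n))) * w i j"
    and S': "\<And>i j. \<bar>S' $ i $ j - mat 1 $ i $ j\<bar> \<le> (1 / (4 * CARD('n))) * w i j"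
    and w1: "\<And>i. i \<in> P \<Longrightarrow> w i i = 1" and wpos: "\<And>i j. i \<in> P \<Longrightarrow> j \<in> P \<Longrightarrow> 0 < w i j"
    and w0: "\<And>i j. i \<in> P \<Longrightarrow> j \<notin> P \<Longrightarrow> w i j = 0"
    and wm: "\<And>i j k. i \<in> P \<Longrightarrow> j \<in> P \<Longrightarrow> k \<in> P \<Longrightarrow> w i k * w k j \<le> w i j"
    and ij: "i0 \<in> P" "j0 \<in> P"
  shows "\<bar>R $ i0 $ j0\<bar> \<le> 2 * w i0 j0"
proof -
  define e where "e = 1 / (4 * real CARD('n))"
  have e: "0 < e" "e \<le> 1/4" "CARD('n) * e = 1/4" by (auto simp: e_def field_simps Suc_leI)
  define Q where "Q = (\<lambda>(i,j). \<bar>R $ i $ j\<bar> / w i j) ` (P \<times> P)"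
  define M where "M = Max Q"
  have Qf: "finite Q" "Q \<noteq> {}" using ij by (auto simp: Q_def)
  have RM: "\<bar>R $ i $ j\<bar> \<le> M * w i j" if "i \<in> P" "j \<in> P" for i j
  proof -
    have "\<bar>R $ i $ j\<bar> / w i j \<le> M" unfolding M_def using Qf that by (intro Max_ge) (auto simp: Q_def)
    then show ?thesis using wpos[OF that] by (simp add: divide_le_eq)
  qed
  have "0 \<le> M" 
  proof -
    have "0 \<le> M * w i0 j0" using RM[OF ij] by linarith
    then show ?thesis using wpos[OF ij] by (simp add: zero_le_mult_iff)
  qed
  have main: "\<bar>R $ i $ j\<bar> \<le> (5/4 + M / 4) * w i j" if i: "i \<in> P" and j: "j \<in> P" for i j
  proof -
    have "S $ i $ j = (\<Sum>k\<in>UNIV. S' $ i $ k * R $ k $ j)" by (simp add: eq[symmetric] matrix_matrix_mult_def)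
    also have "\<dots> = (\<Sum>k\<in>UNIV. (mat 1 $ i $ k) * R $ k $ j) + (\<Sum>k\<in>UNIV. (S' $ i $ k - mat 1 $ i $ k) * R $ k $ j)"
      by (simp add: sum.distrib[symmetric] algebra_simps)
    also have "(\<Sum>k\<in>UNIV. (mat 1 $ i $ k) * R $ k $ j) = R $ i $ j"
      by (simp add: mat_def if_distrib[of "\<lambda>x. x * _"] cong: if_cong)
    finally have "R $ i $ j = S $ i $ j - (\<Sum>k\<in>UNIV. (S' $ i $ k - mat 1 $ i $ k) * R $ k $ j)" by simp
    then have "\<bar>R $ i $ j\<bar> \<le> \<bar>S $ i $ j\<bar> + \<bar>\<Sum>k\<in>UNIV. (S' $ i $ k - mat 1 $ i $ k) * R $ k $ j\<bar>" by linarith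
    also have "\<bar>S $ i $ j\<bar> \<le> 5/4 * w i j"
    proof -
      have "\<bar>S $ i $ j\<bar> \<le> \<bar>mat 1 $ i $ j :: real\<bar> + \<bar>S $ i $ j - mat 1 $ i $ j\<bar>" by linarith
      also have "\<bar>mat 1 $ i $ j :: real\<bar> \<le> w i j" using w1[OF i] wpos[OF i j] by (auto simp: mat_def)
      also have "\<bar>S $ i $ j - mat 1 $ i $ j\<bar> \<le> 1/4 * w i j"
        using S[of i j] mult_right_mono[OF e(2), of "w i j"] wpos[OF i j] unfolding e_def by linarith
      finally show ?thesis by simp
    qed
    also have "\<bar>\<Sum>k\<in>UNIV. (S' $ i $ k - mat 1 $ i $ k) * R $ k $ j\<bar> \<le> (\<Sum>k\<in>(UNIV::'n set). e * M * w i j)"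
    proof (rule order_trans[OF sum_abs sum_mono])
      fix k :: 'n
      show "\<bar>(S' $ i $ k - mat 1 $ i $ k) * R $ k $ j\<bar> \<le> e * M * w i j"
      proof (cases "k \<in> P")
        case True
        have "\<bar>(S' $ i $ k - mat 1 $ i $ k) * R $ k $ j\<bar> \<le> (e * w i k) * (M * w k j)"
          unfolding abs_mult using S'[of i k] RM[OF True j] wpos[OF i True] e
          by (intro mult_mono) (auto simp: e_def)
        also have "\<dots> = e * M * (w i k * w k j)" by simp
        also have "\<dots> \<le> e * M * w i j" using wm[OF i j True] e \<open>0 \<le> M\<close> by (intro mult_left_mono) auto
        finally show ?thesis .
      next
        case False
        then have "S' $ i $ k - mat 1 $ i $ k = 0" using S'[of i k] w0[OF i] by simp
        then show ?thesis using e \<open>0 \<le> M\<close> wpos[OF i j] by simp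
      qed
    qed
    also have "(\<Sum>k\<in>(UNIV::'n set). e * M * w i j) = M / 4 * w i j" using e(3) by simp
    finally show ?thesis by (simp add: algebra_simps)
  qed
  have "M \<in> Q" unfolding M_def using Qf by (rule Max_in)
  then obtain i j where ijM: "i \<in> P" "j \<in> P" "M = \<bar>R $ i $ j\<bar> / w i j" by (auto simp: Q_def)
  have "M * w i j \<le> (5/4 + M / 4) * w i j" using main[OF ijM(1,2)] wpos[OF ijM(1,2)] ijM(3) by simp
  then have "M \<le> 5/4 + M / 4" by (rule mult_right_le_imp_le) (rule wpos[OF ijM(1,2)])
  then have "M \<le> 2" by simp
  then have "M * w i0 j0 \<le> 2 * w i0 j0" using wpos[OF ij] by simp
  then show ?thesis using RM[OF ij] by linarith
qed

text \<open>
  The entries of the quotient stay bounded after conjugation by \<open>diag (exp c)\<close> and by its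
  inverse, so \<open>x\<close> and \<open>y\<close> may be exchanged in all length estimates at the cost of a
  constant.
\<close>

definition near_block :: "'n set \<Rightarrow> ('n \<Rightarrow> real) \<Rightarrow> real^'n^'n \<Rightarrow> real^'n^'n \<Rightarrow> bool" where
  "near_block P c x y \<longleftrightarrow> (\<forall>i\<in>P. \<forall>j\<in>P. \<bar>(y ** transpose x) $ i $ j\<bar> \<le> 2 * exp (- \<bar>c i - c j\<bar>))"

text \<open>
  Only one of two transposed entries is small; asking this of both would double the exponent in
  \<open>emeasure_slant_box\<close>. Orthogonality supplies the other one in \<open>slant_box_overlap\<close>.
\<close>

definition slant_weight :: "'n set \<Rightarrow> ('n \<Rightarrow> real) \<Rightarrow> 'n \<Rightarrow> 'n \<Rightarrow> real" where
  "slant_weight P c i j = (if i \<in> P \<and> j \<in> P then exp (- max 0 (c j - c i)) else 1)"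

definition slant_box :: "'n::finite set \<Rightarrow> ('n \<Rightarrow> real) \<Rightarrow> (real^'n^'n) set" where
  "slant_box P c = cbox (mat 1 - (\<chi> i j. slant_weight P c i j / (4 * CARD('n))))
                        (mat 1 + (\<chi> i j. slant_weight P c i j / (4 * CARD('n))))"

text \<open>
  The quotient \<open>y ** transpose x\<close> is a quotient of elements of the slanted box and so obeys the
  slanted bound. Its transpose is the quotient in the opposite order and obeys it too; together these bound
  each entry by the smaller of two transposed weights, which is \<open>exp (- \<bar>c i - c j\<bar>)\<close>.
\<close>

lemma slant_box_overlap:
  fixes x y T T' :: "real^'n^'n"
  assumes x: "x \<in> block_orthogonal P" and y: "y \<in> block_orthogonal P"
    and T: "T \<in> slant_box P c" and T': "T' \<in> slant_box P c" and eq: "T ** x = T' ** y"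
  shows "near_block P c x y"
proof -
  define w where "w i j = (if i \<in> P \<and> j \<in> P then exp (- max 0 (c j - c i)) else 0)" for i j
  \<comment> \<open>Cutting a matrix down to the block commutes with multiplication by elements of the block group.\<close>
  define pr where "pr A = (\<chi> i j. if i \<in> P \<and> j \<in> P then A $ i $ j else if i = j then 1 else 0)" for A :: "real^'n^'n"
  have ox: "orthogonal_matrix x" "\<And>i j. \<not> (i \<in> P \<and> j \<in> P) \<Longrightarrow> x $ i $ j = (if i = j then 1 else 0)"
    using x by (auto simp: block_orthogonal_def)
  have oy: "orthogonal_matrix y" "\<And>i j. \<not> (i \<in> P \<and> j \<in> P) \<Longrightarrow> y $ i $ j = (if i = j then 1 else 0)"
    using y by (auto simp: block_orthogonal_def)
  have pm: "(pr A ** z) $ i $ j = (if i \<in> P \<and> j \<in> P then (A ** z) $ i $ j else if i = j then 1 else 0)"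
    if z: "\<And>i j. \<not> (i \<in> P \<and> j \<in> P) \<Longrightarrow> z $ i $ j = (if i = j then 1 else 0)" for A z i j
  proof (cases "i \<in> P")
    case i: True
    show ?thesis
    proof (cases "j \<in> P")
      case j: True
      have "(pr A ** z) $ i $ j = (\<Sum>k\<in>UNIV. A $ i $ k * z $ k $ j)"
        unfolding matrix_matrix_mult_def pr_def
        by (simp, rule sum.cong) (use i j z in auto)
      then show ?thesis using i j by (simp add: matrix_matrix_mult_def)
    next
      case j: False
      have "(pr A ** z) $ i $ j = (\<Sum>k\<in>UNIV. pr A $ i $ k * (if k = j then 1 else 0))"
        unfolding matrix_matrix_mult_def by (simp, rule sum.cong) (use j z in auto)
      also have "\<dots> = (\<Sum>k\<in>UNIV. if k = j then pr A $ i $ k else 0)" by (intro sum.cong) auto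
      also have "\<dots> = pr A $ i $ j" by simp
      finally show ?thesis using j by (simp add: pr_def)
    qed
  next
    case i: False
    have "(pr A ** z) $ i $ j = (\<Sum>k\<in>UNIV. (if i = k then 1 else 0) * z $ k $ j)"
      unfolding matrix_matrix_mult_def pr_def by (simp, rule sum.cong) (use i in auto)
    also have "\<dots> = (\<Sum>k\<in>UNIV. if i = k then z $ k $ j else 0)" by (intro sum.cong) auto
    also have "\<dots> = z $ i $ j" by simp
    finally show ?thesis using i z by simp
  qed
  have pe: "pr T ** x = pr T' ** y"
    using pm[OF ox(2)] pm[OF oy(2)] eq by (simp add: vec_eq_iff)
  have xx: "x ** transpose x = mat 1" "y ** transpose y = mat 1"
    using ox(1) oy(1) orthogonal_matrix_def[of x] orthogonal_matrix_def[of y] by auto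
  have e1: "pr T' ** (y ** transpose x) = pr T"
    unfolding matrix_mul_assoc pe[symmetric] unfolding matrix_mul_assoc[symmetric] xx(1) by simp
  have e2: "pr T ** (x ** transpose y) = pr T'"
    unfolding matrix_mul_assoc pe unfolding matrix_mul_assoc[symmetric] xx(2) by simp
  have b: "\<bar>pr A $ i $ j - mat 1 $ i $ j\<bar> \<le> (1 / (4 * CARD('n))) * w i j" if A: "A \<in> slant_box P c" for A i j
  proof (cases "i \<in> P \<and> j \<in> P")
    case True
    have "(mat 1 - (\<chi> i j. slant_weight P c i j / (4 * CARD('n)))) $ i $ j \<le> A $ i $ j
      \<and> A $ i $ j \<le> (mat 1 + (\<chi> i j. slant_weight P c i j / (4 * CARD('n)))) $ i $ j"
      using A unfolding slant_box_def mem_cbox_mat by blast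
    then show ?thesis using True by (simp add: pr_def w_def slant_weight_def abs_le_iff)
  next
    case False
    then show ?thesis by (auto simp: pr_def w_def mat_def)
  qed
  have wfacts: "\<And>i. i \<in> P \<Longrightarrow> w i i = 1" "\<And>i j. i \<in> P \<Longrightarrow> j \<in> P \<Longrightarrow> 0 < w i j"
    "\<And>i j. i \<in> P \<Longrightarrow> j \<notin> P \<Longrightarrow> w i j = 0"
    by (auto simp: w_def)
  have wm: "w i k * w k j \<le> w i j" if "i \<in> P" "j \<in> P" "k \<in> P" for i j k
    using that by (simp add: w_def exp_add[symmetric])
  have r1: "\<bar>(y ** transpose x) $ i $ j\<bar> \<le> 2 * w i j" if "i \<in> P" "j \<in> P" for i j
    by (rule block_group_estimate[OF e1 b[OF T] b[OF T'] wfacts wm that])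
  have r2: "\<bar>(x ** transpose y) $ i $ j\<bar> \<le> 2 * w i j" if "i \<in> P" "j \<in> P" for i j
    by (rule block_group_estimate[OF e2 b[OF T'] b[OF T] wfacts wm that])
  show ?thesis unfolding near_block_def
  proof (intro ballI)
    fix i j assume ij: "i \<in> P" "j \<in> P"
    have "(y ** transpose x) $ i $ j = (x ** transpose y) $ j $ i"
      by (simp add: matrix_matrix_mult_def transpose_def mult.commute)
    then have "\<bar>(y ** transpose x) $ i $ j\<bar> \<le> 2 * w j i" using r2[OF ij(2,1)] by simp
    then have "\<bar>(y ** transpose x) $ i $ j\<bar> \<le> 2 * min (w i j) (w j i)" using r1[OF ij] by simp
    also have "min (w i j) (w j i) = exp (- \<bar>c i - c j\<bar>)" using ij by (auto simp: w_def min_def max_def abs_if)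
    finally show "\<bar>(y ** transpose x) $ i $ j\<bar> \<le> 2 * exp (- \<bar>c i - c j\<bar>)" .
  qed
qed

lemma emeasure_slant_box:
  fixes P :: "'n::{finite,wellorder} set"
  shows "emeasure lborel (slant_box P c) = ennreal ((1 / (2 * real CARD('n))) ^ (CARD('n) * CARD('n)) * exp (- spread P c))"
proof -
  have pos: "0 \<le> slant_weight P c i j" for i j by (simp add: slant_weight_def)
  have "emeasure lborel (slant_box P c) = ennreal (\<Prod>i\<in>UNIV. \<Prod>j\<in>UNIV. (1 / (2 * real CARD('n))) * slant_weight P c i j)"
    unfolding slant_box_def by (subst emeasure_cbox_mat) (auto simp: pos add_increasing2 field_simps intro!: arg_cong[where f=ennreal] prod.cong)
  also have "(\<Prod>i\<in>UNIV. \<Prod>j\<in>UNIV. (1 / (2 * real CARD('n))) * slant_weight P c i j) =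
     (1 / (2 * real CARD('n))) ^ (CARD('n) * CARD('n)) * (\<Prod>i\<in>UNIV. \<Prod>j\<in>UNIV. slant_weight P c i j)"
  proof -
    have "(\<Prod>i\<in>UNIV. \<Prod>j\<in>UNIV. a * slant_weight P c i j) =
      a ^ (CARD('n) * CARD('n)) * (\<Prod>i\<in>UNIV. \<Prod>j\<in>UNIV. slant_weight P c i j)" for a
      by (simp add: prod.distrib power_mult)
    then show ?thesis .
  qed
  also have "(\<Prod>i\<in>UNIV. \<Prod>j\<in>UNIV. slant_weight P c i j) = (\<Prod>i\<in>P. \<Prod>j\<in>P. exp (- max 0 (c j - c i)))"
  proof -
    have "(\<Prod>j\<in>UNIV. slant_weight P c i j) = (if i \<in> P then (\<Prod>j\<in>P. exp (- max 0 (c j - c i))) else 1)" for i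
    proof (cases "i \<in> P")
      case True
      have "(\<Prod>j\<in>UNIV. slant_weight P c i j) = (\<Prod>j\<in>P. slant_weight P c i j)"
        by (rule prod.mono_neutral_right) (auto simp: slant_weight_def)
      also have "\<dots> = (\<Prod>j\<in>P. exp (- max 0 (c j - c i)))" by (rule prod.cong) (auto simp: slant_weight_def True)
      finally show ?thesis using True by simp
    qed (simp add: slant_weight_def)
    then have "(\<Prod>i\<in>UNIV. \<Prod>j\<in>UNIV. slant_weight P c i j) = (\<Prod>i\<in>UNIV. if i \<in> P then (\<Prod>j\<in>P. exp (- max 0 (c j - c i))) else 1)"
      by simp
    also have "\<dots> = (\<Prod>i\<in>P. if i \<in> P then (\<Prod>j\<in>P. exp (- max 0 (c j - c i))) else 1)"
      by (rule prod.mono_neutral_right) auto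
    also have "\<dots> = (\<Prod>i\<in>P. \<Prod>j\<in>P. exp (- max 0 (c j - c i)))" by (rule prod.cong) auto
    finally show ?thesis .
  qed
  also have "\<dots> = exp (- spread P c)"
    by (simp add: exp_sum[symmetric] sum_negf spread_eq)
  finally show ?thesis .
qed

text \<open>
  The volume of a ball that contains all thickened group elements, divided by the volume of the box of
  half-sides \<open>1 / (4 * N)\<close>.
\<close>

definition net_const :: "'n::finite itself \<Rightarrow> real" where
  "net_const _ = measure lborel (cball (0::real^'n^'n) (2 * real CARD('n) * real CARD('n))) * (2 * CARD('n)) ^ (CARD('n) * CARD('n))"

lemma norm_mat_le:
  fixes X :: "real^'n^'n"
  assumes "\<And>i j. \<bar>X $ i $ j\<bar> \<le> B"
  shows "norm X \<le> real CARD('n) * real CARD('n) * B"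
proof -
  have "norm X \<le> (\<Sum>i\<in>UNIV. norm (X $ i))" unfolding norm_vec_def[of X] by (rule L2_set_le_sum) simp
  also have "\<dots> \<le> (\<Sum>i\<in>(UNIV::'n set). real CARD('n) * B)"
  proof (rule sum_mono)
    fix i
    have "norm (X $ i) \<le> (\<Sum>j\<in>UNIV. \<bar>X $ i $ j\<bar>)" by (rule norm_le_l1_cart)
    also have "\<dots> \<le> (\<Sum>j\<in>(UNIV::'n set). B)" using assms by (intro sum_mono)
    finally show "norm (X $ i) \<le> real CARD('n) * B" by simp
  qed
  finally show ?thesis by simp
qed

text \<open>
  A covering number of the group is obtained from Lebesgue measure on all matrices, which avoids Haar measure
  and coordinates on the group: thicken each point \<open>y\<close> to the slanted box times \<open>y\<close>.
  Separation makes these sets disjoint, each has volume a constant times \<open>exp (- spread P c)\<close>,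
  and all lie in a fixed ball.
\<close>

lemma separated_card:
  fixes P :: "'n::{finite,wellorder} set"
  assumes A: "finite A" "A \<subseteq> block_orthogonal P"
    and sep: "\<And>x y. x \<in> A \<Longrightarrow> y \<in> A \<Longrightarrow> x \<noteq> y \<Longrightarrow> \<not> near_block P c x y"
  shows "real (card A) \<le> net_const TYPE('n) * exp (spread P c)"
proof -
  let ?U = "\<lambda>y::real^'n::_^'n::_. {X::real^'n::_^'n::_. X ** transpose y \<in> slant_box P c}"
  let ?C = "cball (0::real^'n::_^'n::_) (2 * real CARD('n) * real CARD('n))"
  define v where "v = (1 / (2 * real CARD('n))) ^ (CARD('n) * CARD('n)) * exp (- spread P c)"
  have v: "v > 0" by (simp add: v_def)
  have oA: "orthogonal_matrix y" if "y \<in> A" for y using A that by (auto simp: block_orthogonal_def)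
  have bS: "slant_box P c \<in> sets borel" by (simp add: slant_box_def)
  have lin: "linear (\<lambda>X. X ** transpose y)" for y :: "real^'n::_^'n::_"
    by (rule linearI) (simp_all add: vec_eq_iff matrix_matrix_mult_def sum.distrib sum_distrib_left algebra_simps)
  have eU: "emeasure lborel (?U y) = ennreal v" if "y \<in> A" for y
    unfolding v_def emeasure_slant_box[symmetric]
    by (rule emeasure_lborel_isometry[OF lin norm_mult_orthogonal_right[OF oA[OF that]] bS])
  have mU: "?U y \<in> sets borel" for y
  proof -
    have "(\<lambda>X. X ** transpose y) \<in> borel_measurable borel"
      by (rule borel_measurable_continuous_onI[OF linear_continuous_on[OF linear_conv_bounded_linear[THEN iffD1, OF lin]]])
    then have "(\<lambda>X. X ** transpose y) -` slant_box P c \<inter> space borel \<in> sets borel" by (rule measurable_sets[OF _ bS])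
    then show ?thesis by (simp add: vimage_def)
  qed
  have recover: "(X ** transpose y) ** y = X" if "y \<in> A" for X y :: "real^'n::_^'n::_"
  proof -
    have "transpose y ** y = mat 1" using oA[OF that] by (simp add: orthogonal_matrix_def)
    then show ?thesis unfolding matrix_mul_assoc[symmetric] by simp
  qed
  have disj: "disjoint_family_on ?U A"
    unfolding disjoint_family_on_def
  proof (intro ballI impI)
    fix x y assume xy: "x \<in> A" "y \<in> A" "x \<noteq> y"
    show "?U x \<inter> ?U y = {}"
    proof (rule ccontr)
      assume "?U x \<inter> ?U y \<noteq> {}"
      then obtain X where X: "X ** transpose x \<in> slant_box P c" "X ** transpose y \<in> slant_box P c" by blast
      have "near_block P c x y"
        by (rule slant_box_overlap[OF _ _ X]) (use xy A recover in auto)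
      then show False using sep xy by blast
    qed
  qed
  have sub: "?U y \<subseteq> ?C" if y: "y \<in> A" for y
  proof
    fix X assume "X \<in> ?U y"
    then have X: "X ** transpose y \<in> slant_box P c" by simp
    have "\<bar>(X ** transpose y) $ i $ j\<bar> \<le> 2" for i j
    proof -
      have sw: "slant_weight P c i j \<le> 1" by (simp add: slant_weight_def)
      have "slant_weight P c i j / (4 * real CARD('n)) \<le> 1 / (4 * real CARD('n))"
        using sw by (intro divide_right_mono) auto
      also have "\<dots> \<le> 1"
      proof -
        have "1 \<le> real CARD('n)" by (simp add: Suc_leI)
        then have "1 \<le> 4 * real CARD('n)" by linarith
        then show ?thesis by (simp add: divide_le_eq)
      qed
      finally have "slant_weight P c i j / (4 * real CARD('n)) \<le> 1" .
      moreover have "(mat 1 - (\<chi> i j. slant_weight P c i j / (4 * CARD('n)))) $ i $ j \<le> (X ** transpose y) $ i $ j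
        \<and> (X ** transpose y) $ i $ j \<le> (mat 1 + (\<chi> i j. slant_weight P c i j / (4 * CARD('n)))) $ i $ j"
        using X unfolding slant_box_def mem_cbox_mat by blast
      moreover have "0 \<le> (mat 1 :: real^'n::_^'n::_) $ i $ j" "(mat 1 :: real^'n::_^'n::_) $ i $ j \<le> 1" by (auto simp: mat_def)
      ultimately show ?thesis
        unfolding vector_minus_component vector_add_component vec_lambda_beta by linarith
    qed
    then have "norm (X ** transpose y) \<le> real CARD('n) * real CARD('n) * 2" by (rule norm_mat_le)
    then show "X \<in> ?C" by (simp add: norm_mult_orthogonal_right[OF oA[OF y]] mult.commute mult.left_commute)
  qed
  have "ennreal (real (card A) * v) = (\<Sum>y\<in>A. emeasure lborel (?U y))"
    using eU v by (simp add: ennreal_mult' ennreal_of_nat_eq_real_of_nat)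
  also have "\<dots> = emeasure lborel (\<Union>y\<in>A. ?U y)"
    by (rule sum_emeasure) (use A mU disj in auto)
  also have "\<dots> \<le> emeasure lborel ?C" using sub by (intro emeasure_mono) auto
  also have "\<dots> = ennreal (measure lborel ?C)"
    by (rule emeasure_eq_ennreal_measure) (use emeasure_lborel_cball_finite in \<open>auto simp: less_top\<close>)
  finally have "real (card A) * v \<le> measure lborel ?C" by simp
  then have "real (card A) \<le> measure lborel ?C / v" using v by (simp add: le_divide_eq)
  also have "\<dots> = net_const TYPE('n) * exp (spread P c)"
    by (simp add: net_const_def v_def exp_minus field_simps)
  finally show ?thesis .
qed

text \<open>
  A maximal separated subset, which exists because of the bound on its size.
\<close>

lemma near_block_net:
  fixes P :: "'n::{finite,wellorder} set"
  assumes G: "G \<subseteq> block_orthogonal P"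
  shows "\<exists>A. finite A \<and> A \<subseteq> G \<and> real (card A) \<le> net_const TYPE('n) * exp (spread P c)
    \<and> (\<forall>x\<in>G. \<exists>y\<in>A. near_block P c x y)"
proof -
  let ?S = "\<lambda>A. finite A \<and> A \<subseteq> G \<and> (\<forall>x\<in>A. \<forall>y\<in>A. x \<noteq> y \<longrightarrow> \<not> near_block P c x y)"
  have bd: "card A < Suc (nat \<lceil>net_const TYPE('n) * exp (spread P c)\<rceil>)" if "?S A" for A
  proof -
    have "real (card A) \<le> net_const TYPE('n) * exp (spread P c)"
      by (rule separated_card) (use that G in auto)
    then have "card A \<le> nat \<lceil>net_const TYPE('n) * exp (spread P c)\<rceil>" by linarith
    then show ?thesis by simp
  qed
  have "?S {}" by simp
  then have "\<exists>A. ?S A \<and> (\<forall>B. ?S B \<longrightarrow> card B \<le> card A)"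
    by (rule Lattices_Big.ex_has_greatest_nat) (intro allI impI, rule bd)
  then obtain A where A0: "?S A \<and> (\<forall>B. ?S B \<longrightarrow> card B \<le> card A)" by (rule exE)
  have A: "?S A" "\<And>B. ?S B \<Longrightarrow> card B \<le> card A"
    by (rule conjunct1[OF A0]) (rule conjunct2[OF A0, THEN spec, THEN mp])
  have sym: "near_block P c x y \<longleftrightarrow> near_block P c y x" for x y :: "real^'n::_^'n::_"
  proof -
    have "(y ** transpose x) $ i $ j = (x ** transpose y) $ j $ i" for i j
      by (simp add: matrix_matrix_mult_def transpose_def mult.commute)
    then show ?thesis unfolding near_block_def by (metis abs_minus_commute)
  qed
  have refl: "near_block P c x x" if "x \<in> G" for x
  proof -
    have "x ** transpose x = mat 1" using that G by (auto simp: block_orthogonal_def orthogonal_matrix_def)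
    then show ?thesis unfolding near_block_def by (auto simp: mat_def)
  qed
  have "\<exists>y\<in>A. near_block P c x y" if x: "x \<in> G" for x
  proof (rule ccontr)
    assume neg: "\<not> ?thesis"
    then have "x \<notin> A" using refl[OF x] by blast
    have "?S (insert x A)" 
    proof (intro conjI ballI impI)
      show "finite (insert x A)" "insert x A \<subseteq> G" using A(1) x by auto
      fix p q assume "p \<in> insert x A" "q \<in> insert x A" "p \<noteq> q"
      then consider "p = x" "q \<in> A" | "p \<in> A" "q = x" | "p \<in> A" "q \<in> A" by blast
      then show "\<not> near_block P c p q"
      proof cases
        case 1 then show ?thesis using neg by blast
      next
        case 2 then show ?thesis using neg sym by blast
      next
        case 3 then show ?thesis using A(1) \<open>p \<noteq> q\<close> by blast
      qed
    qed
    then have "card (insert x A) \<le> card A" by (rule A(2))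
    then show False using \<open>x \<notin> A\<close> A(1) by simp
  qed
  moreover have "real (card A) \<le> net_const TYPE('n) * exp (spread P c)"
    by (rule separated_card) (use A(1) G in auto)
  ultimately show ?thesis using A(1) by blast
qed

section \<open>The exponent inequality and a neighbourhood of the identity\<close>

lemma orthogonal_matrix_inner:
  fixes F :: "real^'n^'n"
  assumes "orthogonal_matrix F" shows "(F *v x) \<bullet> (F *v y) = x \<bullet> y"
proof -
  have "orthogonal_transformation ((*v) F)"
    using assms by (simp add: orthogonal_transformation_matrix matrix_of_matrix_vector_mul)
  then show ?thesis by (simp add: orthogonal_transformation_def)
qed

lemma matrix_mult_transpose_nth: "(A ** transpose B) $ i $ j = (A $ i :: real^'n) \<bullet> B $ j"
  by (simp add: matrix_matrix_mult_def transpose_def inner_vec_def)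

lemma mat_1_nth: "(mat 1 :: real^'n^'n) $ i = axis i 1"
  by (auto simp: mat_def axis_def vec_eq_iff)

text \<open>
  Both sides are the volume of the parallelepiped spanned in \<open>V\<close>.
\<close>

lemma det_mix_frame_eq:
  fixes F F' w :: "real^'n^'n"
  assumes F: "frame P V F" and F': "frame P V F'"
  shows "\<bar>det (mix P w F')\<bar> = \<bar>det (mix P w F)\<bar>"
proof -
  define U where "U = mix P (mat 1) (F' ** transpose F)"
  have oF: "orthogonal_matrix F" "orthogonal_matrix F'" using F F' by (auto simp: frame_def)
  have row: "(F' ** transpose F) $ i = F *v F' $ i" for i
    by (simp add: vec_eq_iff matrix_mult_transpose_nth matrix_vector_mult_row inner_commute)
  have zero: "F' $ i \<bullet> F $ k = 0" if "i \<notin> P" "k \<in> P" for i k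
    using F F' that by (auto simp: frame_def)
  have "U $ i \<bullet> U $ j = (if i = j then 1 else 0)" for i j
  proof -
    have F'o: "F' $ i \<bullet> F' $ j = (if i = j then 1 else 0)" using oF(2) by (simp add: orthogonal_matrix_rows)
    consider "i \<in> P" "j \<in> P" | "i \<in> P" "j \<notin> P" | "i \<notin> P" "j \<in> P" | "i \<notin> P" "j \<notin> P" by blast
    then show ?thesis
    proof cases
      case 1 then show ?thesis by (simp add: U_def mat_1_nth inner_axis_axis)
    next
      case 2 then show ?thesis using zero[of j i]
        by (auto simp: U_def mat_1_inner row matrix_vector_mult_row inner_commute)
    next
      case 3 then show ?thesis using zero[of i j]
        by (auto simp: U_def mat_1_inner[of j] row matrix_vector_mult_row inner_commute[of _ "mat 1 $ j"] inner_commute[of "F $ _"])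
    next
      case 4 then show ?thesis using F'o by (simp add: U_def row orthogonal_matrix_inner[OF oF(1)])
    qed
  qed
  then have "orthogonal_matrix U" by (simp add: orthogonal_matrix_rows)
  then have dU: "\<bar>det U\<bar> = 1" using det_orthogonal_matrix by fastforce
  have "U ** mix P w F = mix P w F'"
  proof (simp only: vec_eq_iff, intro allI)
    fix i j
    show "(U ** mix P w F) $ i $ j = mix P w F' $ i $ j"
    proof (cases "i \<in> P")
      case True
      have "(U ** mix P w F) $ i $ j = (\<Sum>k\<in>UNIV. if k = i then mix P w F $ k $ j else 0)"
        unfolding matrix_matrix_mult_def vec_lambda_beta
        by (rule sum.cong) (use True in \<open>auto simp: U_def mat_def\<close>)
      then show ?thesis using True by simp
    next
      case False
      have Uik: "U $ i $ k = F $ k \<bullet> F' $ i" for k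
        using False by (simp add: U_def matrix_mult_transpose_nth inner_commute)
      have "(U ** mix P w F) $ i $ j = (\<Sum>k\<in>UNIV. U $ i $ k * mix P w F $ k $ j)"
        by (simp add: matrix_matrix_mult_def)
      also have "\<dots> = (\<Sum>k\<in>UNIV. ((F $ k \<bullet> F' $ i) *\<^sub>R F $ k) $ j)"
        by (rule sum.cong) (use zero[OF False] in \<open>auto simp: Uik inner_commute\<close>)
      also have "\<dots> = (\<Sum>k\<in>UNIV. (F $ k \<bullet> F' $ i) *\<^sub>R F $ k) $ j" by (simp only: sum_component)
      also have "\<dots> = F' $ i $ j" using orthogonal_matrix_expand[OF oF(1), of "F' $ i"] by simp
      finally show ?thesis using False by simp
    qed
  qed
  then have "det U * det (mix P w F) = det (mix P w F')" by (metis det_mul)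
  then show ?thesis using dU by (metis abs_mult mult_1)
qed

text \<open>
  The combinatorial heart of the upper bound: the entropy of the auxiliary rotation of the frame is paid for
  by the boxes. With \<open>y k i = max 0 (l k + s i)\<close>, a factor \<open>min 1 (exp (l k + s i))\<close>
  saves \<open>exp (- y k i)\<close> compared with \<open>exp (l k + s i)\<close>. The exponents without the
  saving add up to \<open>N\<close> times the sum of the \<open>l k\<close>, since the \<open>s i\<close> sum
  to zero. And since \<open>l k'\<close> is at least about \<open>- s (p k')\<close>, each \<open>max 0 (l k -
  l k')\<close> in the spread is at most about \<open>y k (p k')\<close>, where different \<open>k'\<close>
  use different indices \<open>p k'\<close>.
\<close>

lemma spread_key:
  fixes l s :: "'n::{finite,wellorder} \<Rightarrow> real"
  assumes p: "inj p" and lp: "\<And>k. k \<in> P \<Longrightarrow> - b - s (p k) \<le> l k" and b: "0 \<le> b" and s: "(\<Sum>i\<in>UNIV. s i) = 0" and C: "1 \<le> C"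
  shows "exp (spread P l) * (\<Prod>i\<in>UNIV. \<Prod>k\<in>P. min 1 (C * exp (l k + s i)))
     \<le> C ^ (CARD('n) * CARD('n)) * exp (real CARD('n) * real CARD('n) * b) * exp (real CARD('n) * (\<Sum>k\<in>P. l k))"
proof -
  have cP: "card P \<le> CARD('n)" by (simp add: card_mono)
  \<comment> \<open>The saving of a truncated factor over an untruncated one.\<close>
  define y where "y k i = max 0 (l k + s i)" for k i
  have m: "min 1 (C * exp (l k + s i)) \<le> C * exp (l k + s i - y k i)" for k i
  proof (cases "l k + s i \<ge> 0")
    case True
    then show ?thesis using C by (simp add: y_def)
  next
    case False
    then show ?thesis by (simp add: y_def)
  qed
  have "(\<Prod>i\<in>UNIV. \<Prod>k\<in>P. min 1 (C * exp (l k + s i))) \<le> (\<Prod>i\<in>UNIV. \<Prod>k\<in>P. C * exp (l k + s i - y k i))"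
    using m C by (intro prod_mono conjI prod_nonneg) auto
  also have "\<dots> = (\<Prod>i\<in>(UNIV::'n set). C ^ card P) * exp (\<Sum>i\<in>UNIV. \<Sum>k\<in>P. (l k + s i - y k i))"
    by (simp add: prod.distrib exp_sum)
  also have "(\<Prod>i\<in>(UNIV::'n set). C ^ card P) = C ^ (card P * CARD('n))" by (simp add: power_mult)
  also have "\<dots> * exp (\<Sum>i\<in>UNIV. \<Sum>k\<in>P. (l k + s i - y k i)) \<le> C ^ (CARD('n) * CARD('n)) * exp (\<Sum>i\<in>UNIV. \<Sum>k\<in>P. (l k + s i - y k i))"
    using C cP by (intro mult_right_mono power_increasing) auto
  finally have 1: "(\<Prod>i\<in>UNIV. \<Prod>k\<in>P. min 1 (C * exp (l k + s i))) \<le> C ^ (CARD('n) * CARD('n)) * exp (\<Sum>i\<in>UNIV. \<Sum>k\<in>P. (l k + s i - y k i))" .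
  have 2: "(\<Sum>i\<in>UNIV. \<Sum>k\<in>P. (l k + s i - y k i)) = real CARD('n) * (\<Sum>k\<in>P. l k) - (\<Sum>i\<in>UNIV. \<Sum>k\<in>P. y k i)"
    using s by (simp add: sum_subtractf sum.distrib sum_distrib_left[symmetric])
  have "spread P l = (\<Sum>k'\<in>P. \<Sum>k\<in>P. max 0 (l k - l k'))" by (rule spread_eq[symmetric])
  also have "\<dots> \<le> (\<Sum>k'\<in>P. \<Sum>k\<in>P. y k (p k') + b)"
  proof (intro sum_mono)
    fix k k' assume "k \<in> P" "k' \<in> P"
    then show "max 0 (l k - l k') \<le> y k (p k') + b" using lp[of k'] b by (simp add: y_def)
  qed
  also have "\<dots> = (\<Sum>k'\<in>P. \<Sum>k\<in>P. y k (p k')) + real (card P) * real (card P) * b"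
    by (simp add: sum.distrib)
  also have "real (card P) * real (card P) * b \<le> real CARD('n) * real CARD('n) * b"
    using cP b by (intro mult_right_mono mult_mono) auto
  also have "(\<Sum>k'\<in>P. \<Sum>k\<in>P. y k (p k')) = (\<Sum>i\<in>p ` P. \<Sum>k\<in>P. y k i)"
    using p by (subst sum.reindex) (auto simp: inj_on_def inj_def)
  also have "\<dots> \<le> (\<Sum>i\<in>UNIV. \<Sum>k\<in>P. y k i)"
    by (rule sum_mono2) (auto simp: y_def intro!: sum_nonneg)
  finally have 3: "spread P l \<le> (\<Sum>i\<in>UNIV. \<Sum>k\<in>P. y k i) + real CARD('n) * real CARD('n) * b" by simp
  have "exp (spread P l) * (\<Prod>i\<in>UNIV. \<Prod>k\<in>P. min 1 (C * exp (l k + s i)))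
    \<le> exp (spread P l) * (C ^ (CARD('n) * CARD('n)) * exp (\<Sum>i\<in>UNIV. \<Sum>k\<in>P. (l k + s i - y k i)))"
    using 1 by (intro mult_left_mono) auto
  also have "\<dots> = C ^ (CARD('n) * CARD('n)) * exp (spread P l + (\<Sum>i\<in>UNIV. \<Sum>k\<in>P. (l k + s i - y k i)))"
    by (simp add: exp_add)
  also have "\<dots> \<le> C ^ (CARD('n) * CARD('n)) * exp (real CARD('n) * real CARD('n) * b + real CARD('n) * (\<Sum>k\<in>P. l k))"
    using 2 3 C by (intro mult_left_mono) auto
  finally show ?thesis by (simp add: exp_add mult.assoc)
qed

lemma norm_matrix_vector_le:
  fixes A :: "real^'n^'m"
  shows "norm (A *v v) \<le> norm A * norm v"
proof -
  have "(norm (A *v v))\<^sup>2 = (\<Sum>i\<in>UNIV. (A $ i \<bullet> v)\<^sup>2)"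
    unfolding matrix_vector_mult_row[symmetric] by (simp add: norm_vec_def[of "A *v v"] L2_set_def sum_nonneg)
  also have "\<dots> \<le> (\<Sum>i\<in>UNIV. (norm (A $ i))\<^sup>2 * (norm v)\<^sup>2)"
  proof (rule sum_mono)
    fix i
    have "\<bar>A $ i \<bullet> v\<bar> \<le> norm (A $ i) * norm v" by (rule Cauchy_Schwarz_ineq2)
    then have "\<bar>A $ i \<bullet> v\<bar>\<^sup>2 \<le> (norm (A $ i) * norm v)\<^sup>2" by (rule power_mono) simp
    then show "(A $ i \<bullet> v)\<^sup>2 \<le> (norm (A $ i))\<^sup>2 * (norm v)\<^sup>2" by (simp add: power_mult_distrib)
  qed
  also have "\<dots> = (norm A * norm v)\<^sup>2"
    by (simp add: norm_vec_def[of A] L2_set_def sum_nonneg power_mult_distrib sum_distrib_right)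
  finally show ?thesis by (rule power2_le_imp_le) simp
qed

text \<open>
  The radius makes every matrix in the ball invertible with bounded distortion. Random lattices are modelled
  by applying a matrix from this ball to a fixed lattice.
\<close>

definition near_id :: "(real^'n^'n) set" where
  "near_id = cball (mat 1) (1/2)"

lemma near_id_bounds:
  fixes A :: "real^'n^'n"
  assumes "A \<in> near_id"
  shows "norm (A *v v) \<le> 2 * norm v" "norm v / 2 \<le> norm (A *v v)"
proof -
  have "norm (A - mat 1) \<le> 1/2" using assms by (simp add: near_id_def dist_norm norm_minus_commute)
  then have "norm ((A - mat 1) *v v) \<le> 1/2 * norm v"
    using norm_matrix_vector_le[of "A - mat 1" v] mult_right_mono[of "norm (A - mat 1)" "1/2" "norm v"] by simp
  then have *: "norm (A *v v - v) \<le> 1/2 * norm v" by (simp add: matrix_vector_mult_diff_rdistrib)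
  have "norm (A *v v) \<le> norm v + norm (A *v v - v)" using norm_triangle_ineq[of v "A *v v - v"] by simp
  then show "norm (A *v v) \<le> 2 * norm v" using * norm_ge_zero[of v] by linarith
  have "norm v \<le> norm (A *v v) + norm (A *v v - v)" using norm_triangle_ineq4[of "A *v v" "A *v v - v"] by simp
  then show "norm v / 2 \<le> norm (A *v v)" using * by linarith
qed

lemma continuous_on_det: "continuous_on S (det :: real^'n^'n \<Rightarrow> real)"
  unfolding det_def by (intro continuous_intros)

lemma near_id_det:
  "\<exists>c>0. \<forall>A\<in>near_id. c \<le> det (A :: real^'n^'n)"
proof -
  have nz: "det A \<noteq> 0" if "A \<in> near_id" for A :: "real^'n^'n"
    unfolding det_nz_kernel
  proof (intro allI impI)
    fix x assume "A *v x = 0"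
    then have "norm x / 2 \<le> 0" using near_id_bounds(2)[OF that, of x] by simp
    then show "x = 0" by simp
  qed
  have c1: "(mat 1 :: real^'n^'n) \<in> near_id" by (simp add: near_id_def)
  have pos: "0 < det A" if A: "A \<in> near_id" for A :: "real^'n^'n"
  proof (rule ccontr)
    assume "\<not> 0 < det A"
    then have "det A \<le> 0" by simp
    have "connected (det ` (near_id :: (real^'n^'n) set))"
      by (intro connected_continuous_image continuous_on_det convex_connected) (simp add: near_id_def)
    moreover have "det A \<in> det ` (near_id :: (real^'n^'n) set)" by (rule imageI[OF A])
    moreover have "1 \<in> det ` (near_id :: (real^'n^'n) set)"
      by (rule image_eqI[of _ _ "mat 1"]) (simp_all add: c1)
    ultimately have "0 \<in> det ` (near_id :: (real^'n^'n) set)"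
      using \<open>det A \<le> 0\<close> by (meson connectedD_interval zero_le_one)
    then show False using nz by auto
  qed
  have "compact (near_id :: (real^'n^'n) set)" by (simp add: near_id_def)
  then have "\<exists>B\<in>(near_id :: (real^'n^'n) set). \<forall>A\<in>near_id. det B \<le> det (A :: real^'n^'n)"
    using c1 by (intro continuous_attains_inf continuous_on_det) auto
  then obtain B :: "real^'n^'n" where B: "B \<in> near_id" "\<forall>A\<in>near_id. det B \<le> det (A :: real^'n^'n)" by (rule bexE)
  then have "0 < det B" using pos by simp
  then show ?thesis using B(2) by (intro exI[of _ "det B"] conjI)
qed

lemma union_bound:
  assumes I: "finite I" "real (card I) \<le> n" and b: "0 \<le> b"
    and B: "\<And>i. i \<in> I \<Longrightarrow> B i \<in> sets M" "\<And>i. i \<in> I \<Longrightarrow> emeasure M (B i) \<le> ennreal b"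
  shows "(\<Union>i\<in>I. B i) \<in> sets M" "emeasure M (\<Union>i\<in>I. B i) \<le> ennreal (n * b)"
proof -
  show "(\<Union>i\<in>I. B i) \<in> sets M" using I B by auto
  have "emeasure M (\<Union>i\<in>I. B i) \<le> (\<Sum>i\<in>I. emeasure M (B i))"
    by (rule emeasure_subadditive_finite) (use I B in auto)
  also have "\<dots> \<le> (\<Sum>i\<in>I. ennreal b)" by (rule sum_mono) (rule B)
  also have "\<dots> = ennreal (real (card I) * b)" using b by (simp add: ennreal_mult' ennreal_of_nat_eq_real_of_nat)
  also have "\<dots> \<le> ennreal (n * b)" using I b by (intro ennreal_leI mult_right_mono)
  finally show "emeasure M (\<Union>i\<in>I. B i) \<le> ennreal (n * b)" .
qed

text \<open>
  Disjoint balls around the lattice points; leaving out the origin makes the bound valid for small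
  \<open>R\<close> too.
\<close>

lemma discrete_subgroup_count:
  fixes \<Lambda> :: "(real^'n) set"
  assumes L: "discrete_subgroup \<Lambda>"
  shows "\<exists>C\<ge>1. \<forall>R\<ge>0. finite {v\<in>\<Lambda>. v \<noteq> 0 \<and> norm v \<le> R} \<and> real (card {v\<in>\<Lambda>. v \<noteq> 0 \<and> norm v \<le> R}) \<le> C * R ^ CARD('n)"
proof -
  obtain r where r: "r > 0" "\<And>x. x \<in> \<Lambda> \<Longrightarrow> x \<noteq> 0 \<Longrightarrow> r \<le> norm x"
    using L by (auto simp: discrete_subgroup_def)
  define C where "C = max 1 ((3 / r) ^ CARD('n))"
  have "finite {v\<in>\<Lambda>. v \<noteq> 0 \<and> norm v \<le> R} \<and> real (card {v\<in>\<Lambda>. v \<noteq> 0 \<and> norm v \<le> R}) \<le> C * R ^ CARD('n)"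
    if R: "R \<ge> 0" for R
  proof
    let ?S = "{v\<in>\<Lambda>. v \<noteq> 0 \<and> norm v \<le> R}"
    show fin: "finite ?S" by (rule finite_subset[OF _ discrete_subgroup_finite[OF L, of R]]) auto
    show "real (card ?S) \<le> C * R ^ CARD('n)"
    proof (cases "R < r")
      case True
      then have eq: "?S = {}" using r by force
      show ?thesis unfolding eq using R by (simp add: C_def)
    next
      case False
      define u where "u = unit_ball_vol (real DIM(real^'n))"
      have u: "u > 0" unfolding u_def by (rule unit_ball_vol_pos) simp
      have disj: "disjoint_family_on (\<lambda>v. ball v (r/2)) ?S"
        unfolding disjoint_family_on_def
      proof (intro ballI impI)
        fix v w assume vw: "v \<in> ?S" "w \<in> ?S" "v \<noteq> w"
        then have "r \<le> dist v w" using r(2)[of "v - w"] discrete_subgroup_diff[OF L, of v w] by (simp add: dist_norm)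
        then show "ball v (r/2) \<inter> ball w (r/2) = {}"
          by (metis disjoint_ballI field_sum_of_halves)
      qed
      have "ennreal (real (card ?S) * (u * (r/2) ^ CARD('n))) = (\<Sum>v\<in>?S. emeasure lborel (ball v (r/2)))"
        using u r by (simp add: emeasure_ball u_def ennreal_mult' ennreal_of_nat_eq_real_of_nat)
      also have "\<dots> = emeasure lborel (\<Union>v\<in>?S. ball v (r/2))"
        by (rule sum_emeasure) (use fin disj in auto)
      also have "\<dots> \<le> emeasure lborel (ball (0::real^'n) (R + r/2))"
      proof (rule emeasure_mono)
        show "(\<Union>v\<in>?S. ball v (r/2)) \<subseteq> ball 0 (R + r/2)"
        proof
          fix x assume "x \<in> (\<Union>v\<in>?S. ball v (r/2))"
          then obtain v where v: "norm v \<le> R" "dist v x < r/2" by auto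
          have "norm x \<le> norm v + norm (x - v)" using norm_triangle_ineq[of v "x - v"] by simp
          then show "x \<in> ball 0 (R + r/2)" using v by (simp add: dist_norm norm_minus_commute)
        qed
      qed simp
      also have "\<dots> = ennreal (u * (R + r/2) ^ CARD('n))" using R r by (simp add: emeasure_ball u_def)
      finally have "real (card ?S) * (u * (r/2) ^ CARD('n)) \<le> u * (R + r/2) ^ CARD('n)"
        using u R r by simp
      then have "real (card ?S) * (r/2) ^ CARD('n) \<le> (R + r/2) ^ CARD('n)" using u by (simp add: mult.left_commute)
      also have "\<dots> \<le> (3/2 * R) ^ CARD('n)" using R r False by (intro power_mono) auto
      finally have "real (card ?S) \<le> (3/2 * R) ^ CARD('n) / (r/2) ^ CARD('n)" using r by (simp add: le_divide_eq)
      also have "\<dots> = (3 / r) ^ CARD('n) * R ^ CARD('n)"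
        unfolding power_divide[symmetric] power_mult_distrib[symmetric] by simp
      also have "\<dots> \<le> C * R ^ CARD('n)" using R by (intro mult_right_mono) (auto simp: C_def)
      finally show ?thesis .
    qed
  qed
  moreover have "C \<ge> 1" by (simp add: C_def)
  ultimately show ?thesis by blast
qed

section \<open>Short systems of lattice vectors\<close>

definition dil :: "('n \<Rightarrow> real) \<Rightarrow> real^'n^'n" where
  "dil s = diag (\<chi> i. exp (- s i))"

lemma dil_nth: "(dil s *v v) $ i = exp (- s i) * v $ i"
  by (simp add: dil_def diag_def matrix_vector_mult_def if_distrib[of "\<lambda>x. x * _"] cong: if_cong)

text \<open>
  Lattice vectors, indexed by \<open>P\<close> and linearly independent, with small product of lengths after
  applying \<open>g\<close>. By \<open>reduced_le_covol\<close> such a system exists whenever the image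
  lattice has a sublattice of rank \<open>card P\<close> and small covolume.
\<close>

definition short_system :: "'n set \<Rightarrow> real^'n^'n \<Rightarrow> (real^'n) set \<Rightarrow> real \<Rightarrow> bool" where
  "short_system P g \<Lambda> \<tau> \<longleftrightarrow>
     (\<exists>w Y. (\<forall>i\<in>P. w $ i \<in> \<Lambda>) \<and> det (mix P w Y) \<noteq> 0 \<and> (\<Prod>i\<in>P. norm (g *v w $ i)) < \<tau>)"

text \<open>
  A fixed frame of the span. It depends on the lattice vectors alone, not on \<open>g\<close>, so only
  countably many such frames occur for one lattice.
\<close>

definition ref_frame :: "'n set \<Rightarrow> real^'n^'n \<Rightarrow> real^'n^'n" where
  "ref_frame P m = (SOME F. frame P (span ((\<lambda>i. m $ i) ` P)) F)"

text \<open>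
  The change between two frames that agree off \<open>P\<close> is a rotation inside the span.
\<close>

lemma frames_block_orthogonal:
  fixes E R :: "real^'n^'n"
  assumes E: "frame P V E" and R: "frame P V R" and eq: "\<And>i. i \<notin> P \<Longrightarrow> E $ i = R $ i"
  shows "E ** transpose R \<in> block_orthogonal P" "(E ** transpose R) ** R = E"
proof -
  have o: "orthogonal_matrix E" "orthogonal_matrix R" using E R by (auto simp: frame_def)
  have "(E ** transpose R) $ i $ j = (if i = j then 1 else 0)" if "\<not> (i \<in> P \<and> j \<in> P)" for i j
  proof (cases "i \<in> P")
    case True
    then have "j \<notin> P" using that by simp
    then have "R $ j \<bullet> E $ i = 0" using R E True by (auto simp: frame_def)
    then show ?thesis using True \<open>j \<notin> P\<close> by (auto simp: matrix_mult_transpose_nth inner_commute)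
  next
    case False
    then show ?thesis using o(2) by (simp add: matrix_mult_transpose_nth eq orthogonal_matrix_rows)
  qed
  moreover have "orthogonal_matrix (E ** transpose R)"
    using o by (intro orthogonal_matrix_mul) (simp_all add: orthogonal_matrix_transpose)
  ultimately show "E ** transpose R \<in> block_orthogonal P" by (simp add: block_orthogonal_def)
  have "transpose R ** R = mat 1" using o by (simp add: orthogonal_matrix_def)
  then show "(E ** transpose R) ** R = E" unfolding matrix_mul_assoc[symmetric] by simp
qed

text \<open>
  Replace the given vectors by a reduced system \<open>m\<close> of \<open>\<Lambda>\<close> in the same span,
  and measure \<open>g\<close> there by an orthogonalizing frame, written as a rotation \<open>W\<close> of
  the reference frame. The determinant of the old vectors in the frame is at least a multiple of the product
  of the \<open>norm (m $ i)\<close>, and \<open>prod_lengths_le\<close> does the rest. Now \<open>m\<close>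
  is discrete, and everything that depends on \<open>g\<close> is in \<open>W\<close> and in the lengths.
\<close>

lemma short_system_reduce:
  fixes \<Lambda> :: "(real^'n::{finite,wellorder}) set"
  assumes L: "discrete_subgroup \<Lambda>" and sh: "short_system P g \<Lambda> \<tau>"
  shows "\<exists>m W. (\<forall>i\<in>P. m $ i \<in> \<Lambda> \<and> m $ i \<noteq> 0) \<and> (\<forall>i. i \<notin> P \<longrightarrow> m $ i = 0) \<and> W \<in> block_orthogonal P
    \<and> orthogonal_matrix (ref_frame P m)
    \<and> (\<Prod>k\<in>P. norm (g *v (W ** ref_frame P m) $ k)) * (\<Prod>i\<in>P. norm (m $ i)) \<le> real CARD('n) ^ CARD('n) * fact CARD('n) * \<tau>"
proof -
  obtain w Y where w: "\<And>i. i \<in> P \<Longrightarrow> w $ i \<in> \<Lambda>" and nz: "det (mix P w Y) \<noteq> 0"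
    and pr: "(\<Prod>i\<in>P. norm (g *v w $ i)) < \<tau>" using sh by (auto simp: short_system_def)
  define V where "V = span ((\<lambda>i. w $ i) ` P)"
  have sV: "subspace V" by (simp add: V_def)
  have dV: "card P = dim V" using det_mix_independent[OF nz] by (simp add: V_def)
  have wV: "w $ i \<in> V" if "i \<in> P" for i unfolding V_def by (rule span_base) (use that in simp)
  define \<Gamma> where "\<Gamma> = \<Lambda> \<inter> V"
  have w\<Gamma>: "w $ i \<in> \<Gamma>" if "i \<in> P" for i using w wV that by (simp add: \<Gamma>_def)
  have "discrete_subgroup \<Gamma>" using L sV unfolding discrete_subgroup_def \<Gamma>_def
    by (auto simp: subspace_0 subspace_diff)
  moreover have "span \<Gamma> = V"
  proof
    show "span \<Gamma> \<subseteq> V" using sV by (intro span_minimal) (auto simp: \<Gamma>_def)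
    have "(\<lambda>i. w $ i) ` P \<subseteq> \<Gamma>" using w\<Gamma> by auto
    then show "V \<subseteq> span \<Gamma>" unfolding V_def by (rule span_mono)
  qed
  ultimately have l\<Gamma>: "lattice_in V \<Gamma>" by (simp add: lattice_in_iff)
  obtain F m0 where F: "frame P V F" and m0: "\<forall>i\<in>P. m0 $ i \<in> \<Gamma> \<and> m0 $ i \<noteq> 0" and sp: "span ((\<lambda>i. m0 $ i) ` P) = V"
    and red: "\<forall>w. (\<forall>i\<in>P. w $ i \<in> \<Gamma>) \<longrightarrow> det (mix P w F) \<noteq> 0 \<longrightarrow>
         (\<Prod>i\<in>P. norm (m0 $ i)) \<le> real CARD('n) ^ CARD('n) * \<bar>det (mix P w F)\<bar>"
    using reduced_le_covol[OF l\<Gamma> dV] by metis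
  define m where "m = (\<chi> i. if i \<in> P then m0 $ i else 0)"
  have mP: "m $ i = m0 $ i" if "i \<in> P" for i using that by (simp add: m_def)
  have spm: "span ((\<lambda>i. m $ i) ` P) = V" unfolding sp[symmetric] using mP by (metis (no_types, lifting) image_cong)
  have "\<exists>R. frame P V R" using F by blast
  then have R: "frame P V (ref_frame P m)" unfolding ref_frame_def spm by (rule someI_ex)
  define R where "R = ref_frame P m"
  have R: "frame P V R" unfolding R_def by (rule R)
  obtain E0 where E0: "frame P V E0" "\<forall>i\<in>P. \<forall>j\<in>P. i \<noteq> j \<longrightarrow> (g *v E0 $ i) \<bullet> (g *v E0 $ j) = 0"
    using orthogonalizing_frame[OF sV dV] by metis
  define E where "E = (\<chi> i. if i \<in> P then E0 $ i else R $ i)"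
  have E: "frame P V E" unfolding E_def
    by (rule frame_replace[OF R]) (use E0(1) in \<open>auto simp: frame_def orthogonal_matrix_rows\<close>)
  have Eo: "(g *v E $ i) \<bullet> (g *v E $ j) = 0" if "i \<in> P" "j \<in> P" "i \<noteq> j" for i j
    using E0(2) that by (simp add: E_def)
  have wF: "frame P (span ((\<lambda>i. w $ i) ` P)) F" using F by (simp add: V_def)
  have "(\<Prod>i\<in>P. norm (m0 $ i)) \<le> real CARD('n) ^ CARD('n) * \<bar>det (mix P w F)\<bar>"
    using red w\<Gamma> det_mix_frame_nz[OF wF] by blast
  also have "\<bar>det (mix P w F)\<bar> = \<bar>det (mix P w E)\<bar>" by (rule det_mix_frame_eq[OF E F])
  finally have 1: "(\<Prod>i\<in>P. norm (m $ i)) \<le> real CARD('n) ^ CARD('n) * \<bar>det (mix P w E)\<bar>"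
    using mP by (simp cong: prod.cong)
  have 2: "(\<Prod>k\<in>P. norm (g *v E $ k)) * \<bar>det (mix P w E)\<bar> \<le> fact CARD('n) * (\<Prod>i\<in>P. norm (g *v w $ i))"
    by (rule prod_lengths_le[OF E Eo wV])
  have "(\<Prod>k\<in>P. norm (g *v E $ k)) * (\<Prod>i\<in>P. norm (m $ i))
     \<le> (\<Prod>k\<in>P. norm (g *v E $ k)) * (real CARD('n) ^ CARD('n) * \<bar>det (mix P w E)\<bar>)"
    by (intro mult_left_mono 1 prod_nonneg) simp
  also have "\<dots> = real CARD('n) ^ CARD('n) * ((\<Prod>k\<in>P. norm (g *v E $ k)) * \<bar>det (mix P w E)\<bar>)" by simp
  also have "\<dots> \<le> real CARD('n) ^ CARD('n) * (fact CARD('n) * (\<Prod>i\<in>P. norm (g *v w $ i)))"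
    by (intro mult_left_mono 2) simp
  also have "\<dots> \<le> real CARD('n) ^ CARD('n) * (fact CARD('n) * \<tau>)"
    using pr by (intro mult_left_mono) auto
  finally have 3: "(\<Prod>k\<in>P. norm (g *v E $ k)) * (\<Prod>i\<in>P. norm (m $ i)) \<le> real CARD('n) ^ CARD('n) * fact CARD('n) * \<tau>"
    by (simp add: mult.assoc)
  define W where "W = E ** transpose R"
  have W: "W \<in> block_orthogonal P" "W ** R = E"
    unfolding W_def by (rule frames_block_orthogonal[OF E R]; simp add: E_def)+
  show ?thesis
  proof (rule exI[of _ m], rule exI[of _ W], intro conjI)
    show "\<forall>i\<in>P. m $ i \<in> \<Lambda> \<and> m $ i \<noteq> 0" using m0 mP by (auto simp: \<Gamma>_def)
    show "\<forall>i. i \<notin> P \<longrightarrow> m $ i = 0" by (simp add: m_def)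
    show "W \<in> block_orthogonal P" by (rule W)
    show "orthogonal_matrix (ref_frame P m)" using R by (simp add: R_def frame_def)
    show "(\<Prod>k\<in>P. norm (g *v (W ** ref_frame P m) $ k)) * (\<Prod>i\<in>P. norm (m $ i)) \<le> real CARD('n) ^ CARD('n) * fact CARD('n) * \<tau>"
      using 3 W(2) unfolding R_def by simp
  qed
qed

text \<open>
  After the orthogonal change of coordinates given by \<open>h\<close> and \<open>E\<close> this is a product
  of intervals. Its conditions say that \<open>dil s ** h ** A\<close> maps the row \<open>E $ k\<close> to a
  vector with entries at most about \<open>exp (l k)\<close>, and that \<open>A\<close> is bounded.
\<close>

definition box_event :: "'n set \<Rightarrow> ('n \<Rightarrow> real) \<Rightarrow> ('n \<Rightarrow> real) \<Rightarrow> real \<Rightarrow> real^'n^'n \<Rightarrow> real^'n^'n \<Rightarrow> (real^'n^'n) set" where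
  "box_event P l s C h E = {A. \<forall>i k. \<bar>(h ** A ** transpose E) $ i $ k\<bar> \<le> (if k \<in> P then 2 * min 1 (C * exp (l k + s i)) else 2)}"

lemma box_event_measure:
  fixes h E :: "real^'n^'n"
  assumes h: "orthogonal_matrix h" and E: "orthogonal_matrix E" and C: "0 \<le> C"
  shows "box_event P l s C h E \<in> sets borel"
    "emeasure lborel (box_event P l s C h E) \<le> ennreal (4 ^ (CARD('n) * CARD('n)) * (\<Prod>i\<in>UNIV. \<Prod>k\<in>P. min 1 (C * exp (l k + s i))))"
proof -
  define b where "b i k = (if k \<in> P then 2 * min 1 (C * exp (l k + s i)) else 2)" for i k
  have b: "0 \<le> b i k" for i k using C by (simp add: b_def)
  let ?B = "cbox (\<chi> i k. - b i k) (\<chi> i k. b i k) :: (real^'n^'n) set"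
  let ?f = "\<lambda>A. h ** A ** transpose E"
  have eq: "box_event P l s C h E = {A. ?f A \<in> ?B}"
    unfolding box_event_def mem_cbox_mat b_def[symmetric] by (auto simp: abs_le_iff minus_le_iff)
  have lin: "linear ?f"
    by (rule linearI) (simp_all add: vec_eq_iff matrix_matrix_mult_def sum.distrib sum_distrib_left sum_distrib_right algebra_simps)
  have iso: "norm (?f A) = norm A" for A
    by (simp add: norm_mult_orthogonal_right[OF E] norm_mult_orthogonal_left[OF h])
  have "emeasure lborel (box_event P l s C h E) = emeasure lborel ?B"
    unfolding eq by (rule emeasure_lborel_isometry[OF lin iso]) simp
  also have "\<dots> = ennreal (\<Prod>i\<in>UNIV. \<Prod>k\<in>UNIV. 2 * b i k)"
    using b by (subst emeasure_cbox_mat) (auto simp: add_increasing)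
  also have "(\<Prod>i\<in>UNIV. \<Prod>k\<in>UNIV. 2 * b i k) = (\<Prod>i\<in>UNIV. \<Prod>k\<in>UNIV. 4 * (if k \<in> P then min 1 (C * exp (l k + s i)) else 1))"
    by (intro prod.cong) (auto simp: b_def)
  also have "\<dots> = 4 ^ (CARD('n) * CARD('n)) * (\<Prod>i\<in>UNIV. \<Prod>k\<in>UNIV. if k \<in> P then min 1 (C * exp (l k + s i)) else 1)"
    by (simp add: prod.distrib power_mult)
  also have "(\<Prod>i\<in>UNIV. \<Prod>k\<in>UNIV. if k \<in> P then min 1 (C * exp (l k + s i)) else 1) = (\<Prod>i\<in>UNIV. \<Prod>k\<in>P. min 1 (C * exp (l k + s i)))"
  proof (rule prod.cong[OF refl])
    fix i
    have "(\<Prod>k\<in>UNIV. if k \<in> P then min 1 (C * exp (l k + s i)) else 1) = (\<Prod>k\<in>P. if k \<in> P then min 1 (C * exp (l k + s i)) else 1)"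
      by (rule prod.mono_neutral_right) auto
    then show "(\<Prod>k\<in>UNIV. if k \<in> P then min 1 (C * exp (l k + s i)) else 1) = (\<Prod>k\<in>P. min 1 (C * exp (l k + s i)))"
      by (simp cong: prod.cong)
  qed
  finally show "emeasure lborel (box_event P l s C h E) \<le> ennreal (4 ^ (CARD('n) * CARD('n)) * (\<Prod>i\<in>UNIV. \<Prod>k\<in>P. min 1 (C * exp (l k + s i))))"
    by simp
  have "?f \<in> borel_measurable borel"
    by (rule borel_measurable_continuous_onI[OF linear_continuous_on[OF linear_conv_bounded_linear[THEN iffD1, OF lin]]])
  then have "?f -` ?B \<inter> space borel \<in> sets borel" by (rule measurable_sets) simp
  then show "box_event P l s C h E \<in> sets borel" unfolding eq by (simp add: vimage_def)
qed

lemma transpose_mult_self: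
  fixes h :: "real^'n^'n"
  assumes "orthogonal_matrix h" shows "transpose h ** h = mat 1" "h ** transpose h = mat 1"
  using assms by (auto simp: orthogonal_matrix_def)

text \<open>
  Each entry of the quotient \<open>h0 ** transpose h\<close>, conjugated by \<open>dil s\<close>, is at most
  two.
\<close>

lemma near_block_left:
  fixes h h0 :: "real^'n^'n"
  assumes h: "h \<in> block_orthogonal P" and h0: "h0 \<in> block_orthogonal P" and near: "near_block P s h h0"
  shows "exp (- s i) * \<bar>(h0 *v v) $ i\<bar> \<le> 2 * real CARD('n) * norm (dil s *v (h *v v))"
proof -
  define B where "B = h0 ** transpose h"
  have B: "\<bar>B $ i $ j\<bar> \<le> 2 * exp (- \<bar>s i - s j\<bar>)" for j
  proof (cases "i \<in> P \<and> j \<in> P")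
    case True
    then show ?thesis using near by (auto simp: near_block_def B_def)
  next
    case False
    have "B $ i $ j = (if i = j then 1 else 0)"
    proof -
      have "B $ i $ j = (\<Sum>k\<in>UNIV. h0 $ i $ k * h $ j $ k)"
        by (simp add: B_def matrix_matrix_mult_def transpose_def)
      show ?thesis
      proof (cases "i \<in> P")
        case True
        then have j: "j \<notin> P" using False by simp
        have "B $ i $ j = (\<Sum>k\<in>UNIV. if k = j then h0 $ i $ k else 0)"
          unfolding \<open>B $ i $ j = _\<close> by (rule sum.cong) (use h j in \<open>auto simp: block_orthogonal_def\<close>)
        then show ?thesis using h0 j by (auto simp: block_orthogonal_def)
      next
        case i: False
        have "B $ i $ j = (\<Sum>k\<in>UNIV. if k = i then h $ j $ k else 0)"
          unfolding \<open>B $ i $ j = _\<close> by (rule sum.cong) (use h0 i in \<open>auto simp: block_orthogonal_def\<close>)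
        then show ?thesis using h i by (auto simp: block_orthogonal_def)
      qed
    qed
    then show ?thesis by auto
  qed
  have "h0 *v v = B *v (h *v v)"
  proof -
    have "transpose h ** h = mat 1" using h by (auto simp: block_orthogonal_def transpose_mult_self)
    then have "B ** h = h0" unfolding B_def matrix_mul_assoc[symmetric] by simp
    then show ?thesis by (simp add: matrix_vector_mul_assoc)
  qed
  then have "(h0 *v v) $ i = (\<Sum>j\<in>UNIV. B $ i $ j * (h *v v) $ j)"
    by (simp add: matrix_vector_mult_def)
  then have "exp (- s i) * \<bar>(h0 *v v) $ i\<bar> \<le> exp (- s i) * (\<Sum>j\<in>UNIV. \<bar>B $ i $ j * (h *v v) $ j\<bar>)"
    using sum_abs[of "\<lambda>j. B $ i $ j * (h *v v) $ j" UNIV] by (intro mult_left_mono) auto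
  also have "\<dots> = (\<Sum>j\<in>UNIV. exp (- s i) * \<bar>B $ i $ j\<bar> * \<bar>(h *v v) $ j\<bar>)"
    by (simp add: sum_distrib_left abs_mult mult.assoc)
  also have "\<dots> \<le> (\<Sum>j\<in>(UNIV::'n set). 2 * norm (dil s *v (h *v v)))"
  proof (rule sum_mono)
    fix j :: 'n
    have "exp (- s i) * \<bar>B $ i $ j\<bar> \<le> exp (- s i) * (2 * exp (- \<bar>s i - s j\<bar>))"
      using B[of j] by (intro mult_left_mono) auto
    also have "\<dots> = 2 * exp (- s i - \<bar>s i - s j\<bar>)" by (simp add: exp_diff exp_minus divide_inverse)
    also have "\<dots> \<le> 2 * exp (- s j)" by simp
    finally have "exp (- s i) * \<bar>B $ i $ j\<bar> * \<bar>(h *v v) $ j\<bar> \<le> 2 * exp (- s j) * \<bar>(h *v v) $ j\<bar>"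
      by (intro mult_right_mono) auto
    also have "\<dots> = 2 * \<bar>(dil s *v (h *v v)) $ j\<bar>" by (simp add: dil_nth abs_mult)
    also have "\<dots> \<le> 2 * norm (dil s *v (h *v v))" by (simp add: component_le_norm_cart)
    finally show "exp (- s i) * \<bar>B $ i $ j\<bar> * \<bar>(h *v v) $ j\<bar> \<le> 2 * norm (dil s *v (h *v v))" .
  qed
  finally show ?thesis by simp
qed

text \<open>
  The row \<open>k\<close> of \<open>W0 ** R\<close> is a combination of the rows \<open>j\<close> of \<open>W
  ** R\<close> with coefficients at most \<open>2 * exp (- \<bar>l k - l j\<bar>)\<close>, and a row of length
  \<open>exp (l j)\<close> with such a coefficient contributes at most \<open>2 * exp (l k)\<close>.
\<close>

lemma near_block_right:
  fixes W W0 R g :: "real^'n^'n"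
  assumes W: "W \<in> block_orthogonal P" and W0: "W0 \<in> block_orthogonal P" and near: "near_block P l W W0"
    and le: "\<And>k. k \<in> P \<Longrightarrow> norm (g *v (W ** R) $ k) \<le> exp (l k + 1)" and k: "k \<in> P"
  shows "norm (g *v (W0 ** R) $ k) \<le> 2 * real CARD('n) * exp (l k + 1)"
proof -
  define B where "B = W0 ** transpose W"
  have z: "B $ k $ j = 0" if j: "j \<notin> P" for j
  proof -
    have "B $ k $ j = (\<Sum>i\<in>UNIV. W0 $ k $ i * W $ j $ i)" by (simp add: B_def matrix_matrix_mult_def transpose_def)
    also have "\<dots> = (\<Sum>i\<in>UNIV. if i = j then W0 $ k $ i else 0)"
      by (rule sum.cong) (use W j in \<open>auto simp: block_orthogonal_def\<close>)
    also have "\<dots> = 0" using W0 j k by (auto simp: block_orthogonal_def)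
    finally show ?thesis .
  qed
  have "transpose W ** W = mat 1" using W by (auto simp: block_orthogonal_def transpose_mult_self)
  then have "B ** W = W0" unfolding B_def matrix_mul_assoc[symmetric] by simp
  then have "W0 ** R = B ** (W ** R)" by (simp add: matrix_mul_assoc)
  then have row: "(W0 ** R) $ k = (\<Sum>j\<in>UNIV. B $ k $ j *\<^sub>R (W ** R) $ j)"
    by (simp add: vec_eq_iff matrix_matrix_mult_def[of B])
  also have "\<dots> = (\<Sum>j\<in>P. B $ k $ j *\<^sub>R (W ** R) $ j)"
    by (rule sum.mono_neutral_right) (use z in auto)
  finally have "g *v (W0 ** R) $ k = (\<Sum>j\<in>P. B $ k $ j *\<^sub>R (g *v (W ** R) $ j))"
    by (simp add: linear_sum[OF matrix_vector_mul_linear] matrix_vector_mult_scaleR)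
  then have "norm (g *v (W0 ** R) $ k) \<le> (\<Sum>j\<in>P. norm (B $ k $ j *\<^sub>R (g *v (W ** R) $ j)))"
    by (simp only: norm_sum)
  also have "\<dots> \<le> (\<Sum>j\<in>P. 2 * exp (l k + 1))"
  proof (rule sum_mono)
    fix j assume j: "j \<in> P"
    have "norm (B $ k $ j *\<^sub>R (g *v (W ** R) $ j)) \<le> (2 * exp (- \<bar>l k - l j\<bar>)) * exp (l j + 1)"
      unfolding norm_scaleR using near le[OF j] j k by (intro mult_mono) (auto simp: near_block_def B_def)
    also have "\<dots> = 2 * exp (- \<bar>l k - l j\<bar> + (l j + 1))" by (simp only: exp_add mult.assoc)
    also have "\<dots> \<le> 2 * exp (l k + 1)" by simp
    finally show "norm (B $ k $ j *\<^sub>R (g *v (W ** R) $ j)) \<le> 2 * exp (l k + 1)" .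
  qed
  also have "\<dots> = real (card P) * (2 * exp (l k + 1))" by simp
  also have "\<dots> \<le> real CARD('n) * (2 * exp (l k + 1))"
    by (intro mult_right_mono) (auto simp: card_mono)
  finally show ?thesis by simp
qed

definition box_const :: "'n::finite itself \<Rightarrow> real" where
  "box_const _ = 4 * exp 1 * real CARD('n) * real CARD('n)"

lemma box_const_ge_1: "1 \<le> box_const TYPE('n::finite)"
proof -
  have 1: "1 \<le> real CARD('n)" by (simp add: Suc_leI)
  have "1 * 1 * 1 * 1 \<le> 4 * exp 1 * real CARD('n) * real CARD('n)"
    using 1 by (intro mult_mono) auto
  then show ?thesis by (simp add: box_const_def)
qed

text \<open>
  The group element \<open>h\<close> and the rotation \<open>W\<close> may be replaced by points of finite
  nets.
\<close>

lemma mem_box_event: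
  fixes A h h0 W W0 R :: "real^'n^'n"
  assumes A: "A \<in> near_id" and h: "h \<in> block_orthogonal P0" and h0: "h0 \<in> block_orthogonal P0" and nh: "near_block P0 s h h0"
    and W: "W \<in> block_orthogonal P" and W0: "W0 \<in> block_orthogonal P" and nW: "near_block P l W W0"
    and R: "orthogonal_matrix R"
    and le: "\<And>k. k \<in> P \<Longrightarrow> norm ((dil s ** h ** A) *v (W ** R) $ k) \<le> exp (l k + 1)"
  shows "A \<in> box_event P l s (box_const TYPE('n)) h0 (W0 ** R)"
  unfolding box_event_def
proof (intro CollectI allI)
  fix i k
  let ?E = "W0 ** R"
  have oE: "orthogonal_matrix ?E" using W0 R by (auto simp: block_orthogonal_def intro: orthogonal_matrix_mul)
  have oh0: "orthogonal_matrix h0" using h0 by (auto simp: block_orthogonal_def)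
  have X: "(h0 ** A ** transpose ?E) $ i $ k = (h0 *v (A *v ?E $ k)) $ i"
  proof -
    have "(h0 ** A ** transpose ?E) $ i $ k = (h0 ** A) $ i \<bullet> ?E $ k" by (rule matrix_mult_transpose_nth)
    then show ?thesis by (simp add: matrix_vector_mul_assoc matrix_vector_mult_row)
  qed
  have nE: "norm (?E $ k) = 1" using oE by (simp add: orthogonal_matrix_rows norm_eq_sqrt_inner)
  have "\<bar>(h0 *v (A *v ?E $ k)) $ i\<bar> \<le> norm (h0 *v (A *v ?E $ k))" by (rule component_le_norm_cart)
  also have "\<dots> = norm (A *v ?E $ k)" by (rule orthogonal_matrix_norm[OF oh0])
  also have "\<dots> \<le> 2" using near_id_bounds(1)[OF A, of "?E $ k"] nE by simp
  finally have b2: "\<bar>(h0 *v (A *v ?E $ k)) $ i\<bar> \<le> 2" .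
  show "\<bar>(h0 ** A ** transpose ?E) $ i $ k\<bar> \<le> (if k \<in> P then 2 * min 1 (box_const TYPE('n) * exp (l k + s i)) else 2)"
  proof (cases "k \<in> P")
    case False
    then show ?thesis using b2 X by simp
  next
    case k: True
    have "exp (- s i) * \<bar>(h0 *v (A *v ?E $ k)) $ i\<bar> \<le> 2 * real CARD('n) * norm (dil s *v (h *v (A *v ?E $ k)))"
      by (rule near_block_left[OF h h0 nh])
    also have "dil s *v (h *v (A *v ?E $ k)) = (dil s ** h ** A) *v ?E $ k"
      by (simp only: matrix_vector_mul_assoc matrix_mul_assoc)
    also have "norm ((dil s ** h ** A) *v ?E $ k) \<le> 2 * real CARD('n) * exp (l k + 1)"
      by (rule near_block_right[OF W W0 nW le k])
    finally have "exp (- s i) * \<bar>(h0 *v (A *v ?E $ k)) $ i\<bar> \<le> 2 * real CARD('n) * (2 * real CARD('n) * exp (l k + 1))"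
      by (simp add: mult_left_mono)
    then have "exp (s i) * (exp (- s i) * \<bar>(h0 *v (A *v ?E $ k)) $ i\<bar>) \<le> exp (s i) * (2 * real CARD('n) * (2 * real CARD('n) * exp (l k + 1)))"
      by (intro mult_left_mono) auto
    moreover have "exp (s i) * (exp (- s i) * \<bar>(h0 *v (A *v ?E $ k)) $ i\<bar>) = \<bar>(h0 *v (A *v ?E $ k)) $ i\<bar>"
      by (simp add: mult.assoc[symmetric] exp_add[symmetric])
    moreover have "exp (s i) * (2 * real CARD('n) * (2 * real CARD('n) * exp (l k + 1))) = box_const TYPE('n) * exp (l k + s i)"
      by (simp add: box_const_def exp_add)
    ultimately have "\<bar>(h0 *v (A *v ?E $ k)) $ i\<bar> \<le> box_const TYPE('n) * exp (l k + s i)" by simp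
    moreover have "0 \<le> box_const TYPE('n) * exp (l k + s i)" using box_const_ge_1[where 'n='n] by simp
    ultimately show ?thesis using b2 X k by (auto simp: min_def)
  qed
qed

text \<open>
  A matrix with determinant bounded below has a permutation along which all entries are bounded below, because
  the entries are bounded above. This matches the rows of the frame with different contraction factors of
  \<open>dil s\<close> and yields the map \<open>p\<close> in \<open>spread_key\<close>.
\<close>

lemma lengths_lower_bound:
  fixes A h E :: "real^'n^'n"
  assumes A: "A \<in> near_id" and c: "c \<le> det A" "0 < c" and h: "orthogonal_matrix h" and E: "orthogonal_matrix E"
  shows "\<exists>p. inj p \<and> (\<forall>k. c / (fact CARD('n) * 2 ^ CARD('n)) * exp (- s (p k)) \<le> norm ((dil s ** h ** A) *v E $ k))"
proof -
  define M where "M = transpose (h ** A ** transpose E)"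
  have Mn: "M $ k $ i = (h *v (A *v E $ k)) $ i" for i k
  proof -
    have "M $ k $ i = (h ** A) $ i \<bullet> E $ k" unfolding M_def transpose_def[of "h ** A ** transpose E"]
      by (simp add: matrix_mult_transpose_nth)
    then show ?thesis by (simp add: matrix_vector_mul_assoc matrix_vector_mult_row)
  qed
  have "\<bar>det h\<bar> = 1" "\<bar>det E\<bar> = 1" using det_orthogonal_matrix[OF h] det_orthogonal_matrix[OF E] by auto
  then have dM: "\<bar>det M\<bar> = \<bar>det A\<bar>" by (simp add: M_def det_mul abs_mult)
  obtain p where p: "p permutes UNIV" "\<bar>det M\<bar> \<le> fact CARD('n) * (\<Prod>k\<in>UNIV. \<bar>M $ k $ p k\<bar>)"
    using det_large_permutation[of M] by blast
  have nE: "norm (E $ k) = 1" for k using E by (simp add: orthogonal_matrix_rows norm_eq_sqrt_inner)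
  have M2: "\<bar>M $ k $ i\<bar> \<le> 2" for k i
  proof -
    have "\<bar>M $ k $ i\<bar> \<le> norm (h *v (A *v E $ k))" unfolding Mn by (rule component_le_norm_cart)
    also have "\<dots> = norm (A *v E $ k)" by (rule orthogonal_matrix_norm[OF h])
    finally show ?thesis using near_id_bounds(1)[OF A, of "E $ k"] nE[of k] by simp
  qed
  have lower: "c / (fact CARD('n) * 2 ^ CARD('n)) \<le> \<bar>M $ k $ p k\<bar>" for k
  proof -
    have "(\<Prod>k\<in>UNIV. \<bar>M $ k $ p k\<bar>) = \<bar>M $ k $ p k\<bar> * (\<Prod>k\<in>UNIV - {k}. \<bar>M $ k $ p k\<bar>)"
      by (rule prod.remove) auto
    also have "\<dots> \<le> \<bar>M $ k $ p k\<bar> * (\<Prod>k\<in>UNIV - {k}. 2)"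
      using M2 by (intro mult_left_mono prod_mono) auto
    also have "\<dots> \<le> \<bar>M $ k $ p k\<bar> * 2 ^ CARD('n)"
    proof -
      have "(\<Prod>k\<in>UNIV - {k}. 2 :: real) \<le> 2 ^ CARD('n)" by (simp add: power_increasing)
      then show ?thesis by (rule mult_left_mono) simp
    qed
    finally have "c \<le> fact CARD('n) * (\<bar>M $ k $ p k\<bar> * 2 ^ CARD('n))"
      using p(2) dM c by (smt (verit) fact_ge_zero mult_left_mono)
    then show ?thesis by (simp add: divide_le_eq mult.commute mult.left_commute)
  qed
  have "c / (fact CARD('n) * 2 ^ CARD('n)) * exp (- s (p k)) \<le> norm ((dil s ** h ** A) *v E $ k)" for k
  proof -
    have "c / (fact CARD('n) * 2 ^ CARD('n)) * exp (- s (p k)) \<le> \<bar>M $ k $ p k\<bar> * exp (- s (p k))"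
      by (intro mult_right_mono lower) simp
    also have "\<dots> = \<bar>((dil s ** h ** A) *v E $ k) $ p k\<bar>"
      by (simp add: Mn dil_nth matrix_vector_mul_assoc[symmetric] abs_mult)
    also have "\<dots> \<le> norm ((dil s ** h ** A) *v E $ k)" by (rule component_le_norm_cart)
    finally show ?thesis .
  qed
  then show ?thesis using p(1) permutes_inj by blast
qed

section \<open>Counting discrete data of short systems\<close>

text \<open>
  Setting the rows outside \<open>P\<close> to zero makes the set finite.
\<close>

definition system_set :: "(real^'n) set \<Rightarrow> 'n set \<Rightarrow> ('n \<Rightarrow> real) \<Rightarrow> (real^'n^'n) set" where
  "system_set \<Lambda> P j = {m. (\<forall>i\<in>P. m $ i \<in> \<Lambda> \<and> m $ i \<noteq> 0 \<and> norm (m $ i) \<le> exp (j i + 1)) \<and> (\<forall>i. i \<notin> P \<longrightarrow> m $ i = 0)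
     \<and> orthogonal_matrix (ref_frame P m)}"

lemma system_set_card:
  fixes \<Lambda> :: "(real^'n) set"
  assumes C: "1 \<le> C" "\<And>R. 0 \<le> R \<Longrightarrow> finite {v\<in>\<Lambda>. v \<noteq> 0 \<and> norm v \<le> R}"
    "\<And>R. 0 \<le> R \<Longrightarrow> real (card {v\<in>\<Lambda>. v \<noteq> 0 \<and> norm v \<le> R}) \<le> C * R ^ CARD('n)"
  shows "finite (system_set \<Lambda> P j)"
    "real (card (system_set \<Lambda> P j)) \<le> (C * exp (real CARD('n))) ^ CARD('n) * exp (real CARD('n) * (\<Sum>i\<in>P. j i))"
proof -
  define T where "T i = (if i \<in> P then {v\<in>\<Lambda>. v \<noteq> 0 \<and> norm v \<le> exp (j i + 1)} else {0})" for i
  have fT: "finite (T i)" for i using C(2)[of "exp (j i + 1)"] by (simp add: T_def)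
  have sub: "system_set \<Lambda> P j \<subseteq> vec_lambda ` (PiE UNIV T)"
  proof
    fix m assume m: "m \<in> system_set \<Lambda> P j"
    have "(\<lambda>i. m $ i) \<in> PiE UNIV T" using m by (auto simp: system_set_def T_def)
    then show "m \<in> vec_lambda ` (PiE UNIV T)" by (intro image_eqI[of _ _ "\<lambda>i. m $ i"]) (simp_all add: vec_nth_inverse)
  qed
  have fP: "finite (PiE UNIV T)" using fT by (intro finite_PiE) auto
  show "finite (system_set \<Lambda> P j)" using sub fP by (meson finite_imageI finite_subset)
  have cP: "card P \<le> CARD('n)" by (simp add: card_mono)
  have "card (system_set \<Lambda> P j) \<le> card (vec_lambda ` (PiE UNIV T))" using fP by (intro card_mono sub) simp
  also have "\<dots> \<le> card (PiE UNIV T)" using fP by (rule card_image_le)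
  also have "\<dots> = (\<Prod>i\<in>UNIV. card (T i))" by (rule card_PiE) simp
  finally have "real (card (system_set \<Lambda> P j)) \<le> real (\<Prod>i\<in>UNIV. card (T i))" by (simp only: of_nat_le_iff)
  also have "\<dots> = (\<Prod>i\<in>UNIV. real (card (T i)))" by simp
  also have "\<dots> = (\<Prod>i\<in>P. real (card (T i)))" by (rule prod.mono_neutral_right) (auto simp: T_def)
  also have "\<dots> \<le> (\<Prod>i\<in>P. C * exp (j i + 1) ^ CARD('n))"
    using C(3) by (intro prod_mono) (auto simp: T_def)
  also have "\<dots> = (\<Prod>i\<in>P. (C * exp (real CARD('n))) * exp (real CARD('n) * j i))"
    by (intro prod.cong) (auto simp: exp_of_nat_mult[symmetric] exp_add[symmetric] algebra_simps)
  also have "\<dots> = (C * exp (real CARD('n))) ^ card P * exp (real CARD('n) * (\<Sum>i\<in>P. j i))"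
    by (simp only: prod.distrib prod_constant power_mult_distrib exp_sum[OF finite[of P], symmetric] sum_distrib_left)
  also have "\<dots> \<le> (C * exp (real CARD('n))) ^ CARD('n) * exp (real CARD('n) * (\<Sum>i\<in>P. j i))"
  proof -
    have "1 * 1 \<le> C * exp (real CARD('n))" using C(1) by (intro mult_mono) auto
    then show ?thesis using cP by (intro mult_right_mono power_increasing) auto
  qed
  finally show "real (card (system_set \<Lambda> P j)) \<le> (C * exp (real CARD('n))) ^ CARD('n) * exp (real CARD('n) * (\<Sum>i\<in>P. j i))" .
qed

text \<open>
  For fixed logarithmic sizes \<open>l\<close> of the lengths and \<open>j\<close> of the lattice vectors:
  there are about \<open>exp (spread P0 s)\<close> choices of \<open>h0\<close>, \<open>exp (N * sum j
  P)\<close> choices of \<open>m\<close> and \<open>exp (spread P l)\<close> choices of \<open>W0\<close>. By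
  \<open>spread_key\<close> the last number times the volume of a box is about \<open>exp (N * sum l
  P)\<close>, and \<open>exp (sum l P + sum j P)\<close> is at most a multiple of \<open>\<tau>\<close>.
\<close>

lemma index_measure:
  fixes \<Lambda> :: "(real^'n::{finite,wellorder}) set" and P P0 :: "'n set"
  assumes C: "1 \<le> C" "\<And>R. 0 \<le> R \<Longrightarrow> finite {v\<in>\<Lambda>. v \<noteq> 0 \<and> norm v \<le> R}"
    "\<And>R. 0 \<le> R \<Longrightarrow> real (card {v\<in>\<Lambda>. v \<noteq> 0 \<and> norm v \<le> R}) \<le> C * R ^ CARD('n)"
    and NH: "finite NH" "NH \<subseteq> block_orthogonal P0" "real (card NH) \<le> net_const TYPE('n) * exp (spread P0 s)"
    and NW: "finite NW" "NW \<subseteq> block_orthogonal P" "real (card NW) \<le> net_const TYPE('n) * exp (spread P l)"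
    and s: "(\<Sum>i\<in>UNIV. s i) = 0" and p: "inj p" "\<And>k. k \<in> P \<Longrightarrow> - b - s (p k) \<le> l k" and b: "0 \<le> b"
    and tau: "0 < \<tau>" "0 \<le> C1" "exp ((\<Sum>i\<in>P. l i) + (\<Sum>i\<in>P. j i)) \<le> C1 * \<tau>" and C2: "1 \<le> C2"
  defines "S \<equiv> (\<Union>h0\<in>NH. \<Union>m\<in>system_set \<Lambda> P j. \<Union>W0\<in>NW. box_event P l s C2 h0 (W0 ** ref_frame P m))"
  shows "S \<in> sets borel" "emeasure lborel S \<le> ennreal (
    (net_const TYPE('n) * net_const TYPE('n) * (C * exp (real CARD('n))) ^ CARD('n) * 4 ^ (CARD('n) * CARD('n))
      * C2 ^ (CARD('n) * CARD('n)) * exp (real CARD('n) * real CARD('n) * b) * C1 ^ CARD('n)) * exp (spread P0 s) * \<tau> ^ CARD('n))"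
proof -
  let ?N = "CARD('n)" and ?nc = "net_const TYPE('n)"
  define X where "X = (\<Prod>i\<in>UNIV. \<Prod>k\<in>P. min 1 (C2 * exp (l k + s i)))"
  have X: "0 \<le> X" using C2 by (auto simp: X_def intro!: prod_nonneg)
  define cM where "cM = (C * exp (real ?N)) ^ ?N * exp (real ?N * (\<Sum>i\<in>P. j i))"
  have cM: "0 \<le> cM" using C by (simp add: cM_def)
  have nc: "0 \<le> ?nc" by (simp add: net_const_def)
  have oH: "orthogonal_matrix h" if "h \<in> NH" for h using NH that by (auto simp: block_orthogonal_def)
  have oW: "orthogonal_matrix h" if "h \<in> NW" for h using NW that by (auto simp: block_orthogonal_def)
  have C20: "0 \<le> C2" using C2 by simp
  let ?b0 = "4 ^ (?N * ?N) * X" 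
  have 1: "box_event P l s C2 h0 (W0 ** ref_frame P m) \<in> sets lborel"
     "emeasure lborel (box_event P l s C2 h0 (W0 ** ref_frame P m)) \<le> ennreal ?b0"
    if "h0 \<in> NH" "m \<in> system_set \<Lambda> P j" "W0 \<in> NW" for h0 m W0
  proof -
    have "orthogonal_matrix (W0 ** ref_frame P m)" using oW that by (intro orthogonal_matrix_mul) (auto simp: system_set_def)
    note * = box_event_measure[OF oH[OF that(1)] this C20, of P l s]
    show "box_event P l s C2 h0 (W0 ** ref_frame P m) \<in> sets lborel" using *(1) by simp
    show "emeasure lborel (box_event P l s C2 h0 (W0 ** ref_frame P m)) \<le> ennreal ?b0" using *(2) by (simp add: X_def)
  qed
  let ?b1 = "?nc * exp (spread P l) * ?b0"
  let ?U1 = "\<lambda>h0 m. \<Union>W0\<in>NW. box_event P l s C2 h0 (W0 ** ref_frame P m)"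
  have b0: "0 \<le> ?b0" using X by simp
  have 2: "?U1 h0 m \<in> sets lborel" "emeasure lborel (?U1 h0 m) \<le> ennreal ?b1"
    if "h0 \<in> NH" "m \<in> system_set \<Lambda> P j" for h0 m
    by (rule union_bound[OF NW(1) NW(3) b0 1[OF that]]; assumption)+
  let ?b2 = "cM * ?b1"
  let ?U2 = "\<lambda>h0. \<Union>m\<in>system_set \<Lambda> P j. ?U1 h0 m"
  have b1: "0 \<le> ?b1" using nc b0 by simp
  note sc = system_set_card[OF C(1) C(2) C(3), of P j]
  have sc2: "real (card (system_set \<Lambda> P j)) \<le> cM" unfolding cM_def by (rule sc(2))
  have 3: "?U2 h0 \<in> sets lborel" "emeasure lborel (?U2 h0) \<le> ennreal ?b2" if "h0 \<in> NH" for h0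
    by (rule union_bound[OF sc(1) sc2 b1 2[OF that]]; assumption)+
  have b2: "0 \<le> ?b2" using cM b1 by simp
  have 4: "S \<in> sets lborel" "emeasure lborel S \<le> ennreal (?nc * exp (spread P0 s) * ?b2)"
    unfolding S_def by (rule union_bound[OF NH(1) NH(3) b2 3]; assumption)+
  show "S \<in> sets borel" using 4(1) by simp
  have key: "exp (spread P l) * X \<le> C2 ^ (?N * ?N) * exp (real ?N * real ?N * b) * exp (real ?N * (\<Sum>k\<in>P. l k))"
    unfolding X_def by (rule spread_key[OF p b s C2])
  have "?nc * exp (spread P0 s) * ?b2 = ?nc * ?nc * exp (spread P0 s) * (C * exp (real ?N)) ^ ?N * 4 ^ (?N * ?N)
      * exp (real ?N * (\<Sum>i\<in>P. j i)) * (exp (spread P l) * X)"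
    by (simp add: cM_def)
  also have "\<dots> \<le> ?nc * ?nc * exp (spread P0 s) * (C * exp (real ?N)) ^ ?N * 4 ^ (?N * ?N)
      * exp (real ?N * (\<Sum>i\<in>P. j i)) * (C2 ^ (?N * ?N) * exp (real ?N * real ?N * b) * exp (real ?N * (\<Sum>k\<in>P. l k)))"
    using nc C(1) by (intro mult_left_mono key) auto
  also have "\<dots> = ?nc * ?nc * exp (spread P0 s) * (C * exp (real ?N)) ^ ?N * 4 ^ (?N * ?N)
       * C2 ^ (?N * ?N) * exp (real ?N * real ?N * b) * (exp ((\<Sum>k\<in>P. l k) + (\<Sum>i\<in>P. j i))) ^ ?N"
  proof -
    have "exp (real ?N * (\<Sum>i\<in>P. j i)) * exp (real ?N * (\<Sum>k\<in>P. l k)) = exp ((\<Sum>k\<in>P. l k) + (\<Sum>i\<in>P. j i)) ^ ?N"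
      by (simp add: exp_of_nat_mult[symmetric] exp_add[symmetric] algebra_simps)
    then show ?thesis by (simp add: ac_simps)
  qed
  also have "\<dots> \<le> ?nc * ?nc * exp (spread P0 s) * (C * exp (real ?N)) ^ ?N * 4 ^ (?N * ?N)
       * C2 ^ (?N * ?N) * exp (real ?N * real ?N * b) * (C1 * \<tau>) ^ ?N"
    using nc C(1) C20 by (intro mult_left_mono power_mono tau(3)) auto
  also have "\<dots> = (?nc * ?nc * (C * exp (real ?N)) ^ ?N * 4 ^ (?N * ?N) * C2 ^ (?N * ?N)
      * exp (real ?N * real ?N * b) * C1 ^ ?N) * exp (spread P0 s) * \<tau> ^ ?N"
    by (simp add: power_mult_distrib)
  finally have "ennreal (?nc * exp (spread P0 s) * ?b2) \<le> ennreal \<dots>" by (rule ennreal_leI)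
  with 4(2) show "emeasure lborel S \<le> ennreal ((?nc * ?nc * (C * exp (real ?N)) ^ ?N * 4 ^ (?N * ?N)
      * C2 ^ (?N * ?N) * exp (real ?N * real ?N * b) * C1 ^ ?N) * exp (spread P0 s) * \<tau> ^ ?N)"
    by (rule order_trans)
qed

lemma floor_ln_bounds:
  fixes x :: real
  assumes "0 < x"
  shows "exp (of_int \<lfloor>ln x\<rfloor>) \<le> x" "x \<le> exp (of_int \<lfloor>ln x\<rfloor> + 1)"
proof -
  have "exp (of_int \<lfloor>ln x\<rfloor>) \<le> exp (ln x)" by simp
  then show "exp (of_int \<lfloor>ln x\<rfloor>) \<le> x" using assms by simp
  have "exp (ln x) \<le> exp (of_int \<lfloor>ln x\<rfloor> + 1)" using floor_correct[of "ln x"] by (simp add: less_imp_le)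
  then show "x \<le> exp (of_int \<lfloor>ln x\<rfloor> + 1)" using assms by simp
qed

lemma norm_dil_le:
  assumes "\<And>i. \<bar>s i\<bar> \<le> \<kappa>" shows "norm (dil s *v (v::real^'n)) \<le> exp \<kappa> * norm v"
proof -
  have "(norm (dil s *v v))\<^sup>2 = (\<Sum>i\<in>UNIV. (exp (- s i) * v $ i)\<^sup>2)"
    by (simp add: norm_vec_def[of "dil s *v v"] L2_set_def sum_nonneg dil_nth)
  also have "\<dots> \<le> (\<Sum>i\<in>UNIV. (exp \<kappa>)\<^sup>2 * (v $ i)\<^sup>2)"
  proof (rule sum_mono)
    fix i
    have "exp (- s i) \<le> exp \<kappa>" using assms[of i] by (simp add: abs_le_iff)
    then have "(exp (- s i))\<^sup>2 \<le> (exp \<kappa>)\<^sup>2" by (rule power_mono) simp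
    then show "(exp (- s i) * v $ i)\<^sup>2 \<le> (exp \<kappa>)\<^sup>2 * (v $ i)\<^sup>2" unfolding power_mult_distrib by (rule mult_right_mono) simp
  qed
  also have "\<dots> = (exp \<kappa> * norm v)\<^sup>2"
    by (simp add: norm_vec_def[of v] L2_set_def sum_nonneg power_mult_distrib sum_distrib_left)
  finally show ?thesis by (rule power2_le_imp_le) simp
qed

text \<open>
  The indices are the integer parts of the logarithms of the lengths. They are bounded below because lattice
  vectors are not short and by \<open>lengths_lower_bound\<close>, and then above because their sum is bounded
  above; hence their number grows only polynomially in \<open>\<kappa>\<close>.
\<close>

lemma short_system_index:
  fixes \<Lambda> :: "(real^'n::{finite,wellorder}) set" and P P0 :: "'n set"
  assumes L: "discrete_subgroup \<Lambda>" and r: "0 < r" "\<forall>x\<in>\<Lambda>. x \<noteq> 0 \<longrightarrow> r \<le> norm x"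
    and A: "A \<in> near_id" and c: "c \<le> det A" "0 < c"
    and h: "h \<in> block_orthogonal P0"
    and kap: "\<And>i. \<bar>s i\<bar> \<le> \<kappa>" "1 \<le> \<kappa>" and tau: "0 < \<tau>" "\<tau> \<le> 1"
    and sh: "short_system P (dil s ** h ** A) \<Lambda> \<tau>"
  defines "C1 \<equiv> real CARD('n) ^ CARD('n) * fact CARD('n)"
  defines "b \<equiv> \<bar>ln (c / (fact CARD('n) * 2 ^ CARD('n)))\<bar>"
  shows "\<exists>l j m W. (\<forall>i. \<bar>real_of_int (l i)\<bar> \<le> (b + \<bar>ln r\<bar> + 3 + \<bar>ln C1\<bar> + real CARD('n) * (b + \<bar>ln r\<bar> + 2)) * \<kappa>)
     \<and> (\<forall>i. \<bar>real_of_int (j i)\<bar> \<le> (b + \<bar>ln r\<bar> + 3 + \<bar>ln C1\<bar> + real CARD('n) * (b + \<bar>ln r\<bar> + 2)) * \<kappa>)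
     \<and> (\<exists>p. inj p \<and> (\<forall>k\<in>P. - (b + 1) - s (p k) \<le> real_of_int (l k)))
     \<and> exp ((\<Sum>i\<in>P. real_of_int (l i)) + (\<Sum>i\<in>P. real_of_int (j i))) \<le> C1 * \<tau>
     \<and> m \<in> system_set \<Lambda> P (\<lambda>i. real_of_int (j i)) \<and> W \<in> block_orthogonal P
     \<and> (\<forall>k\<in>P. norm ((dil s ** h ** A) *v (W ** ref_frame P m) $ k) \<le> exp (real_of_int (l k) + 1))"
proof -
  let ?N = "real CARD('n)"
  let ?g = "dil s ** h ** A"
  obtain m W where m: "\<forall>i\<in>P. m $ i \<in> \<Lambda> \<and> m $ i \<noteq> 0" "\<forall>i. i \<notin> P \<longrightarrow> m $ i = 0" and W: "W \<in> block_orthogonal P"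
    and oR: "orthogonal_matrix (ref_frame P m)"
    and prod: "(\<Prod>k\<in>P. norm (?g *v (W ** ref_frame P m) $ k)) * (\<Prod>i\<in>P. norm (m $ i)) \<le> C1 * \<tau>"
    using short_system_reduce[OF L sh] unfolding C1_def by metis
  define E where "E = W ** ref_frame P m"
  have oE: "orthogonal_matrix E" unfolding E_def using W oR by (auto simp: block_orthogonal_def intro: orthogonal_matrix_mul)
  have oh: "orthogonal_matrix h" using h by (auto simp: block_orthogonal_def)
  define c' where "c' = c / (fact CARD('n) * 2 ^ CARD('n))"
  have c': "0 < c'" using c by (simp add: c'_def)
  have bc: "b = \<bar>ln c'\<bar>" by (simp add: b_def c'_def)
  have b0: "0 \<le> b" by (simp add: bc)
  obtain p where p: "inj p" "\<And>k. c' * exp (- s (p k)) \<le> norm (?g *v E $ k)"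
    using lengths_lower_bound[OF A c oh oE, of s] unfolding c'_def by blast
  define len where "len k = norm (?g *v E $ k)" for k
  have lenpos: "0 < len k" for k
  proof -
    have "0 < c' * exp (- s (p k))" using c' by simp
    then show ?thesis using p(2)[of k] unfolding len_def by linarith
  qed
  have lnlow: "- b - s (p k) \<le> ln (len k)" for k
  proof -
    have "ln (c' * exp (- s (p k))) \<le> ln (len k)"
      unfolding len_def using p(2)[of k] c' lenpos[of k] by (intro ln_mono) (auto simp: len_def)
    then show ?thesis using c' by (simp add: ln_mult bc)
  qed
  have lnlow2: "- b - \<kappa> \<le> ln (len k)" for k using lnlow[of k] kap(1)[of "p k"] by linarith
  have lnup: "ln (len k) \<le> \<kappa> + 1" for k
  proof -
    have nE: "norm (E $ k) = 1" using oE by (simp add: orthogonal_matrix_rows norm_eq_sqrt_inner)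
    have "?g *v E $ k = dil s *v (h *v (A *v E $ k))" by (simp only: matrix_vector_mul_assoc matrix_mul_assoc)
    then have "len k \<le> exp \<kappa> * norm (h *v (A *v E $ k))" unfolding len_def using norm_dil_le[OF kap(1)] by simp
    also have "norm (h *v (A *v E $ k)) = norm (A *v E $ k)" by (rule orthogonal_matrix_norm[OF oh])
    also have "exp \<kappa> * norm (A *v E $ k) \<le> exp \<kappa> * exp 1"
    proof (rule mult_left_mono)
      have "norm (A *v E $ k) \<le> 2" using near_id_bounds(1)[OF A, of "E $ k"] nE by simp
      also have "2 \<le> exp (1::real)" using exp_ge_add_one_self[of "1::real"] by simp
      finally show "norm (A *v E $ k) \<le> exp 1" .
    qed simp
    finally have "len k \<le> exp (\<kappa> + 1)" by (simp add: exp_add)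
    then show ?thesis using lenpos[of k] by (metis ln_exp ln_le_cancel_iff exp_gt_zero)
  qed
  define M where "M i = ln (norm (m $ i))" for i
  have mpos: "0 < norm (m $ i)" if "i \<in> P" for i using m that by simp
  have Mlow: "- \<bar>ln r\<bar> \<le> M i" if "i \<in> P" for i
  proof -
    have "r \<le> norm (m $ i)" using r m that by blast
    then have "ln r \<le> M i" unfolding M_def using r by (intro ln_mono) auto
    then show ?thesis by linarith
  qed
  have C1: "0 < C1" by (simp add: C1_def)
  have sumln: "(\<Sum>k\<in>P. ln (len k)) + (\<Sum>i\<in>P. M i) \<le> ln (C1 * \<tau>)"
  proof -
    have pp: "0 < (\<Prod>k\<in>P. len k)" "0 < (\<Prod>i\<in>P. norm (m $ i))" using lenpos mpos by (auto intro: prod_pos)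
    have "ln ((\<Prod>k\<in>P. len k) * (\<Prod>i\<in>P. norm (m $ i))) \<le> ln (C1 * \<tau>)"
      using prod pp C1 tau by (intro ln_mono mult_pos_pos) (auto simp: len_def E_def)
    moreover have "ln ((\<Prod>k\<in>P. len k) * (\<Prod>i\<in>P. norm (m $ i))) = (\<Sum>k\<in>P. ln (len k)) + (\<Sum>i\<in>P. M i)"
    proof -
      have lz: "len k \<noteq> 0" for k using lenpos[of k] by simp
      show ?thesis using pp lz lenpos mpos by (simp add: ln_mult ln_prod M_def)
    qed
    ultimately show ?thesis by simp
  qed
  have sumln2: "(\<Sum>k\<in>P. ln (len k)) + (\<Sum>i\<in>P. M i) \<le> \<bar>ln C1\<bar>"
  proof -
    have "ln (C1 * \<tau>) = ln C1 + ln \<tau>" using C1 tau by (simp add: ln_mult)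
    moreover have "ln \<tau> \<le> 0" using tau by simp
    ultimately show ?thesis using sumln by linarith
  qed
  define B where "B = b + \<bar>ln r\<bar> + 3 + \<bar>ln C1\<bar> + ?N * (b + \<bar>ln r\<bar> + 2)"
  have cP: "real (card P) \<le> ?N" by (simp add: card_mono)
  have Mup: "M i \<le> (\<bar>ln C1\<bar> + ?N * (b + \<bar>ln r\<bar> + 2)) * \<kappa>" if i: "i \<in> P" for i
  proof -
    have "(\<Sum>k\<in>P. ln (len k)) \<ge> (\<Sum>k\<in>P. - (b + \<kappa>))" 
    proof (rule sum_mono)
      show "- (b + \<kappa>) \<le> ln (len k)" for k using lnlow2[of k] by linarith
    qed
    then have 1: "(\<Sum>k\<in>P. ln (len k)) \<ge> - (real (card P) * (b + \<kappa>))" by (simp add: algebra_simps)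
    have "(\<Sum>k\<in>P. M k) = M i + (\<Sum>k\<in>P - {i}. M k)" by (rule sum.remove) (use i in auto)
    moreover have "(\<Sum>k\<in>P - {i}. M k) \<ge> (\<Sum>k\<in>P - {i}. - \<bar>ln r\<bar>)" using Mlow by (intro sum_mono) auto
    moreover have "(\<Sum>k\<in>P - {i}. - \<bar>ln r\<bar>) \<ge> - (real (card P) * \<bar>ln r\<bar>)"
    proof -
      have "real (card (P - {i})) * \<bar>ln r\<bar> \<le> real (card P) * \<bar>ln r\<bar>" by (intro mult_right_mono) (auto intro: card_mono)
      then show ?thesis by simp
    qed
    ultimately have "M i \<le> \<bar>ln C1\<bar> + real (card P) * (b + \<kappa>) + real (card P) * \<bar>ln r\<bar>" using 1 sumln2 by linarith
    also have "\<dots> = \<bar>ln C1\<bar> + real (card P) * (b + \<kappa> + \<bar>ln r\<bar>)" by (simp add: algebra_simps)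
    also have "\<dots> \<le> \<bar>ln C1\<bar> + ?N * (b + \<kappa> + \<bar>ln r\<bar>)"
      using cP b0 kap(2) by (intro add_left_mono mult_right_mono) auto
    also have "\<dots> \<le> \<bar>ln C1\<bar> * \<kappa> + ?N * ((b + \<bar>ln r\<bar> + 2) * \<kappa>)"
    proof (intro add_mono mult_left_mono)
      show "\<bar>ln C1\<bar> \<le> \<bar>ln C1\<bar> * \<kappa>" using kap(2) mult_left_mono[of 1 \<kappa> "\<bar>ln C1\<bar>"] by simp
      have "b * 1 \<le> b * \<kappa>" "\<bar>ln r\<bar> * 1 \<le> \<bar>ln r\<bar> * \<kappa>" using b0 kap(2) by (intro mult_left_mono; simp)+
      then show "b + \<kappa> + \<bar>ln r\<bar> \<le> (b + \<bar>ln r\<bar> + 2) * \<kappa>" using kap(2) by (simp add: algebra_simps)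
    qed simp
    finally show ?thesis by (simp add: algebra_simps)
  qed
  have small: "\<bar>real_of_int \<lfloor>x\<rfloor>\<bar> \<le> B * \<kappa>"
    if "- (b + \<bar>ln r\<bar> + 1) * \<kappa> \<le> x" "x \<le> (b + \<bar>ln r\<bar> + 2 + \<bar>ln C1\<bar> + ?N * (b + \<bar>ln r\<bar> + 2)) * \<kappa>" for x
  proof -
    have q: "0 \<le> \<bar>ln C1\<bar> + ?N * (b + \<bar>ln r\<bar> + 2)" using b0 by simp
    have "0 \<le> (\<bar>ln C1\<bar> + ?N * (b + \<bar>ln r\<bar> + 2)) * \<kappa>" using q kap(2) by (intro mult_nonneg_nonneg) auto
    moreover have "x - 1 \<le> real_of_int \<lfloor>x\<rfloor>" "real_of_int \<lfloor>x\<rfloor> \<le> x" by linarith+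
    moreover have "B * \<kappa> = (b + \<bar>ln r\<bar> + 1) * \<kappa> + 2 * \<kappa> + (\<bar>ln C1\<bar> + ?N * (b + \<bar>ln r\<bar> + 2)) * \<kappa>"
      by (simp add: B_def algebra_simps)
    moreover have "(b + \<bar>ln r\<bar> + 2 + \<bar>ln C1\<bar> + ?N * (b + \<bar>ln r\<bar> + 2)) * \<kappa> = (b + \<bar>ln r\<bar> + 1) * \<kappa> + \<kappa> + (\<bar>ln C1\<bar> + ?N * (b + \<bar>ln r\<bar> + 2)) * \<kappa>"
      by (simp add: algebra_simps)
    moreover have "- (b + \<bar>ln r\<bar> + 1) * \<kappa> = - ((b + \<bar>ln r\<bar> + 1) * \<kappa>)" by (simp add: algebra_simps)
    ultimately show ?thesis using that kap(2) by linarith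
  qed
  have bk: "b \<le> b * \<kappa>" "\<bar>ln r\<bar> \<le> \<bar>ln r\<bar> * \<kappa>" "0 \<le> \<bar>ln C1\<bar> * \<kappa>" "0 \<le> \<bar>ln r\<bar> * \<kappa>" "0 \<le> b * \<kappa>" "0 \<le> ?N * (b + \<bar>ln r\<bar> + 2) * \<kappa>"
    using b0 kap(2) mult_left_mono[of 1 \<kappa> b] mult_left_mono[of 1 \<kappa> "\<bar>ln r\<bar>"] by auto
  have ex1: "(b + \<bar>ln r\<bar> + 2 + \<bar>ln C1\<bar> + ?N * (b + \<bar>ln r\<bar> + 2)) * \<kappa>
      = b * \<kappa> + \<bar>ln r\<bar> * \<kappa> + 2 * \<kappa> + \<bar>ln C1\<bar> * \<kappa> + ?N * (b + \<bar>ln r\<bar> + 2) * \<kappa>"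
    and ex2: "- (b + \<bar>ln r\<bar> + 1) * \<kappa> = - (b * \<kappa>) - \<bar>ln r\<bar> * \<kappa> - \<kappa>"
    and ex3: "(\<bar>ln C1\<bar> + ?N * (b + \<bar>ln r\<bar> + 2)) * \<kappa> = \<bar>ln C1\<bar> * \<kappa> + ?N * (b + \<bar>ln r\<bar> + 2) * \<kappa>"
    by (simp_all add: algebra_simps)
  define l where "l i = (if i \<in> P then \<lfloor>ln (len i)\<rfloor> else 0)" for i
  define j where "j i = (if i \<in> P then \<lfloor>M i\<rfloor> else 0)" for i
  have Bk: "0 \<le> B * \<kappa>" using b0 kap(2) by (simp add: B_def)
  have lB: "\<bar>real_of_int (l i)\<bar> \<le> B * \<kappa>" for i
  proof (cases "i \<in> P")
    case True
    have "\<bar>real_of_int \<lfloor>ln (len i)\<rfloor>\<bar> \<le> B * \<kappa>"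
    proof (rule small)
      show "- (b + \<bar>ln r\<bar> + 1) * \<kappa> \<le> ln (len i)" unfolding ex2 using lnlow2[of i] bk kap(2) by linarith
      show "ln (len i) \<le> (b + \<bar>ln r\<bar> + 2 + \<bar>ln C1\<bar> + ?N * (b + \<bar>ln r\<bar> + 2)) * \<kappa>"
        unfolding ex1 using lnup[of i] bk kap(2) by linarith
    qed
    then show ?thesis using True by (simp add: l_def)
  qed (simp add: l_def Bk)
  have jB: "\<bar>real_of_int (j i)\<bar> \<le> B * \<kappa>" for i
  proof (cases "i \<in> P")
    case True
    have "\<bar>real_of_int \<lfloor>M i\<rfloor>\<bar> \<le> B * \<kappa>"
    proof (rule small)
      show "- (b + \<bar>ln r\<bar> + 1) * \<kappa> \<le> M i" unfolding ex2 using Mlow[OF True] bk kap(2) by linarith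
      show "M i \<le> (b + \<bar>ln r\<bar> + 2 + \<bar>ln C1\<bar> + ?N * (b + \<bar>ln r\<bar> + 2)) * \<kappa>"
        unfolding ex1 using Mup[OF True, unfolded ex3] bk kap(2) by linarith
    qed
    then show ?thesis using True by (simp add: j_def)
  qed (simp add: j_def Bk)
  show ?thesis
    unfolding B_def[symmetric]
  proof (intro exI conjI allI ballI)
    show "\<bar>real_of_int (l i)\<bar> \<le> B * \<kappa>" for i by (rule lB)
    show "\<bar>real_of_int (j i)\<bar> \<le> B * \<kappa>" for i by (rule jB)
    show "inj p" by (rule p)
    show "- (b + 1) - s (p k) \<le> real_of_int (l k)" if "k \<in> P" for k
    proof -
      have "ln (len k) - 1 \<le> real_of_int \<lfloor>ln (len k)\<rfloor>" by linarith
      moreover have "l k = \<lfloor>ln (len k)\<rfloor>" using that by (simp add: l_def)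
      ultimately show ?thesis using lnlow[of k] by linarith
    qed
    show "exp ((\<Sum>i\<in>P. real_of_int (l i)) + (\<Sum>i\<in>P. real_of_int (j i))) \<le> C1 * \<tau>"
    proof -
      have "(\<Sum>i\<in>P. real_of_int (l i)) + (\<Sum>i\<in>P. real_of_int (j i)) \<le> (\<Sum>k\<in>P. ln (len k)) + (\<Sum>i\<in>P. M i)"
        by (intro add_mono sum_mono) (auto simp: l_def j_def)
      then have "exp ((\<Sum>i\<in>P. real_of_int (l i)) + (\<Sum>i\<in>P. real_of_int (j i))) \<le> exp (ln (C1 * \<tau>))"
        using sumln by simp
      then show ?thesis using C1 tau by simp
    qed
    show "m \<in> system_set \<Lambda> P (\<lambda>i. real_of_int (j i))"
      using m oR floor_ln_bounds(2)[OF mpos] by (auto simp: system_set_def j_def M_def)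
    show "W \<in> block_orthogonal P" by (rule W)
    show "norm (?g *v (W ** ref_frame P m) $ k) \<le> exp (real_of_int (l k) + 1)" if "k \<in> P" for k
      using floor_ln_bounds(2)[OF lenpos[of k]] that by (simp add: l_def len_def E_def)
  qed
qed

section \<open>Measure of the matrices with a short system\<close>

text \<open>
  Sum \<open>index_measure\<close> over all \<open>P\<close> and over the polynomially many indices. For
  \<open>s i = t * z $ i\<close> the bound is \<open>exp (t * delta n z) * \<tau> ^ N\<close> up to a
  polynomial in \<open>t\<close>, so that \<open>\<tau> = exp (- t * delta n z / N)\<close> is the critical
  size. The group \<open>G\<close> enters through its net only, which is the source of the factor \<open>exp
  (spread P0 s)\<close>.
\<close>

lemma short_system_measure:
  fixes \<Lambda> :: "(real^'n::{finite,wellorder}) set" and P0 :: "'n set"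
  assumes L: "discrete_subgroup \<Lambda>"
  shows "\<exists>C\<ge>0. \<forall>G s \<kappa> \<tau>. G \<subseteq> block_orthogonal P0 \<longrightarrow> (\<Sum>i\<in>UNIV. s i) = 0 \<longrightarrow> (\<forall>i. \<bar>s i\<bar> \<le> \<kappa>) \<longrightarrow> 1 \<le> \<kappa>
    \<longrightarrow> 0 < \<tau> \<longrightarrow> \<tau> \<le> 1 \<longrightarrow> (\<exists>S\<in>sets borel. {A\<in>near_id. \<exists>P. \<exists>h\<in>G. short_system P (dil s ** h ** A) \<Lambda> \<tau>} \<subseteq> S
      \<and> emeasure lborel S \<le> ennreal (C * \<kappa> ^ (2 * CARD('n)) * exp (spread P0 s) * \<tau> ^ CARD('n)))"
proof -
  let ?N = "CARD('n)"
  obtain r where r: "r > 0" "\<forall>x\<in>\<Lambda>. x \<noteq> 0 \<longrightarrow> r \<le> norm x"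
    using L by (auto simp: discrete_subgroup_def)
  obtain CL where CL0: "1 \<le> CL" "\<forall>R\<ge>0. finite {v\<in>\<Lambda>. v \<noteq> 0 \<and> norm v \<le> R} \<and> real (card {v\<in>\<Lambda>. v \<noteq> 0 \<and> norm v \<le> R}) \<le> CL * R ^ ?N"
    using discrete_subgroup_count[OF L] by (elim exE conjE)
  have CL: "1 \<le> CL" "\<And>R. 0 \<le> R \<Longrightarrow> finite {v\<in>\<Lambda>. v \<noteq> 0 \<and> norm v \<le> R}"
    "\<And>R. 0 \<le> R \<Longrightarrow> real (card {v\<in>\<Lambda>. v \<noteq> 0 \<and> norm v \<le> R}) \<le> CL * R ^ ?N"
    using CL0 by blast+
  obtain c where c0: "0 < c" "\<forall>A\<in>near_id. c \<le> det (A :: real^'n::_^'n::_)"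
    using near_id_det by (elim exE conjE)
  have c: "0 < c" "\<And>A. A \<in> near_id \<Longrightarrow> c \<le> det (A :: real^'n::_^'n::_)"
    using c0 by blast+
  define C1 where "C1 = real ?N ^ ?N * fact ?N"
  define b where "b = \<bar>ln (c / (fact ?N * 2 ^ ?N))\<bar>"
  define B where "B = b + \<bar>ln r\<bar> + 3 + \<bar>ln C1\<bar> + real ?N * (b + \<bar>ln r\<bar> + 2)"
  have B0: "0 \<le> B" by (simp add: B_def b_def)
  define C2 where "C2 = box_const TYPE('n)"
  have C2: "1 \<le> C2" unfolding C2_def by (rule box_const_ge_1)
  have C10: "0 \<le> C1" by (simp add: C1_def)
  define D where "D = net_const TYPE('n) * net_const TYPE('n) * (CL * exp (real ?N)) ^ ?N * 4 ^ (?N * ?N)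
      * C2 ^ (?N * ?N) * exp (real ?N * real ?N * (b + 1)) * C1 ^ ?N"
  have D0: "0 \<le> D" using CL(1) C2 C10 by (simp add: D_def net_const_def)
  define C where "C = 2 ^ ?N * (2 * B + 3) ^ (2 * ?N) * D"
  have C0: "0 \<le> C" using B0 D0 by (simp add: C_def)
  have "\<exists>S\<in>sets borel. {A\<in>near_id. \<exists>P. \<exists>h\<in>G. short_system P (dil s ** h ** A) \<Lambda> \<tau>} \<subseteq> S
      \<and> emeasure lborel S \<le> ennreal (C * \<kappa> ^ (2 * ?N) * exp (spread P0 s) * \<tau> ^ ?N)"
    if G: "G \<subseteq> block_orthogonal P0" and s: "(\<Sum>i\<in>UNIV. s i) = 0" and kap: "\<forall>i. \<bar>s i\<bar> \<le> \<kappa>" "1 \<le> \<kappa>" and tau: "0 < \<tau>" "\<tau> \<le> 1"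
    for G s \<kappa> \<tau>
  proof -
    define K where "K = \<lfloor>B * \<kappa>\<rfloor>"
    have K0: "0 \<le> K" using B0 kap by (simp add: K_def)
    define F where "F = (PiE UNIV (\<lambda>_. {- K..K}) :: ('n \<Rightarrow> int) set)"
    have fF: "finite F" unfolding F_def by (intro finite_PiE) auto
    have cF: "real (card F) \<le> ((2 * B + 3) * \<kappa>) ^ ?N"
    proof -
      have "card F = nat (2 * K + 1) ^ ?N" unfolding F_def by (subst card_PiE) (auto simp: algebra_simps)
      then have "real (card F) = real_of_int (2 * K + 1) ^ ?N" using K0 by simp
      also have "\<dots> \<le> ((2 * B + 3) * \<kappa>) ^ ?N"
      proof (rule power_mono)
        have "real_of_int K \<le> B * \<kappa>" by (simp add: K_def)
        then show "real_of_int (2 * K + 1) \<le> (2 * B + 3) * \<kappa>" using kap(2) by (simp add: algebra_simps)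
        show "0 \<le> real_of_int (2 * K + 1)" using K0 by simp
      qed
      finally show ?thesis .
    qed
    have memF: "l \<in> F" if "\<And>i. \<bar>real_of_int (l i)\<bar> \<le> B * \<kappa>" for l :: "'n \<Rightarrow> int"
    proof -
      have "- K \<le> l i \<and> l i \<le> K" for i
      proof -
        have "real_of_int (l i) \<le> B * \<kappa>" "real_of_int (- l i) \<le> B * \<kappa>" using that[of i] by auto
        then have "l i \<le> K" "- l i \<le> K" unfolding K_def by (simp_all only: le_floor_iff)
        then show ?thesis by linarith
      qed
      then show ?thesis by (auto simp: F_def)
    qed
    define adm where "adm P l j \<longleftrightarrow> (\<exists>p. inj p \<and> (\<forall>k\<in>P. - (b + 1) - s (p k) \<le> real_of_int (l k)))
      \<and> exp ((\<Sum>i\<in>P. real_of_int (l i)) + (\<Sum>i\<in>P. real_of_int (j i))) \<le> C1 * \<tau>" for P :: "'n set" and l j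
    define I where "I = {(P, l, j). l \<in> F \<and> j \<in> F \<and> adm P l j}"
    have Isub: "I \<subseteq> UNIV \<times> F \<times> F" by (auto simp: I_def)
    have fI: "finite I" by (rule finite_subset[OF Isub]) (use fF in auto)
    have cI: "real (card I) \<le> 2 ^ ?N * ((2 * B + 3) ^ (2 * ?N) * \<kappa> ^ (2 * ?N))"
    proof -
      have "card I \<le> card ((UNIV :: 'n set set) \<times> F \<times> F)" by (rule card_mono[OF _ Isub]) (use fF in auto)
      also have "\<dots> = 2 ^ ?N * (card F * card F)" by (simp add: card_cartesian_product card_UNIV_set card_Pow Pow_UNIV[symmetric] del: Pow_UNIV)
      finally have "real (card I) \<le> real (2 ^ ?N * (card F * card F))" by (simp only: of_nat_le_iff)
      also have "\<dots> = 2 ^ ?N * (real (card F) * real (card F))" by simp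
      also have "\<dots> \<le> 2 ^ ?N * (((2 * B + 3) * \<kappa>) ^ ?N * ((2 * B + 3) * \<kappa>) ^ ?N)"
      proof (rule mult_left_mono)
        have "0 \<le> ((2 * B + 3) * \<kappa>) ^ ?N" by (rule order_trans[OF of_nat_0_le_iff cF])
        then show "real (card F) * real (card F) \<le> ((2 * B + 3) * \<kappa>) ^ ?N * ((2 * B + 3) * \<kappa>) ^ ?N"
          by (rule mult_mono[OF cF cF]) simp
      qed simp
      also have "\<dots> = 2 ^ ?N * ((2 * B + 3) ^ (2 * ?N) * \<kappa> ^ (2 * ?N))"
      proof -
        have "X ^ ?N * X ^ ?N = X ^ (2 * ?N)" for X :: real by (metis mult_2 power_add)
        then have "((2 * B + 3) * \<kappa>) ^ ?N * ((2 * B + 3) * \<kappa>) ^ ?N = ((2 * B + 3) * \<kappa>) ^ (2 * ?N)" .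
        then show ?thesis by (simp only: power_mult_distrib[of "2 * B + 3" \<kappa> "2 * ?N"])
      qed
      finally show ?thesis .
    qed
    obtain NH where NH: "finite NH" "NH \<subseteq> G" "real (card NH) \<le> net_const TYPE('n) * exp (spread P0 s)"
      "\<forall>x\<in>G. \<exists>y\<in>NH. near_block P0 s x y"
      using near_block_net[OF G, of s] by (elim exE conjE)
    have NH2: "NH \<subseteq> block_orthogonal P0" using NH G by auto
    define NW where "NW P l = (SOME A. finite A \<and> A \<subseteq> block_orthogonal P \<and> real (card A) \<le> net_const TYPE('n) * exp (spread P l)
      \<and> (\<forall>x\<in>block_orthogonal P. \<exists>y\<in>A. near_block P l x y))" for P :: "'n set" and l
    have NW: "finite (NW P l) \<and> NW P l \<subseteq> block_orthogonal P \<and> real (card (NW P l)) \<le> net_const TYPE('n) * exp (spread P l)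
      \<and> (\<forall>x\<in>block_orthogonal P. \<exists>y\<in>NW P l. near_block P l x y)" for P l
      unfolding NW_def by (rule someI_ex) (rule near_block_net[OF order_refl])
    define T where "T = (\<lambda>(P, l, j). \<Union>h0\<in>NH. \<Union>m\<in>system_set \<Lambda> P (\<lambda>i. real_of_int (j i)). \<Union>W0\<in>NW P (\<lambda>i. real_of_int (l i)).
        box_event P (\<lambda>i. real_of_int (l i)) s C2 h0 (W0 ** ref_frame P m))"
    have T: "T x \<in> sets lborel" "emeasure lborel (T x) \<le> ennreal (D * exp (spread P0 s) * \<tau> ^ ?N)" if x: "x \<in> I" for x
    proof -
      obtain P l j where x: "x = (P, l, j)" "adm P l j" using x by (auto simp: I_def)
      obtain p where p: "inj p" "\<And>k. k \<in> P \<Longrightarrow> - (b + 1) - s (p k) \<le> real_of_int (l k)"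
        and e: "exp ((\<Sum>i\<in>P. real_of_int (l i)) + (\<Sum>i\<in>P. real_of_int (j i))) \<le> C1 * \<tau>"
        using x(2) unfolding adm_def by blast
      have b1: "0 \<le> b + 1" by (simp add: b_def)
      have nw: "finite (NW P (\<lambda>i. real_of_int (l i)))" "NW P (\<lambda>i. real_of_int (l i)) \<subseteq> block_orthogonal P"
        "real (card (NW P (\<lambda>i. real_of_int (l i)))) \<le> net_const TYPE('n) * exp (spread P (\<lambda>i. real_of_int (l i)))"
        using NW[of P "\<lambda>i. real_of_int (l i)"] by blast+
      note * = index_measure[OF CL NH(1) NH2 NH(3) nw s p b1 tau(1) C10 e C2]
      show "T x \<in> sets lborel" using *(1) by (simp add: x T_def)
      show "emeasure lborel (T x) \<le> ennreal (D * exp (spread P0 s) * \<tau> ^ ?N)" using *(2) by (simp add: x T_def D_def)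
    qed
    have D1: "0 \<le> D * exp (spread P0 s) * \<tau> ^ ?N" using D0 tau by simp
    have Um: "(\<Union>x\<in>I. T x) \<in> sets lborel"
      by (rule union_bound(1)[OF fI cI D1]) (rule T; assumption)+
    have Ub: "emeasure lborel (\<Union>x\<in>I. T x) \<le> ennreal (2 ^ ?N * ((2 * B + 3) ^ (2 * ?N) * \<kappa> ^ (2 * ?N)) * (D * exp (spread P0 s) * \<tau> ^ ?N))"
      by (rule union_bound(2)[OF fI cI D1]) (rule T; assumption)+
    have sub: "{A\<in>near_id. \<exists>P. \<exists>h\<in>G. short_system P (dil s ** h ** A) \<Lambda> \<tau>} \<subseteq> (\<Union>x\<in>I. T x)"
    proof
      fix A assume "A \<in> {A\<in>near_id. \<exists>P. \<exists>h\<in>G. short_system P (dil s ** h ** A) \<Lambda> \<tau>}"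
      then obtain P h where A: "A \<in> near_id" and h: "h \<in> G" and sh: "short_system P (dil s ** h ** A) \<Lambda> \<tau>" by blast
      have hb: "h \<in> block_orthogonal P0" using h G by blast
      note * = short_system_index[OF L r A c(2)[OF A] c(1) hb kap(1)[rule_format] kap(2) tau sh,
          folded b_def C1_def, folded B_def]
      obtain l j m W where all: "(\<forall>i. \<bar>real_of_int (l i)\<bar> \<le> B * \<kappa>) \<and> (\<forall>i. \<bar>real_of_int (j i)\<bar> \<le> B * \<kappa>)
        \<and> (\<exists>p. inj p \<and> (\<forall>k\<in>P. - (b + 1) - s (p k) \<le> real_of_int (l k)))
        \<and> exp ((\<Sum>i\<in>P. real_of_int (l i)) + (\<Sum>i\<in>P. real_of_int (j i))) \<le> C1 * \<tau>
        \<and> m \<in> system_set \<Lambda> P (\<lambda>i. real_of_int (j i)) \<and> W \<in> block_orthogonal P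
        \<and> (\<forall>k\<in>P. norm ((dil s ** h ** A) *v (W ** ref_frame P m) $ k) \<le> exp (real_of_int (l k) + 1))"
        using * by (elim exE)
      have lB: "\<And>i. \<bar>real_of_int (l i)\<bar> \<le> B * \<kappa>" and jB: "\<And>i. \<bar>real_of_int (j i)\<bar> \<le> B * \<kappa>"
        and p: "\<exists>p. inj p \<and> (\<forall>k\<in>P. - (b + 1) - s (p k) \<le> real_of_int (l k))"
        and e: "exp ((\<Sum>i\<in>P. real_of_int (l i)) + (\<Sum>i\<in>P. real_of_int (j i))) \<le> C1 * \<tau>"
        and m: "m \<in> system_set \<Lambda> P (\<lambda>i. real_of_int (j i))" and W: "W \<in> block_orthogonal P"
        and le: "\<And>k. k \<in> P \<Longrightarrow> norm ((dil s ** h ** A) *v (W ** ref_frame P m) $ k) \<le> exp (real_of_int (l k) + 1)"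
        using all by blast+
      have I: "(P, l, j) \<in> I" using memF[OF lB] memF[OF jB] p e by (simp add: I_def adm_def)
      obtain h0 where h0: "h0 \<in> NH" "near_block P0 s h h0" using NH(4) h by blast
      obtain W0 where W0: "W0 \<in> NW P (\<lambda>i. real_of_int (l i))" "near_block P (\<lambda>i. real_of_int (l i)) W W0"
        using NW[of P "\<lambda>i. real_of_int (l i)"] W by blast
      have "A \<in> box_event P (\<lambda>i. real_of_int (l i)) s C2 h0 (W0 ** ref_frame P m)"
        unfolding C2_def
      proof (rule mem_box_event[OF A hb _ h0(2) W _ W0(2) _ le])
        show "h0 \<in> block_orthogonal P0" using h0 NH2 by blast
        show "W0 \<in> block_orthogonal P" using W0 NW by blast
        show "orthogonal_matrix (ref_frame P m)" using m by (simp add: system_set_def)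
      qed
      then have "A \<in> T (P, l, j)" unfolding T_def using h0 m W0 by blast
      then show "A \<in> (\<Union>x\<in>I. T x)" using I by blast
    qed
    have eq: "2 ^ ?N * ((2 * B + 3) ^ (2 * ?N) * \<kappa> ^ (2 * ?N)) * (D * exp (spread P0 s) * \<tau> ^ ?N)
      = C * \<kappa> ^ (2 * ?N) * exp (spread P0 s) * \<tau> ^ ?N"
      by (simp add: C_def)
    show ?thesis
    proof (rule bexI[of _ "\<Union>x\<in>I. T x"], intro conjI)
      show "emeasure lborel (\<Union>x\<in>I. T x) \<le> ennreal (C * \<kappa> ^ (2 * ?N) * exp (spread P0 s) * \<tau> ^ ?N)"
        using Ub unfolding eq .
      show "(\<Union>x\<in>I. T x) \<in> sets borel" using Um by simp
    qed (rule sub)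
  qed
  then show ?thesis using C0 by (intro exI[of _ C]) blast
qed

section \<open>From every lattice to almost every lattice\<close>

text \<open>
  The exceptional sets of the Borel-Cantelli argument have this form. The rows of \<open>X\<close> need not be
  independent; a condition on fewer vectors is met by filling up with zero rows.
\<close>

definition hitting :: "(real^'n^'n) set \<Rightarrow> (real^'n) set set" where
  "hitting U = {\<Lambda>\<in>unimodular_lattices. \<exists>X\<in>U. \<forall>i. X $ i \<in> \<Lambda>}"

lemma linear_mult_transpose: "linear (\<lambda>A::real^'n^'n. (M::real^'n^'n) ** transpose A)"
  by (rule linearI) (simp_all add: vec_eq_iff matrix_matrix_mult_def transpose_def sum.distrib sum_distrib_left algebra_simps)

text \<open>
  A lattice \<open>act A integer_lattice\<close> contains the rows of \<open>M ** transpose A\<close> for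
  integer matrices \<open>M\<close> and no other matrices; each \<open>M\<close> gives an open condition on
  \<open>A\<close>.
\<close>

lemma hitting_open:
  fixes U :: "(real^'n::{finite,wellorder}^'n::_) set"
  assumes U: "open U" shows "open_in_lattices (hitting U)"
  unfolding open_in_lattices_def
proof
  show "hitting U \<subseteq> unimodular_lattices" by (auto simp: hitting_def)
  define Z where "Z = {M :: real^'n::_^'n::_. \<forall>i. M $ i \<in> integer_lattice}"
  have row: "(M ** transpose A) $ i = A *v M $ i" for M A :: "real^'n::_^'n::_" and i
    by (simp add: vec_eq_iff matrix_mult_transpose_nth matrix_vector_mult_row inner_commute)
  have "{A \<in> SL. act A integer_lattice \<in> hitting U} = SL \<inter> (\<Union>M\<in>Z. (\<lambda>A. M ** transpose A) -` U)"
  proof (intro set_eqI iffI)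
    fix A :: "real^'n::_^'n::_" assume "A \<in> {A \<in> SL. act A integer_lattice \<in> hitting U}"
    then obtain X where A: "A \<in> SL" and X: "X \<in> U" "\<And>i. X $ i \<in> act A integer_lattice" by (auto simp: hitting_def)
    have "\<forall>i. \<exists>v. v \<in> integer_lattice \<and> X $ i = A *v v" using X(2) by (auto simp: act_def)
    then obtain f where f: "\<And>i. f i \<in> integer_lattice" "\<And>i. X $ i = A *v f i" by metis
    define M where "M = (\<chi> i. f i)"
    have "M ** transpose A = X" by (subst vec_eq_iff) (simp add: row M_def f)
    moreover have "M \<in> Z" using f by (simp add: Z_def M_def)
    ultimately show "A \<in> SL \<inter> (\<Union>M\<in>Z. (\<lambda>A. M ** transpose A) -` U)" using A X by blast
  next
    fix A :: "real^'n::_^'n::_" assume "A \<in> SL \<inter> (\<Union>M\<in>Z. (\<lambda>A. M ** transpose A) -` U)"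
    then obtain M where A: "A \<in> SL" and M: "M \<in> Z" "M ** transpose A \<in> U" by blast
    have "act A integer_lattice \<in> unimodular_lattices"
      using A by (intro act_unimodular integer_lattice_unimodular) (simp add: SL_def)
    moreover have "(M ** transpose A) $ i \<in> act A integer_lattice" for i
      using M(1) unfolding row act_def Z_def by blast
    ultimately show "A \<in> {A \<in> SL. act A integer_lattice \<in> hitting U}" using A M by (auto simp: hitting_def)
  qed
  moreover have "open (\<Union>M\<in>Z. (\<lambda>A. M ** transpose A) -` U)"
  proof (rule open_UN, rule ballI)
    fix M :: "real^'n::_^'n::_"
    have "continuous_on UNIV (\<lambda>A::real^'n::_^'n::_. (M::real^'n::_^'n::_) ** transpose A)"
      by (rule linear_continuous_on[OF linear_conv_bounded_linear[THEN iffD1, OF linear_mult_transpose]])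
    then show "open ((\<lambda>A. M ** transpose A) -` U)" using U by (simp add: open_vimage)
  qed
  ultimately show "openin (top_of_set SL) {A \<in> SL. act A integer_lattice \<in> hitting U}"
    by (simp add: openin_open_Int)
qed

lemma open_in_lattices_sets: "open_in_lattices U \<Longrightarrow> U \<in> sets borel_lattices"
proof -
  assume U: "open_in_lattices U"
  have "{U. open_in_lattices U} \<subseteq> Pow unimodular_lattices" by (auto simp: open_in_lattices_def)
  then show ?thesis unfolding borel_lattices_def
    by (subst sets_measure_of) (use U in \<open>auto intro: sigma_sets.Basic\<close>)
qed

lemma space_borel_lattices: "space borel_lattices = unimodular_lattices"
proof -
  have "{U. open_in_lattices U} \<subseteq> Pow unimodular_lattices" by (auto simp: open_in_lattices_def)
  then show ?thesis unfolding borel_lattices_def by (rule space_measure_of)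
qed

definition unimod :: "real^'n^'n \<Rightarrow> real^'n^'n" where
  "unimod A = (det A powr (- 1 / real CARD('n))) *\<^sub>R A"

lemma det_scaleR:
  fixes A :: "real^'n^'n" shows "det (c *\<^sub>R A) = c ^ CARD('n) * det A"
proof -
  have "det (\<chi> i. (\<lambda>_. c) i *s (\<lambda>i. A $ i) i) = prod (\<lambda>_. c) (UNIV :: 'n set) * det (\<chi> i. A $ i)"
    by (rule det_rows_mul)
  moreover have "(\<chi> i. c *s A $ i) = c *\<^sub>R A" by (simp add: vec_eq_iff)
  ultimately show ?thesis by simp
qed

lemma det_unimod:
  fixes A :: "real^'n^'n" assumes "0 < det A" shows "det (unimod A) = 1"
proof -
  have "(det A powr (- 1 / real CARD('n))) ^ CARD('n) = det A powr (- 1)"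
    using assms by (simp add: powr_powr powr_realpow[symmetric])
  then show ?thesis using assms by (simp add: unimod_def det_scaleR powr_minus)
qed

text \<open>
  An open subset of a product is a countable union of rectangles from a basis.
\<close>

lemma joint_open:
  fixes W :: "((real^'n::{finite,wellorder}^'n::_) \<times> (real^'n::_^'n::_)) set"
  assumes W: "open W"
  shows "{(A, \<Lambda>). \<Lambda> \<in> unimodular_lattices \<and> (\<exists>X. (A, X) \<in> W \<and> (\<forall>i. X $ i \<in> \<Lambda>))} \<in> sets (borel \<Otimes>\<^sub>M borel_lattices)"
proof -
  obtain B :: "(real^'n::_^'n::_) set set" where B: "countable B" "topological_basis B" using ex_countable_basis by blast
  define J where "J = {(U, V) \<in> B \<times> B. U \<times> V \<subseteq> W}"
  have cJ: "countable J" by (rule countable_subset[of _ "B \<times> B"]) (use B in \<open>auto simp: J_def\<close>)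
  have oB: "open U" if "U \<in> B" for U using B(2) that by (rule topological_basis_open)
  have "{(A, \<Lambda>). \<Lambda> \<in> unimodular_lattices \<and> (\<exists>X. (A, X) \<in> W \<and> (\<forall>i. X $ i \<in> \<Lambda>))} = (\<Union>(U, V)\<in>J. U \<times> hitting V)"
  proof (intro set_eqI iffI)
    fix p assume "p \<in> {(A, \<Lambda>). \<Lambda> \<in> unimodular_lattices \<and> (\<exists>X. (A, X) \<in> W \<and> (\<forall>i. X $ i \<in> \<Lambda>))}"
    then obtain A \<Lambda> X where p: "p = (A, \<Lambda>)" "\<Lambda> \<in> unimodular_lattices" "(A, X) \<in> W" "\<forall>i. X $ i \<in> \<Lambda>" by blast
    obtain U V where UV: "open U" "open V" "(A, X) \<in> U \<times> V" "U \<times> V \<subseteq> W" using open_prod_elim[OF W p(3)] by metis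
    have AU: "A \<in> U" and XV: "X \<in> V" using UV(3) by auto
    obtain U' where U': "U' \<in> B" "A \<in> U'" "U' \<subseteq> U" by (rule topological_basisE[OF B(2) UV(1) AU])
    obtain V' where V': "V' \<in> B" "X \<in> V'" "V' \<subseteq> V" by (rule topological_basisE[OF B(2) UV(2) XV])
    have "(U', V') \<in> J" using U' V' UV(4) by (auto simp: J_def)
    moreover have "p \<in> U' \<times> hitting V'" using p U' V' by (auto simp: hitting_def)
    ultimately show "p \<in> (\<Union>(U, V)\<in>J. U \<times> hitting V)" by blast
  next
    fix p assume "p \<in> (\<Union>(U, V)\<in>J. U \<times> hitting V)"
    then obtain U V A \<Lambda> where UV: "(U, V) \<in> J" "p = (A, \<Lambda>)" "A \<in> U" "\<Lambda> \<in> hitting V" by blast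
    then obtain X where X: "\<Lambda> \<in> unimodular_lattices" "X \<in> V" "\<forall>i. X $ i \<in> \<Lambda>" unfolding hitting_def by blast
    have "(A, X) \<in> W" using UV X by (auto simp: J_def)
    then show "p \<in> {(A, \<Lambda>). \<Lambda> \<in> unimodular_lattices \<and> (\<exists>X. (A, X) \<in> W \<and> (\<forall>i. X $ i \<in> \<Lambda>))}"
      using UV X by blast
  qed
  also have "\<dots> \<in> sets (borel \<Otimes>\<^sub>M borel_lattices)"
  proof (rule sets.countable_UN'[OF cJ])
    show "(\<lambda>(U, V). U \<times> hitting V) ` J \<subseteq> sets (borel \<Otimes>\<^sub>M borel_lattices)"
    proof
      fix S assume "S \<in> (\<lambda>(U, V). U \<times> hitting V) ` J"
      then obtain U V where UV: "U \<in> B" "V \<in> B" "S = U \<times> hitting V" by (auto simp: J_def)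
      then show "S \<in> sets (borel \<Otimes>\<^sub>M borel_lattices)"
        using oB[of U] open_in_lattices_sets[OF hitting_open[OF oB[of V]]] by (auto intro!: pair_measureI)
    qed
  qed
  finally show ?thesis .
qed

lemma joint_hitting:
  fixes U :: "(real^'n::{finite,wellorder}^'n::_) set"
  assumes U: "open U"
  shows "{(A, \<Lambda>). 0 < det A \<and> \<Lambda> \<in> unimodular_lattices \<and> act (unimod A) \<Lambda> \<in> hitting U} \<in> sets (borel \<Otimes>\<^sub>M borel_lattices)"
proof -
  define W where "W = {p :: (real^'n::_^'n::_) \<times> (real^'n::_^'n::_). 0 < det (fst p) \<and> snd p ** transpose (unimod (fst p)) \<in> U}"
  have row: "(M ** transpose A) $ i = A *v M $ i" for M A :: "real^'n::_^'n::_" and i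
    by (simp add: vec_eq_iff matrix_mult_transpose_nth matrix_vector_mult_row inner_commute)
  have cdet: "continuous_on S (\<lambda>p::(real^'n::_^'n::_) \<times> (real^'n::_^'n::_). det (fst p))" for S
    by (rule continuous_on_compose2[OF continuous_on_det continuous_on_fst[OF continuous_on_id] subset_UNIV])
  have oD: "open {p :: (real^'n::_^'n::_) \<times> (real^'n::_^'n::_). 0 < det (fst p)}"
    using open_Collect_less[OF continuous_on_const cdet] .
  have "continuous_on {p. 0 < det (fst p)} (\<lambda>p::(real^'n::_^'n::_) \<times> (real^'n::_^'n::_). snd p ** transpose (unimod (fst p)))"
  proof -
    have e: "(\<lambda>p::(real^'n::_^'n::_) \<times> (real^'n::_^'n::_). snd p ** transpose (unimod (fst p)))
      = (\<lambda>p. \<chi> i j. \<Sum>k\<in>UNIV. snd p $ i $ k * ((det (fst p) powr (- 1 / real CARD('n))) * fst p $ j $ k))"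
      by (simp add: fun_eq_iff vec_eq_iff matrix_matrix_mult_def transpose_def unimod_def)
    show ?thesis unfolding e
      by (intro continuous_on_vec_lambda continuous_on_sum continuous_on_mult continuous_on_powr continuous_intros cdet) auto
  qed
  then have "open ((\<lambda>p. snd p ** transpose (unimod (fst p))) -` U \<inter> {p :: (real^'n::_^'n::_) \<times> (real^'n::_^'n::_). 0 < det (fst p)})"
    using continuous_on_open_vimage[OF oD] U by blast
  moreover have "W = (\<lambda>p. snd p ** transpose (unimod (fst p))) -` U \<inter> {p. 0 < det (fst p)}"
    by (auto simp: W_def)
  ultimately have "open W" by simp
  have "{(A, \<Lambda>). 0 < det A \<and> \<Lambda> \<in> unimodular_lattices \<and> act (unimod A) \<Lambda> \<in> hitting U}
    = {(A, \<Lambda>). \<Lambda> \<in> unimodular_lattices \<and> (\<exists>X. (A, X) \<in> W \<and> (\<forall>i. X $ i \<in> \<Lambda>))}"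
  proof -
    have "act (unimod A) \<Lambda> \<in> hitting U \<longleftrightarrow> (\<exists>X. (A, X) \<in> W \<and> (\<forall>i. X $ i \<in> \<Lambda>))"
      if A: "0 < det A" and \<Lambda>: "\<Lambda> \<in> unimodular_lattices" for A :: "real^'n::_^'n::_" and \<Lambda>
    proof
      assume "act (unimod A) \<Lambda> \<in> hitting U"
      then obtain X where X: "X \<in> U" "\<And>i. X $ i \<in> act (unimod A) \<Lambda>" by (auto simp: hitting_def)
      have "\<forall>i. \<exists>v. v \<in> \<Lambda> \<and> X $ i = unimod A *v v" using X(2) by (auto simp: act_def)
      then obtain f where f: "\<And>i. f i \<in> \<Lambda>" "\<And>i. X $ i = unimod A *v f i" by metis
      have "(\<chi> i. f i) ** transpose (unimod A) = X" by (subst vec_eq_iff) (simp add: row f)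
      then have "(A, \<chi> i. f i) \<in> W" using A X by (simp add: W_def)
      then show "\<exists>X. (A, X) \<in> W \<and> (\<forall>i. X $ i \<in> \<Lambda>)" using f by (intro exI[of _ "\<chi> i. f i"]) simp
    next
      assume "\<exists>X. (A, X) \<in> W \<and> (\<forall>i. X $ i \<in> \<Lambda>)"
      then obtain X where X: "X ** transpose (unimod A) \<in> U" "\<And>i. X $ i \<in> \<Lambda>" by (auto simp: W_def)
      have "(X ** transpose (unimod A)) $ i \<in> act (unimod A) \<Lambda>" for i
        unfolding row act_def using X(2) by blast
      then show "act (unimod A) \<Lambda> \<in> hitting U"
        using X(1) act_unimodular[OF \<Lambda> det_unimod[OF A]] by (auto simp: hitting_def)
    qed
    moreover have "0 < det A" if "(A, X) \<in> W" for A X using that by (simp add: W_def)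
    ultimately show ?thesis by auto
  qed
  then show ?thesis using joint_open[OF \<open>open W\<close>] by simp
qed

lemma limsup_hitting_measurable:
  fixes \<mu> :: "(real^'n::{finite,wellorder}) set measure" and U :: "nat \<Rightarrow> (real^'n::_^'n::_) set"
  assumes sm: "sets \<mu> = sets borel_lattices" and U: "\<And>k. open (U k)"
    and E: "E = (\<Inter>K. \<Union>k\<in>{K..}. hitting (U k))"
  shows "{(A, \<Lambda>). A \<in> near_id \<and> \<Lambda> \<in> unimodular_lattices \<and> act (unimod A) \<Lambda> \<in> E} \<in> sets (lborel \<Otimes>\<^sub>M \<mu>)"
    (is "?T \<in> _")
proof -
  have sp: "space \<mu> = unimodular_lattices" using sets_eq_imp_space_eq[OF sm] space_borel_lattices by simp
  have pos: "0 < det A" if "A \<in> near_id" for A :: "real^'n::_^'n::_" using near_id_det that by (metis less_le_trans)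
  have sb: "sets ((lborel :: (real^'n::_^'n::_) measure) \<Otimes>\<^sub>M \<mu>) = sets (borel \<Otimes>\<^sub>M borel_lattices)"
    by (rule sets_pair_measure_cong) (simp_all add: sm)
    define J where "J k = {(A, \<Lambda>). 0 < det A \<and> \<Lambda> \<in> unimodular_lattices \<and> act (unimod A) \<Lambda> \<in> hitting (U k)}" for k
    have J: "J k \<in> sets (lborel \<Otimes>\<^sub>M \<mu>)" for k
    proof -
      have "J k \<in> sets (borel \<Otimes>\<^sub>M borel_lattices)" unfolding J_def by (rule joint_hitting) (rule U)
      then show ?thesis by (simp only: sb)
    qed
    have um: "unimodular_lattices \<in> sets \<mu>" using sets.top[of \<mu>] unfolding sp .
    have nid: "near_id \<in> sets (lborel :: (real^'n::_^'n::_) measure)" by (simp add: near_id_def)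
    have "near_id \<times> unimodular_lattices \<in> sets ((lborel :: (real^'n::_^'n::_) measure) \<Otimes>\<^sub>M \<mu>)"
      by (rule pair_measureI[OF nid um])
    moreover have "(\<Inter>K. \<Union>k\<in>{K..}. J k) \<in> sets (lborel \<Otimes>\<^sub>M \<mu>)"
    proof -
      have "(\<Union>k\<in>{K..}. J k) \<in> sets (lborel \<Otimes>\<^sub>M \<mu>)" for K using J by (intro sets.countable_UN) auto
      then show ?thesis by (intro sets.countable_INT) auto
    qed
    ultimately have "near_id \<times> unimodular_lattices \<inter> (\<Inter>K. \<Union>k\<in>{K..}. J k) \<in> sets (lborel \<Otimes>\<^sub>M \<mu>)" by (rule sets.Int)
    moreover have "?T = near_id \<times> unimodular_lattices \<inter> (\<Inter>K. \<Union>k\<in>{K..}. J k)"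
    proof (rule set_eqI)
      fix q :: "(real^'n::_^'n::_) \<times> (real^'n::_) set"
      obtain A \<Lambda> where q: "q = (A, \<Lambda>)" by (cases q)
      have Eiff: "X \<in> E \<longleftrightarrow> (\<forall>K. \<exists>k\<in>{K..}. X \<in> hitting (U k))" for X unfolding E by blast
      have Jiff: "(A, \<Lambda>) \<in> (\<Inter>K. \<Union>k\<in>{K..}. J k) \<longleftrightarrow> (\<forall>K. \<exists>k\<in>{K..}. (A, \<Lambda>) \<in> J k)" by blast
      have Jk: "(A, \<Lambda>) \<in> J k \<longleftrightarrow> 0 < det A \<and> \<Lambda> \<in> unimodular_lattices \<and> act (unimod A) \<Lambda> \<in> hitting (U k)" for k
        unfolding J_def by simp
      have Tiff: "(A, \<Lambda>) \<in> ?T \<longleftrightarrow> A \<in> near_id \<and> \<Lambda> \<in> unimodular_lattices \<and> act (unimod A) \<Lambda> \<in> E"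
        by simp
      show "q \<in> ?T \<longleftrightarrow> q \<in> near_id \<times> unimodular_lattices \<inter> (\<Inter>K. \<Union>k\<in>{K..}. J k)"
      proof (cases "A \<in> near_id \<and> \<Lambda> \<in> unimodular_lattices")
        case True
        then have "0 < det A" using pos by blast
        then show ?thesis unfolding q Int_iff Jiff Tiff Eiff Jk using True by simp
      next
        case False
        then show ?thesis unfolding q Int_iff Tiff by blast
      qed
    qed
    ultimately show ?thesis by simp
qed

text \<open>
  Let \<open>E\<close> be the set of lattices in infinitely many \<open>hitting (U k)\<close>, and consider
  the pairs \<open>(A, \<Lambda>)\<close> with \<open>A\<close> near the identity and \<open>act (unimod A)
  \<Lambda> \<in> E\<close>. For fixed \<open>\<Lambda>\<close> the matrices \<open>A\<close> form a Lebesgue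
  null set by the Borel-Cantelli lemma. For fixed \<open>A\<close> the lattices have measure \<open>\<mu>
  E\<close> by invariance. Fubini's theorem gives \<open>\<mu> E = 0\<close>.
\<close>

lemma AE_eventually_not_hitting:
  fixes \<mu> :: "(real^'n::{finite,wellorder}) set measure" and U :: "nat \<Rightarrow> (real^'n::_^'n::_) set"
  assumes mu: "SL_invariant_prob_measure \<mu>" and U: "\<And>k. open (U k)"
    and S: "\<And>\<Lambda>. \<Lambda> \<in> unimodular_lattices \<Longrightarrow> \<exists>S b. (\<forall>k. S k \<in> sets lborel) \<and> (\<forall>k. {A\<in>near_id. act (unimod A) \<Lambda> \<in> hitting (U k)} \<subseteq> S k)
      \<and> (\<forall>k. emeasure lborel (S k) \<le> ennreal (b k)) \<and> (\<forall>k. 0 \<le> b k) \<and> summable b"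
  shows "AE \<Lambda> in \<mu>. \<forall>\<^sub>F k in sequentially. \<Lambda> \<notin> hitting (U k)"
proof -
  interpret M: prob_space \<mu> using mu by (simp add: SL_invariant_prob_measure_def)
  have sm: "sets \<mu> = sets borel_lattices" using mu by (simp add: SL_invariant_prob_measure_def)
  have sp: "space \<mu> = unimodular_lattices" using sets_eq_imp_space_eq[OF sm] space_borel_lattices by simp
  have hm: "hitting (U k) \<in> sets \<mu>" for k using open_in_lattices_sets[OF hitting_open[OF U]] sm by simp
  define E where "E = (\<Inter>K. \<Union>k\<in>{K..}. hitting (U k))"
  have "(\<Union>k\<in>{K..}. hitting (U k)) \<in> sets \<mu>" for K using hm by (intro sets.countable_UN) auto
  then have Em: "E \<in> sets \<mu>" unfolding E_def by (intro sets.countable_INT) auto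
  have inv: "emeasure \<mu> {\<Lambda>\<in>space \<mu>. act g \<Lambda> \<in> E} = emeasure \<mu> E" if g: "det g = 1" for g
  proof -
    obtain h where h: "g ** h = mat 1" "h ** g = mat 1"
      using g invertible_det_nz[of g] by (auto simp: invertible_def)
    have "det g * det h = 1" using h(1) by (metis det_mul det_I)
    then have dh: "det h = 1" using g by simp
    have "{\<Lambda>\<in>space \<mu>. act g \<Lambda> \<in> E} = act h ` E"
    proof (intro set_eqI iffI)
      fix \<Lambda> assume "\<Lambda> \<in> {\<Lambda>\<in>space \<mu>. act g \<Lambda> \<in> E}"
      then show "\<Lambda> \<in> act h ` E" by (intro image_eqI[of _ _ "act g \<Lambda>"]) (simp_all add: act_mult[symmetric] h act_id)
    next
      fix \<Lambda> assume "\<Lambda> \<in> act h ` E"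
      then obtain \<Lambda>' where \<Lambda>': "\<Lambda>' \<in> E" "\<Lambda> = act h \<Lambda>'" by blast
      then have "\<Lambda>' \<in> unimodular_lattices" using sets.sets_into_space[OF Em] sp by blast
      then have "\<Lambda> \<in> space \<mu>" unfolding \<Lambda>'(2) sp by (rule act_unimodular[OF _ dh])
      then show "\<Lambda> \<in> {\<Lambda>\<in>space \<mu>. act g \<Lambda> \<in> E}" using \<Lambda>' by (simp add: act_mult[symmetric] h act_id)
    qed
    moreover have "emeasure \<mu> (act h ` E) = emeasure \<mu> E"
      using mu dh Em by (simp add: SL_invariant_prob_measure_def SL_def)
    ultimately show ?thesis by simp
  qed
  define T where "T = {(A, \<Lambda>). A \<in> near_id \<and> \<Lambda> \<in> unimodular_lattices \<and> act (unimod A) \<Lambda> \<in> E}"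
  have pos: "0 < det A" if "A \<in> near_id" for A :: "real^'n::_^'n::_" using near_id_det that by (metis less_le_trans)
  have sb: "sets ((lborel :: (real^'n::_^'n::_) measure) \<Otimes>\<^sub>M \<mu>) = sets (borel \<Otimes>\<^sub>M borel_lattices)"
    by (rule sets_pair_measure_cong) (simp_all add: sm)
  have Tm: "T \<in> sets (lborel \<Otimes>\<^sub>M \<mu>)"
    unfolding T_def by (rule limsup_hitting_measurable[OF sm U E_def])
  interpret P: pair_sigma_finite "lborel :: (real^'n::_^'n::_) measure" \<mu>
    by (intro pair_sigma_finite.intro lborel.sigma_finite_measure_axioms M.sigma_finite_measure_axioms)
  have null: "emeasure lborel ((\<lambda>A. (A, \<Lambda>)) -` T) = 0" if \<Lambda>: "\<Lambda> \<in> space \<mu>" for \<Lambda>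
  proof -
    have "\<Lambda> \<in> unimodular_lattices" using \<Lambda> unfolding sp .
    then have "\<exists>S b. (\<forall>k. S k \<in> sets lborel) \<and> (\<forall>k. {A\<in>near_id. act (unimod A) \<Lambda> \<in> hitting (U k)} \<subseteq> S k)
      \<and> (\<forall>k. emeasure lborel (S k) \<le> ennreal (b k)) \<and> (\<forall>k. 0 \<le> b k) \<and> summable b" by (rule S)
    then obtain S b where Sb0: "(\<forall>k. S k \<in> sets lborel) \<and> (\<forall>k. {A\<in>near_id. act (unimod A) \<Lambda> \<in> hitting (U k)} \<subseteq> S k)
      \<and> (\<forall>k. emeasure lborel (S k) \<le> ennreal (b k)) \<and> (\<forall>k. 0 \<le> b k) \<and> summable b" by (elim exE)
    have Sm: "\<And>k. S k \<in> sets lborel" and sub: "\<And>k. {A\<in>near_id. act (unimod A) \<Lambda> \<in> hitting (U k)} \<subseteq> S k"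
      and Sb: "\<And>k. emeasure lborel (S k) \<le> ennreal (b k)" and b: "\<And>k. 0 \<le> b k" "summable b"
      using Sb0 by blast+
    have fin: "emeasure lborel (S k) < \<infinity>" for k using order_le_less_trans[OF Sb[of k] ennreal_less_top] by simp
    have "measure lborel (S k) \<le> b k" for k
      using Sb[of k] b(1)[of k] by (simp add: measure_def enn2real_leI)
    then have "summable (\<lambda>k. measure lborel (S k))"
      by (intro summable_comparison_test[OF _ b(2)]) auto
    then have ls: "limsup S \<in> null_sets lborel" by (intro borel_cantelli_limsup1 Sm fin)
    have "(\<lambda>A. (A, \<Lambda>)) -` T \<subseteq> limsup S"
    proof
      fix A assume "A \<in> (\<lambda>A. (A, \<Lambda>)) -` T"
      then have A: "A \<in> near_id" "act (unimod A) \<Lambda> \<in> E" by (auto simp: T_def)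
      have "\<exists>k\<ge>K. A \<in> S k" for K
      proof -
        obtain k where "k \<ge> K" "act (unimod A) \<Lambda> \<in> hitting (U k)" using A(2) by (auto simp: E_def)
        then show ?thesis using sub A(1) by blast
      qed
      then show "A \<in> limsup S" by (auto simp: limsup_INF_SUP)
    qed
    then have "emeasure lborel ((\<lambda>A. (A, \<Lambda>)) -` T) \<le> emeasure lborel (limsup S)"
      by (rule emeasure_mono) (rule null_setsD2[OF ls])
    then show ?thesis using null_setsD1[OF ls] by simp
  qed
  have "emeasure (lborel \<Otimes>\<^sub>M \<mu>) T = (\<integral>\<^sup>+\<Lambda>. emeasure lborel ((\<lambda>A. (A, \<Lambda>)) -` T) \<partial>\<mu>)"
    by (rule P.emeasure_pair_measure_alt2[OF Tm])
  also have "\<dots> = (\<integral>\<^sup>+\<Lambda>. 0 \<partial>\<mu>)" by (rule nn_integral_cong) (rule null)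
  finally have "0 = emeasure (lborel \<Otimes>\<^sub>M \<mu>) T" by simp
  also have "\<dots> = (\<integral>\<^sup>+A. emeasure \<mu> (Pair A -` T) \<partial>lborel)" by (rule M.emeasure_pair_measure_alt[OF Tm])
  also have "\<dots> = (\<integral>\<^sup>+A. emeasure \<mu> E * indicator (near_id :: (real^'n::_^'n::_) set) A \<partial>lborel)"
  proof (rule nn_integral_cong)
    fix A :: "real^'n::_^'n::_"
    show "emeasure \<mu> (Pair A -` T) = emeasure \<mu> E * indicator near_id A"
    proof (cases "A \<in> near_id")
      case True
      then have "Pair A -` T = {\<Lambda>\<in>space \<mu>. act (unimod A) \<Lambda> \<in> E}" by (auto simp: T_def sp)
      then show ?thesis using inv[OF det_unimod[OF pos[OF True]]] True by simp
    next
      case False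
      then have "Pair A -` T = {}" by (auto simp: T_def)
      then show ?thesis using False by simp
    qed
  qed
  also have "\<dots> = emeasure \<mu> E * emeasure lborel (near_id :: (real^'n::_^'n::_) set)"
    by (rule nn_integral_cmult_indicator) (simp add: near_id_def)
  finally have "emeasure \<mu> E * emeasure lborel (near_id :: (real^'n::_^'n::_) set) = 0" by simp
  moreover have "emeasure lborel (near_id :: (real^'n::_^'n::_) set) \<noteq> 0"
  proof -
    have "unit_ball_vol (real DIM(real^'n::_^'n::_)) > 0" by (rule unit_ball_vol_pos) simp
    then show ?thesis unfolding near_id_def by (subst emeasure_cball) (auto simp: ennreal_eq_0_iff not_le simp del: unit_ball_vol_pos)
  qed
  ultimately have "emeasure \<mu> E = 0" by simp
  then have "E \<in> null_sets \<mu>" using Em by blast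
  then have "AE \<Lambda> in \<mu>. \<Lambda> \<notin> E" by (rule AE_not_in)
  then show ?thesis
  proof (rule AE_mp, intro AE_I2 impI)
    fix \<Lambda> assume "\<Lambda> \<notin> E"
    then show "\<forall>\<^sub>F k in sequentially. \<Lambda> \<notin> hitting (U k)" by (auto simp: E_def eventually_sequentially)
  qed
qed

section \<open>The flow, heights and the block group\<close>

lemma diag_power: "((**) (diag w) ^^ k) (mat 1) = diag (\<chi> i. (w $ i) ^ k)" for w :: "real^'n"
proof (induction k)
  case 0
  show ?case by (simp add: vec_eq_iff diag_def mat_def)
next
  case (Suc k)
  have "diag w ** diag (\<chi> i. (w $ i) ^ k) = diag (\<chi> i. (w $ i) ^ Suc k)"
    by (simp add: vec_eq_iff diag_def matrix_matrix_mult_def if_distrib[of "\<lambda>x. x * _"] if_distrib[of "\<lambda>x. _ * x"] cong: if_cong)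
  then show ?case using Suc by simp
qed

lemma flow_eq_dil: "flow z t = dil (\<lambda>i. t * z $ i)"
proof -
  have "(\<lambda>k. (1 / fact k) *\<^sub>R diag (\<chi> i. ((- t *\<^sub>R z) $ i) ^ k)) sums diag (\<chi> i. exp (- (t * z $ i)))"
    unfolding sums_def
  proof (rule vec_tendstoI, rule vec_tendstoI)
    fix i j :: 'a
    have s: "(\<lambda>k. (1 / fact k) * (if i = j then ((- t *\<^sub>R z) $ i) ^ k else 0)) sums (if i = j then exp (- (t * z $ i)) else 0)"
    proof (cases "i = j")
      case True
      have "(\<lambda>k. (- (t * z $ i)) ^ k /\<^sub>R fact k) sums exp (- (t * z $ i))" by (rule exp_converges)
      then show ?thesis using True by (simp add: field_simps)
    qed simp
    have eq: "(\<lambda>m. (\<Sum>k<m. (1 / fact k) *\<^sub>R diag (\<chi> i. ((- t *\<^sub>R z) $ i) ^ k)) $ i $ j)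
      = (\<lambda>m. \<Sum>k<m. (1 / fact k) * (if i = j then ((- t *\<^sub>R z) $ i) ^ k else 0))"
      by (intro ext) (simp add: sum_component diag_def cong: if_cong)
    have d: "diag (\<chi> i. exp (- (t * z $ i))) $ i $ j = (if i = j then exp (- (t * z $ i)) else 0)"
      by (simp add: diag_def)
    show "(\<lambda>m. (\<Sum>k<m. (1 / fact k) *\<^sub>R diag (\<chi> i. ((- t *\<^sub>R z) $ i) ^ k)) $ i $ j) \<longlonglongrightarrow> diag (\<chi> i. exp (- (t * z $ i))) $ i $ j"
      unfolding eq d using s unfolding sums_def .
  qed
  moreover have "- t *\<^sub>R diag z = diag (- t *\<^sub>R z)" by (simp add: vec_eq_iff diag_def)
  ultimately show ?thesis unfolding flow_def matrix_exp_def dil_def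
    by (simp add: diag_power sums_unique[symmetric])
qed

lemma dil_dil: "dil a *v (dil b *v v) = dil (\<lambda>i. a i + b i) *v v"
  by (simp add: vec_eq_iff dil_nth mult.assoc[symmetric] exp_add[symmetric])

lemma dil_zero: "dil (\<lambda>i. 0) *v v = v"
  by (simp add: vec_eq_iff dil_nth)

lemma norm_dil_ge:
  assumes "\<And>i. \<bar>s i\<bar> \<le> \<kappa>" shows "exp (- \<kappa>) * norm (v::real^'n) \<le> norm (dil s *v v)"
proof -
  have "v = dil (\<lambda>i. - s i) *v (dil s *v v)" by (simp add: dil_dil dil_zero)
  then have "norm v \<le> exp \<kappa> * norm (dil s *v v)"
    using norm_dil_le[of "\<lambda>i. - s i" \<kappa> "dil s *v v"] assms by simp
  then show ?thesis by (simp add: exp_minus field_simps)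
qed

text \<open>
  Linear independence passes from the images under an invertible \<open>g\<close> to the vectors.
\<close>

lemma det_mix_image:
  fixes g X w Y :: "real^'n^'n"
  assumes X: "\<And>i. i \<in> P \<Longrightarrow> X $ i = g *v w $ i" and g: "det g \<noteq> 0" and nz: "det (mix P X Y) \<noteq> 0"
  shows "\<exists>Y'. det (mix P w Y') \<noteq> 0"
proof -
  obtain h where h: "g ** h = mat 1" using g invertible_det_nz[of g] by (auto simp: invertible_def)
  define Y' where "Y' = (\<chi> i. h *v Y $ i)"
  have row: "(M ** transpose g) $ i = g *v M $ i" for M :: "real^'n^'n" and i
    by (simp add: vec_eq_iff matrix_mult_transpose_nth matrix_vector_mult_row inner_commute)
  have "mix P X Y $ i = (mix P w Y' ** transpose g) $ i" for i
    unfolding row using X by (simp add: Y'_def matrix_vector_mul_assoc h)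
  then have "mix P X Y = mix P w Y' ** transpose g" by (simp only: vec_eq_iff) simp
  then have "det (mix P X Y) = det (mix P w Y') * det (transpose g)" by (simp only: det_mul)
  then have "det (mix P w Y') \<noteq> 0" using nz by auto
  then show ?thesis by blast
qed

lemma exists_card_subset:
  assumes "k \<le> CARD('n::finite)" shows "\<exists>P :: 'n set. card P = k"
  using obtain_subset_with_card_n[OF assms] by metis

definition height_set :: "(real^'n) set \<Rightarrow> real set" where
  "height_set \<Lambda> = {1 / covol V (\<Lambda> \<inter> V) | V.
     subspace V \<and> 1 \<le> dim V \<and> dim V \<le> CARD('n) - 1 \<and> lattice_in V (\<Lambda> \<inter> V)}"

lemma height_eq: "height \<Lambda> = Sup (height_set \<Lambda>)"
  by (simp add: height_def height_set_def)

text \<open>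
  A sublattice of small covolume contains a short vector. It bounds the sets whose suprema are taken,
  uniformly over the compact group.
\<close>

lemma covol_ge_shortest:
  fixes L :: "(real^'n::{finite,wellorder}) set"
  assumes L: "lattice_in V L" and r: "0 < r" "r \<le> 1" "\<And>x. x \<in> L \<Longrightarrow> x \<noteq> 0 \<Longrightarrow> r \<le> norm x"
  shows "r ^ CARD('n) / real CARD('n) ^ CARD('n) \<le> covol V L"
proof -
  have "dim V \<le> CARD('n)" using dim_subset_UNIV[of V] by simp
  then obtain P :: "'n set" where P: "card P = dim V" using exists_card_subset by metis
  obtain F m where m: "\<forall>i\<in>P. m $ i \<in> L \<and> m $ i \<noteq> 0"
    and le: "(\<Prod>i\<in>P. norm (m $ i)) \<le> real CARD('n) ^ CARD('n) * covol V L"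
    using reduced_le_covol[OF L P] by (elim exE conjE)
  have "r ^ CARD('n) \<le> r ^ card P" using r by (intro power_decreasing) (auto simp: card_mono)
  also have "\<dots> = (\<Prod>i\<in>P. r)" by simp
  also have "\<dots> \<le> (\<Prod>i\<in>P. norm (m $ i))" using r m by (intro prod_mono) auto
  finally show ?thesis using le by (simp add: divide_le_eq mult.commute)
qed

lemma height_set_le:
  assumes c: "0 < c" and le: "\<And>V. subspace V \<Longrightarrow> lattice_in V (\<Lambda> \<inter> V) \<Longrightarrow> c \<le> covol V (\<Lambda> \<inter> V)" and x: "x \<in> height_set \<Lambda>"
  shows "x \<le> 1 / c"
proof -
  obtain V where V: "subspace V" "lattice_in V (\<Lambda> \<inter> V)" "x = 1 / covol V (\<Lambda> \<inter> V)" using x by (auto simp: height_set_def)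
  have "c \<le> covol V (\<Lambda> \<inter> V)" using le V by blast
  then show ?thesis using c V(3) by (simp add: frac_le)
qed

text \<open>
  The vector spans a line, whose intersection with the lattice has covolume at most a multiple of its length;
  hence short vectors force a large height.
\<close>

lemma height_set_line:
  fixes \<Lambda> :: "(real^'n::{finite,wellorder}) set"
  assumes L: "discrete_subgroup \<Lambda>" and v: "v \<in> \<Lambda>" "v \<noteq> 0" and N: "2 \<le> CARD('n)"
  shows "\<exists>x\<in>height_set \<Lambda>. 1 / (fact CARD('n) * norm v) \<le> x"
proof -
  define V where "V = span {v}"
  have sV: "subspace V" by (simp add: V_def)
  have dV: "dim V = 1" using v by (simp add: V_def dim_insert)
  have vV: "v \<in> V" by (simp add: V_def span_base)
  have "discrete_subgroup (\<Lambda> \<inter> V)" using L sV unfolding discrete_subgroup_def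
    by (auto simp: subspace_0 subspace_diff)
  moreover have "span (\<Lambda> \<inter> V) = V"
  proof
    show "span (\<Lambda> \<inter> V) \<subseteq> V" using sV by (intro span_minimal) auto
    show "V \<subseteq> span (\<Lambda> \<inter> V)" unfolding V_def by (rule span_mono) (use v vV V_def in auto)
  qed
  ultimately have lV: "lattice_in V (\<Lambda> \<inter> V)" by (simp add: lattice_in_iff)
  let ?i = "Min (UNIV :: 'n set)"
  let ?P = "{?i}"
  have "\<exists>F. frame ?P V F" by (rule frame_exists[OF sV]) (simp add: dV)
  then obtain F where F: "frame ?P V F" by (elim exE)
  define w :: "real^'n::_^'n::_" where "w = (\<chi> i. v)"
  have nz: "det (mix ?P w F) \<noteq> 0"
    by (rule det_mix_frame_nz) (use F in \<open>simp add: w_def V_def\<close>)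
  have pos: "0 < covol V (\<Lambda> \<inter> V)"
  proof -
    obtain r where r: "r > 0" "\<forall>x\<in>\<Lambda>. x \<noteq> 0 \<longrightarrow> r \<le> norm x" using L by (auto simp: discrete_subgroup_def)
    have "(min r 1) ^ CARD('n) / real CARD('n) ^ CARD('n) \<le> covol V (\<Lambda> \<inter> V)"
      by (rule covol_ge_shortest[OF lV]) (use r in \<open>auto simp: min_le_iff_disj\<close>)
    moreover have "0 < (min r 1) ^ CARD('n) / real CARD('n) ^ CARD('n)" using r by simp
    ultimately show ?thesis by linarith
  qed
  have "covol V (\<Lambda> \<inter> V) \<le> \<bar>det (mix ?P w F)\<bar>"
    by (rule covol_le_det[OF lV F _ nz]) (use v vV in \<open>simp add: w_def\<close>)
  also have "\<dots> \<le> fact CARD('n) * (\<Prod>i\<in>UNIV. if i = ?i then norm v else 1)"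
  proof (rule det_leibniz_bound)
    fix i j
    show "\<bar>mix ?P w F $ i $ j\<bar> \<le> (if i = ?i then norm v else 1)"
    proof (cases "i = ?i")
      case True
      then show ?thesis by (simp add: w_def component_le_norm_cart)
    next
      case False
      have "norm (F $ i) = 1" using F by (simp add: frame_def orthogonal_matrix_rows norm_eq_sqrt_inner)
      then show ?thesis using False component_le_norm_cart[of "F $ i" j] by simp
    qed
  qed
  also have "(\<Prod>i\<in>UNIV. if i = ?i then norm v else 1) = norm v" by simp
  finally have "covol V (\<Lambda> \<inter> V) \<le> fact CARD('n) * norm v" .
  then have "1 / (fact CARD('n) * norm v) \<le> 1 / covol V (\<Lambda> \<inter> V)" using pos by (intro frac_le) auto
  moreover have "1 / covol V (\<Lambda> \<inter> V) \<in> height_set \<Lambda>"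
    unfolding height_set_def using sV dV lV N by (intro CollectI exI[of _ V]) auto
  ultimately show ?thesis by blast
qed

lemma block_SO_block_orthogonal: "block_SO n \<subseteq> block_orthogonal (first_coords n)"
  unfolding block_SO_def block_orthogonal_def rotation_matrix_def by blast

lemma mat_1_block_SO: "mat 1 \<in> block_SO n"
  by (simp add: block_SO_def rotation_matrix_def orthogonal_matrix_id mat_1_nth axis_def)

lemma block_SO_orthogonal: "h \<in> block_SO n \<Longrightarrow> orthogonal_matrix h"
  by (simp add: block_SO_def rotation_matrix_def)

lemma card_first_coords:
  assumes "n \<le> CARD('n::{finite,wellorder})" shows "card (first_coords n :: 'n set) = n"
proof -
  let ?f = "\<lambda>i::'n. card {j. j < i}"
  have lt: "?f i < ?f k" if "i < k" for i k
    by (rule psubset_card_mono) (use that in auto)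
  have inj: "inj ?f" by (rule injI) (metis lt less_irrefl linorder_neqE)
  have sub: "range ?f \<subseteq> {..<CARD('n)}"
  proof
    fix x assume "x \<in> range ?f"
    then obtain i where "x = ?f i" by blast
    moreover have "?f i < card (UNIV :: 'n set)" by (rule psubset_card_mono) auto
    ultimately show "x \<in> {..<CARD('n)}" by simp
  qed
  have "range ?f = {..<CARD('n)}"
    by (rule card_subset_eq[OF _ sub]) (simp_all add: card_image[OF inj])
  have "?f ` first_coords n = {..<n}"
  proof (intro set_eqI iffI)
    fix x assume "x \<in> ?f ` first_coords n"
    then show "x \<in> {..<n}" by (auto simp: first_coords_def)
  next
    fix x assume "x \<in> {..<n}"
    then have "x < n" "x \<in> range ?f" using \<open>range ?f = {..<CARD('n)}\<close> assms by auto
    then obtain i where "x = ?f i" by blast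
    with \<open>x < n\<close> show "x \<in> ?f ` first_coords n" by (auto simp: first_coords_def)
  qed
  then have "card (?f ` first_coords n) = n" by simp
  then show ?thesis using card_image[OF inj_on_subset[OF inj subset_UNIV], of "first_coords n"] by simp
qed

lemma Min_first_coords: "1 \<le> n \<Longrightarrow> Min UNIV \<in> (first_coords n :: 'n::{finite,wellorder} set)"
proof -
  have "{j::'n. j < Min UNIV} = {}" using Min_le[of "UNIV :: 'n set"] by (auto simp: not_less simp del: Min_le)
  then have "card {j::'n. j < Min UNIV} = 0" by (simp only: card.empty)
  moreover assume "1 \<le> n"
  ultimately have "card {j::'n. j < Min UNIV} < n" by linarith
  then show "Min UNIV \<in> (first_coords n :: 'n set)" unfolding first_coords_def by (rule CollectI)
qed

text \<open>
  A reflection in the hyperplane orthogonal to \<open>a = u - norm u * e\<close>, where \<open>u\<close> is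
  the part of \<open>v\<close> in the block and \<open>e\<close> the first unit vector, moves \<open>u\<close>
  to \<open>norm u * e\<close>. If it has determinant \<open>-1\<close>, compose it with the reflection in the
  first coordinate; this changes the sign of one entry.
\<close>

lemma rotate_to_first:
  fixes v :: "real^'n::{finite,wellorder}"
  assumes n: "1 \<le> n"
  shows "\<exists>h\<in>block_SO n. (\<forall>i. i \<in> first_coords n \<longrightarrow> i \<noteq> Min UNIV \<longrightarrow> (h *v v) $ i = 0)
    \<and> (\<forall>i. i \<notin> first_coords n \<longrightarrow> (h *v v) $ i = v $ i) \<and> \<bar>(h *v v) $ Min UNIV\<bar> \<le> (\<Sum>i\<in>first_coords n. \<bar>v $ i\<bar>)"
proof -
  let ?fc = "first_coords n :: 'n set" and ?p = "Min (UNIV :: 'n set)"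
  have p: "?p \<in> ?fc" by (rule Min_first_coords[OF n])
  define u :: "real^'n::_" where "u = (\<chi> i. if i \<in> ?fc then v $ i else 0)"
  have un: "norm u \<le> (\<Sum>i\<in>?fc. \<bar>v $ i\<bar>)"
  proof -
    have "norm u \<le> (\<Sum>i\<in>UNIV. \<bar>u $ i\<bar>)" by (rule norm_le_l1_cart)
    also have "\<dots> = (\<Sum>i\<in>?fc. \<bar>u $ i\<bar>)" by (rule sum.mono_neutral_right) (auto simp: u_def)
    also have "\<dots> = (\<Sum>i\<in>?fc. \<bar>v $ i\<bar>)" by (rule sum.cong) (auto simp: u_def)
    finally show ?thesis .
  qed
  define a where "a = u - norm u *\<^sub>R axis ?p 1"
  have a0: "a $ i = 0" if "i \<notin> ?fc" for i using that p by (auto simp: a_def u_def axis_def)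
  \<comment> \<open>For \<open>a = 0\<close> division by zero makes this the identity, which is what is needed then.\<close>
  define H :: "real^'n::_^'n::_" where "H = (\<chi> i j. (if i = j then 1 else 0) - 2 / (a \<bullet> a) * a $ i * a $ j)"
  have Hv: "H *v x = x - (2 * (a \<bullet> x) / (a \<bullet> a)) *\<^sub>R a" for x
  proof -
    have "(H *v x) $ i = (x - (2 * (a \<bullet> x) / (a \<bullet> a)) *\<^sub>R a) $ i" for i
    proof -
      have "(H *v x) $ i = (\<Sum>j\<in>UNIV. (if i = j then x $ j else 0) - (2 / (a \<bullet> a) * a $ i) * (a $ j * x $ j))"
        unfolding H_def matrix_vector_mult_def by (simp, rule sum.cong) (auto simp: algebra_simps)
      also have "\<dots> = x $ i - (2 / (a \<bullet> a) * a $ i) * (a \<bullet> x)"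
      proof -
        have s1: "(\<Sum>j\<in>UNIV. if i = j then x $ j else 0) = x $ i" by simp
        have s2: "(\<Sum>j\<in>UNIV. c * (a $ j * x $ j)) = c * (a \<bullet> x)" for c
          by (simp only: sum_distrib_left inner_vec_def inner_real_def)
        show ?thesis by (simp only: sum_subtractf s1 s2)
      qed
      finally show ?thesis by (simp add: mult.commute mult.left_commute)
    qed
    then show ?thesis by (simp add: vec_eq_iff)
  qed
  have oH: "orthogonal_matrix H"
  proof -
    have Hi: "H $ i = axis i 1 - (2 / (a \<bullet> a) * a $ i) *\<^sub>R a" for i
      by (simp add: vec_eq_iff H_def axis_def)
    have ax: "axis i (1::real) $ j = (if i = j then 1 else 0)" for i j :: 'n by (simp add: axis_def)
    have "H $ i \<bullet> H $ j = (if i = j then 1 else 0)" for i j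
    proof (cases "a = 0")
      case True
      then show ?thesis by (simp add: Hi inner_axis_axis)
    next
      case False
      then have "a \<bullet> a \<noteq> 0" by simp
      then show ?thesis unfolding Hi
        by (simp add: inner_diff_left inner_diff_right inner_axis inner_axis' inner_axis_axis ax field_simps)
    qed
    then show ?thesis by (simp add: orthogonal_matrix_rows)
  qed
  have Hb: "H $ i $ j = (if i = j then 1 else 0)" if "\<not> (i \<in> ?fc \<and> j \<in> ?fc)" for i j
    using that a0 by (auto simp: H_def)
  have Hva: "H *v v = v - a"
  proof (cases "a = 0")
    case True
    then show ?thesis by (simp add: Hv)
  next
    case False
    have av: "a \<bullet> v = a \<bullet> u"
      unfolding inner_vec_def by (rule sum.cong) (auto simp: u_def a0)
    have e2: "2 * (a \<bullet> v) = a \<bullet> a"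
    proof -
      have "u \<bullet> u = norm u * norm u" by (simp add: dot_square_norm power2_eq_square)
      then show ?thesis unfolding av
        by (simp add: a_def inner_diff_left inner_diff_right inner_axis inner_axis' inner_axis_axis algebra_simps inner_commute)
    qed
    have p: "0 < a \<bullet> a" using False by simp
    have k: "2 * (a \<bullet> v) / (a \<bullet> a) = 1"
      unfolding e2 by (rule divide_self) (rule less_imp_neq[OF p, symmetric])
    show ?thesis unfolding Hv[of v] k scaleR_one ..
  qed
  have H1: "(H *v v) $ i = 0" if "i \<in> ?fc" "i \<noteq> ?p" for i using that by (simp add: Hva a_def u_def axis_def)
  have H2: "(H *v v) $ i = v $ i" if "i \<notin> ?fc" for i using that by (simp add: Hva a0)
  have H3: "(H *v v) $ ?p = norm u" using p by (simp add: Hva a_def u_def axis_def)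
  show ?thesis
  proof (cases "det H = 1")
    case True
    then have "H \<in> block_SO n" using oH Hb by (simp add: block_SO_def rotation_matrix_def)
    then show ?thesis using H1 H2 H3 un by (intro bexI[of _ H]) auto
  next
    case False
    then have dH: "det H = - 1" using det_orthogonal_matrix[OF oH] by auto
    define R :: "real^'n::_^'n::_" where "R = (\<chi> i j. if i = j then (if i = ?p then - 1 else 1) else 0)"
    have Rn: "(R *v x) $ i = (if i = ?p then - x $ i else x $ i)" for x i
      by (simp add: R_def matrix_vector_mult_def if_distrib[of "\<lambda>y. y * _"] cong: if_cong)
    have dR: "det R = - 1"
    proof -
      have "det R = (\<Prod>i\<in>UNIV. R $ i $ i)" by (rule det_diagonal) (simp add: R_def)
      also have "\<dots> = (\<Prod>i\<in>UNIV. if i = ?p then - 1 else 1)" by (simp add: R_def)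
      also have "\<dots> = - 1" by simp
      finally show ?thesis .
    qed
    have oR: "orthogonal_matrix R"
    proof -
      have "R $ i = (if i = ?p then - 1 else 1) *\<^sub>R axis i 1" for i by (auto simp: R_def vec_eq_iff axis_def)
      then show ?thesis by (auto simp: orthogonal_matrix_rows inner_axis_axis)
    qed
    have RH: "(R ** H) $ i $ j = (if i = ?p then - H $ i $ j else H $ i $ j)" for i j
      by (simp add: R_def matrix_matrix_mult_def if_distrib[of "\<lambda>y. y * _"] cong: if_cong)
    have "R ** H \<in> block_SO n"
      unfolding block_SO_def rotation_matrix_def
    proof (intro CollectI conjI allI impI)
      show "orthogonal_matrix (R ** H)" by (rule orthogonal_matrix_mul[OF oR oH])
      show "det (R ** H) = 1" by (simp add: det_mul dR dH)
      fix i j assume ij: "\<not> (i \<in> ?fc \<and> j \<in> ?fc)"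
      show "(R ** H) $ i $ j = (if i = j then 1 else 0)"
        using Hb[OF ij] ij p unfolding RH by auto
    qed
    moreover have "((R ** H) *v v) $ i = (if i = ?p then - (H *v v) $ i else (H *v v) $ i)" for i
      by (simp add: matrix_vector_mul_assoc[symmetric] Rn)
    ultimately show ?thesis using H1 H2 H3 un p by (intro bexI[of _ "R ** H"]) auto
  qed
qed

section \<open>The lower bound\<close>

lemma det_dil_nz:
  fixes h :: "real^'n^'n"
  assumes "orthogonal_matrix h" shows "det (dil s ** h) \<noteq> 0"
proof -
  have "det (dil s :: real^'n^'n) = (\<Prod>i\<in>UNIV. exp (- s i))"
    unfolding dil_def diag_def by (subst det_diagonal) auto
  moreover have "det h \<noteq> 0" using det_orthogonal_matrix[OF assms] by auto
  ultimately show ?thesis by (simp add: det_mul)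
qed

text \<open>
  The bound does not depend on \<open>h\<close>, hence the supremum in \<open>max_height\<close> is over a
  bounded set.
\<close>

lemma orbit_covol_lower:
  fixes \<Lambda> :: "(real^'n::{finite,wellorder}) set"
  assumes L: "discrete_subgroup \<Lambda>"
  shows "\<exists>c>0. \<forall>h V. orthogonal_matrix h \<longrightarrow> lattice_in V (act (dil s ** h) \<Lambda> \<inter> V) \<longrightarrow> c \<le> covol V (act (dil s ** h) \<Lambda> \<inter> V)"
proof -
  obtain r where r: "r > 0" "\<forall>x\<in>\<Lambda>. x \<noteq> 0 \<longrightarrow> r \<le> norm x" using L by (auto simp: discrete_subgroup_def)
  define \<kappa> where "\<kappa> = (\<Sum>i\<in>UNIV. \<bar>s i\<bar>)"
  have kap: "\<bar>s i\<bar> \<le> \<kappa>" for i unfolding \<kappa>_def by (rule member_le_sum) auto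
  define q where "q = min (exp (- \<kappa>) * r) 1"
  have q: "0 < q" "q \<le> 1" using r by (auto simp: q_def)
  show ?thesis
  proof (intro exI[of _ "q ^ CARD('n) / real CARD('n) ^ CARD('n)"] conjI allI impI)
    show "0 < q ^ CARD('n) / real CARD('n) ^ CARD('n)" using q by simp
    fix h :: "real^'n::_^'n::_" and V
    assume h: "orthogonal_matrix h" and V: "lattice_in V (act (dil s ** h) \<Lambda> \<inter> V)"
    show "q ^ CARD('n) / real CARD('n) ^ CARD('n) \<le> covol V (act (dil s ** h) \<Lambda> \<inter> V)"
    proof (rule covol_ge_shortest[OF V q])
      fix x assume x: "x \<in> act (dil s ** h) \<Lambda> \<inter> V" "x \<noteq> 0"
      then obtain v where v: "v \<in> \<Lambda>" "x = (dil s ** h) *v v" by (auto simp: act_def)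
      then have "v \<noteq> 0" using x by auto
      then have "r \<le> norm v" using r v by blast
      have "q \<le> exp (- \<kappa>) * r" by (simp add: q_def)
      also have "\<dots> \<le> exp (- \<kappa>) * norm (h *v v)" using \<open>r \<le> norm v\<close> by (simp add: orthogonal_matrix_norm[OF h])
      also have "\<dots> \<le> norm (dil s *v (h *v v))" by (rule norm_dil_ge[OF kap])
      finally show "q \<le> norm x" by (simp add: v matrix_vector_mul_assoc)
    qed
  qed
qed

lemma max_height_eq: "max_height n z t \<Lambda> = (SUP h\<in>block_SO n. Sup (height_set (act (dil (\<lambda>i. t * z $ i) ** h) \<Lambda>)))"
  by (simp add: max_height_def height_eq flow_eq_dil)

context
  fixes \<Lambda> :: "(real^'n::{finite,wellorder}) set" and z :: "real^'n::_" and t :: real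
  assumes L: "discrete_subgroup \<Lambda>" and N: "2 \<le> CARD('n)" and nonzero: "\<exists>v\<in>\<Lambda>. v \<noteq> 0"
begin

lemma orbit_height_nonempty:
  fixes h :: "real^'n::_^'n::_"
  assumes h: "orthogonal_matrix h"
  shows "height_set (act (dil s ** h) \<Lambda>) \<noteq> {}"
proof -
  obtain v where v: "v \<in> \<Lambda>" "v \<noteq> 0" using nonzero by blast
  have nz: "det (dil s ** h) \<noteq> 0" by (rule det_dil_nz[OF h])
  then have "(dil s ** h) *v v \<noteq> 0" using det_nz_kernel v by blast
  moreover have "(dil s ** h) *v v \<in> act (dil s ** h) \<Lambda>" using v by (auto simp: act_def)
  ultimately show ?thesis using height_set_line[OF discrete_subgroup_act[OF L nz] _ _ N] by blast
qed

lemma max_height_le: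
  assumes c: "0 < c" and le: "\<And>h V. h \<in> block_SO n \<Longrightarrow> subspace V \<Longrightarrow> lattice_in V (act (dil (\<lambda>i. t * z $ i) ** h) \<Lambda> \<inter> V) \<Longrightarrow>
    c \<le> covol V (act (dil (\<lambda>i. t * z $ i) ** h) \<Lambda> \<inter> V)"
  shows "max_height n z t \<Lambda> \<le> 1 / c"
  unfolding max_height_eq
proof (rule cSUP_least)
  show "block_SO n \<noteq> {}" using mat_1_block_SO by blast
  fix h :: "real^'n::_^'n::_" assume h: "h \<in> block_SO n"
  show "Sup (height_set (act (dil (\<lambda>i. t * z $ i) ** h) \<Lambda>)) \<le> 1 / c"
  proof (rule cSup_least[OF orbit_height_nonempty[OF block_SO_orthogonal[OF h]]])
    fix x assume "x \<in> height_set (act (dil (\<lambda>i. t * z $ i) ** h) \<Lambda>)"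
    moreover have "c \<le> covol V (act (dil (\<lambda>i. t * z $ i) ** h) \<Lambda> \<inter> V)"
      if "subspace V" "lattice_in V (act (dil (\<lambda>i. t * z $ i) ** h) \<Lambda> \<inter> V)" for V by (rule le[OF h that])
    ultimately show "x \<le> 1 / c" by (intro height_set_le[OF c])
  qed
qed

lemma max_height_ge:
  assumes h: "h \<in> block_SO n" and x: "x \<in> height_set (act (dil (\<lambda>i. t * z $ i) ** h) \<Lambda>)"
  shows "x \<le> max_height n z t \<Lambda>"
proof -
  let ?s = "\<lambda>i. t * z $ i"
  obtain c where c: "c > 0" "\<forall>h V. orthogonal_matrix h \<longrightarrow> lattice_in V (act (dil ?s ** h) \<Lambda> \<inter> V) \<longrightarrow> c \<le> covol V (act (dil ?s ** h) \<Lambda> \<inter> V)"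
    using orbit_covol_lower[OF L, of ?s] by (elim exE conjE)
  have ub: "y \<le> 1 / c" if "k \<in> block_SO n" "y \<in> height_set (act (dil ?s ** k) \<Lambda>)" for k :: "real^'n::_^'n::_" and y
    by (rule height_set_le[OF c(1) _ that(2)]) (use c(2) block_SO_orthogonal[OF that(1)] in blast)
  have "x \<le> Sup (height_set (act (dil ?s ** h) \<Lambda>))"
    by (rule cSup_upper[OF x]) (rule bdd_aboveI[of _ "1 / c"], rule ub[OF h])
  also have "\<dots> \<le> max_height n z t \<Lambda>"
    unfolding max_height_eq
  proof (rule cSUP_upper[OF h], rule bdd_aboveI2)
    fix k :: "real^'n::_^'n::_" assume k: "k \<in> block_SO n"
    show "Sup (height_set (act (dil ?s ** k) \<Lambda>)) \<le> 1 / c"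
      by (rule cSup_least[OF orbit_height_nonempty[OF block_SO_orthogonal[OF k]]]) (rule ub[OF k])
  qed
  finally show ?thesis .
qed

end

lemma unimodular_facts:
  assumes "\<Lambda> \<in> unimodular_lattices"
  shows "discrete_subgroup \<Lambda>" "\<exists>v\<in>\<Lambda>. v \<noteq> 0"
proof -
  have L: "discrete_subgroup \<Lambda>" "span \<Lambda> = UNIV" using assms by (auto simp: unimodular_lattices_def lattice_in_iff)
  show "discrete_subgroup \<Lambda>" by (rule L)
  show "\<exists>v\<in>\<Lambda>. v \<noteq> 0"
  proof (rule ccontr)
    assume "\<not> ?thesis"
    then have "\<Lambda> \<subseteq> {0}" by auto
    then have "span \<Lambda> \<subseteq> {0}" by (metis span_mono span_0 span_insert_0 span_empty)
    then have "(UNIV :: (real^'a) set) \<subseteq> {0}" using L by simp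
    then have "axis undefined 1 = (0 :: real^'a)" by blast
    then show False by (simp add: axis_eq_0_iff)
  qed
qed

text \<open>
  With \<open>R = rho n z / N\<close>, Minkowski's theorem gives a nonzero vector with entries at most
  \<open>2 * exp (t * (z $ 1 - R))\<close> in the block and at most \<open>2 * exp (t * (z $ i - R))\<close>
  outside. Rotate its block part to the first axis, which is contracted most, by \<open>exp (- t * z $
  1)\<close>. The flow then makes the vector as short as \<open>exp (- t * R)\<close>.
\<close>

lemma max_height_lower:
  fixes \<Lambda> :: "(real^'n::{finite,wellorder}) set" and z :: "real^'n::_"
  assumes \<Lambda>: "\<Lambda> \<in> unimodular_lattices" and N: "2 \<le> CARD('n)" and n: "1 \<le> n" "n \<le> CARD('n)" and z: "(\<Sum>i\<in>UNIV. z $ i) = 0"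
  shows "\<exists>c>0. \<forall>t. c * exp (t * (rho n z / CARD('n))) \<le> max_height n z t \<Lambda>"
proof -
  note L = unimodular_facts[OF \<Lambda>]
  let ?N = "real CARD('n)" and ?fc = "first_coords n :: 'n set" and ?p = "Min (UNIV :: 'n set)"
  define R where "R = rho n z / ?N"
  have "1 / (fact CARD('n) * (2 * ?N * ?N)) * exp (t * R) \<le> max_height n z t \<Lambda>" for t
  proof -
    \<comment> \<open>The exponents sum to zero, so the factor 2 alone makes the product exceed one.\<close>
    define b where "b i = 2 * exp (t * ((if i \<in> ?fc then z $ ?p else z $ i) - R))" for i
    have "(\<Prod>i\<in>UNIV. b i) = (\<Prod>i\<in>(UNIV :: 'n set). 2) * exp (\<Sum>i\<in>UNIV. t * ((if i \<in> ?fc then z $ ?p else z $ i) - R))"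
      by (simp only: b_def prod.distrib exp_sum[OF finite])
    also have "(\<Sum>i\<in>UNIV. t * ((if i \<in> ?fc then z $ ?p else z $ i) - R)) = t * ((\<Sum>i\<in>UNIV. (if i \<in> ?fc then z $ ?p else z $ i)) - ?N * R)"
      by (simp add: sum_distrib_left[symmetric] sum_subtractf)
    also have "(\<Sum>i\<in>UNIV. (if i \<in> ?fc then z $ ?p else z $ i)) = rho n z"
    proof -
      have "(\<Sum>i\<in>UNIV. (if i \<in> ?fc then z $ ?p else z $ i)) = (\<Sum>i\<in>UNIV. z $ i + (if i \<in> ?fc then z $ ?p - z $ i else 0))"
        by (rule sum.cong) auto
      also have "\<dots> = (\<Sum>i\<in>UNIV. if i \<in> ?fc then z $ ?p - z $ i else 0)" by (simp add: sum.distrib z)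
      also have "\<dots> = (\<Sum>i\<in>?fc. z $ ?p - z $ i)" by (simp add: sum.If_cases)
      also have "\<dots> = rho n z" by (simp add: rho_def sum_subtractf card_first_coords[OF n(2)])
      finally show ?thesis .
    qed
    also have "rho n z - ?N * R = 0" by (simp add: R_def)
    finally have pb: "(\<Prod>i\<in>UNIV. b i) = 2 ^ CARD('n)" by simp
    have "1 < (\<Prod>i\<in>UNIV. b i)" unfolding pb by (rule one_less_power) auto
    then obtain v where v: "v \<in> \<Lambda>" "v \<noteq> 0" "\<forall>i. \<bar>v $ i\<bar> < b i"
      using minkowski[OF \<Lambda>, of b] by (auto simp: b_def)
    obtain h where h: "h \<in> block_SO n" and h1: "\<forall>i. i \<in> ?fc \<longrightarrow> i \<noteq> ?p \<longrightarrow> (h *v v) $ i = 0"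
      and h2: "\<forall>i. i \<notin> ?fc \<longrightarrow> (h *v v) $ i = v $ i" and h3: "\<bar>(h *v v) $ ?p\<bar> \<le> (\<Sum>i\<in>?fc. \<bar>v $ i\<bar>)"
      using rotate_to_first[OF n(1), of v] by (elim bexE conjE)
    let ?s = "\<lambda>i. t * z $ i"
    let ?y = "(dil ?s ** h) *v v"
    have oh: "orthogonal_matrix h" by (rule block_SO_orthogonal[OF h])
    have nz: "det (dil ?s ** h) \<noteq> 0" by (rule det_dil_nz[OF oh])
    have y0: "?y \<noteq> 0" using det_nz_kernel nz v(2) by blast
    have yL: "?y \<in> act (dil ?s ** h) \<Lambda>" using v by (auto simp: act_def)
    have N1: "1 \<le> ?N" by (simp add: Suc_leI)
    have comp: "\<bar>?y $ i\<bar> \<le> 2 * ?N * exp (- (t * R))" for i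
    proof -
      have y: "?y $ i = exp (- (t * z $ i)) * (h *v v) $ i" by (simp add: matrix_vector_mul_assoc[symmetric] dil_nth)
      consider "i = ?p" | "i \<in> ?fc" "i \<noteq> ?p" | "i \<notin> ?fc" by blast
      then show ?thesis
      proof cases
        case 1
        have "(\<Sum>i\<in>?fc. \<bar>v $ i\<bar>) \<le> (\<Sum>i\<in>?fc. 2 * exp (t * (z $ ?p - R)))"
        proof (rule sum_mono)
          fix i assume "i \<in> ?fc"
          then show "\<bar>v $ i\<bar> \<le> 2 * exp (t * (z $ ?p - R))" using v(3)[rule_format, of i] by (simp add: b_def)
        qed
        also have "\<dots> \<le> ?N * (2 * exp (t * (z $ ?p - R)))"
        proof -
          have "real n \<le> ?N" using n by simp
          then show ?thesis by (simp add: card_first_coords[OF n(2)] mult_right_mono)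
        qed
        finally have "\<bar>(h *v v) $ ?p\<bar> \<le> ?N * (2 * exp (t * (z $ ?p - R)))" using h3 by linarith
        then have "\<bar>?y $ i\<bar> \<le> exp (- (t * z $ ?p)) * (?N * (2 * exp (t * (z $ ?p - R))))"
          unfolding y abs_mult unfolding 1 by (simp only: abs_exp_cancel) (intro mult_left_mono, simp_all)
        also have "\<dots> = 2 * ?N * (exp (- (t * z $ ?p)) * exp (t * (z $ ?p - R)))" by simp
        also have "exp (- (t * z $ ?p)) * exp (t * (z $ ?p - R)) = exp (- (t * R))"
          by (simp add: exp_add[symmetric] algebra_simps)
        finally show ?thesis .
      next
        case 2
        then show ?thesis unfolding y using h1 by simp
      next
        case 3
        have "\<bar>?y $ i\<bar> \<le> exp (- (t * z $ i)) * (2 * exp (t * (z $ i - R)))"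
          unfolding y using h2 3 v(3)[rule_format, of i] by (simp add: abs_mult b_def mult_left_mono)
        also have "\<dots> = 2 * (exp (- (t * z $ i)) * exp (t * (z $ i - R)))" by simp
        also have "exp (- (t * z $ i)) * exp (t * (z $ i - R)) = exp (- (t * R))"
          by (simp add: exp_add[symmetric] algebra_simps)
        also have "2 * exp (- (t * R)) \<le> 2 * ?N * exp (- (t * R))" using N1 by simp
        finally show ?thesis .
      qed
    qed
    have "norm ?y \<le> (\<Sum>i\<in>UNIV. \<bar>?y $ i\<bar>)" by (rule norm_le_l1_cart)
    also have "\<dots> \<le> (\<Sum>i\<in>(UNIV::'n set). 2 * ?N * exp (- (t * R)))" by (rule sum_mono) (rule comp)
    finally have ny: "norm ?y \<le> 2 * ?N * ?N * exp (- (t * R))" by simp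
    obtain x where x: "x \<in> height_set (act (dil ?s ** h) \<Lambda>)" "1 / (fact CARD('n) * norm ?y) \<le> x"
      using height_set_line[OF discrete_subgroup_act[OF L(1) nz] yL y0 N] by blast
    have "1 / (fact CARD('n) * (2 * ?N * ?N)) * exp (t * R) = 1 / (fact CARD('n) * (2 * ?N * ?N * exp (- (t * R))))"
      by (simp add: exp_minus field_simps)
    also have "\<dots> \<le> 1 / (fact CARD('n) * norm ?y)"
      using ny y0 by (intro divide_left_mono mult_left_mono mult_pos_pos) auto
    also have "\<dots> \<le> x" by (rule x)
    also have "x \<le> max_height n z t \<Lambda>" by (rule max_height_ge[OF L(1) N L(2) h x(1)])
    finally show ?thesis .
  qed
  moreover have "0 < 1 / (fact CARD('n) * (2 * ?N * ?N))" by simp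
  ultimately show ?thesis unfolding R_def by blast
qed

section \<open>Open sets that detect short systems\<close>

text \<open>
  The vectors of a short system, as a condition on a matrix with rows in the lattice; being a union over
  \<open>P\<close>, \<open>h\<close> and \<open>Y\<close> of strict inequalities it is open.
\<close>

definition short_open :: "nat \<Rightarrow> ('n \<Rightarrow> real) \<Rightarrow> real \<Rightarrow> (real^'n::{finite,wellorder}^'n::_) set" where
  "short_open n s \<tau> = {X. \<exists>P. \<exists>h\<in>block_SO n. \<exists>Y. det (mix P X Y) \<noteq> 0 \<and> (\<Prod>i\<in>P. norm ((dil s ** h) *v X $ i)) < \<tau>}"

lemma open_short_open:
  fixes s :: "'n::{finite,wellorder} \<Rightarrow> real"
  shows "open (short_open n s \<tau>)"
proof -
  have eq: "short_open n s \<tau> = (\<Union>P. \<Union>h\<in>block_SO n. \<Union>Y. {X. det (mix P X Y) \<noteq> 0} \<inter> {X. (\<Prod>i\<in>P. norm ((dil s ** h) *v X $ i)) < \<tau>})"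
    unfolding short_open_def by blast
  have "open {X. det (mix P X Y) \<noteq> 0}" for P and Y :: "real^'n::_^'n::_"
  proof -
    have e: "(\<lambda>X. mix P X Y) = (\<lambda>X. \<chi> i j. if i \<in> P then X $ i $ j else Y $ i $ j)"
      by (auto simp: fun_eq_iff vec_eq_iff)
    have "continuous_on UNIV (\<lambda>X. mix P X Y)" unfolding e
    proof (intro continuous_on_vec_lambda)
      fix i j show "continuous_on UNIV (\<lambda>X. if i \<in> P then X $ i $ j else Y $ i $ j)"
        by (cases "i \<in> P") (auto intro!: continuous_intros)
    qed
    then have "continuous_on UNIV (\<lambda>X. det (mix P X Y))"
      by (rule continuous_on_compose2[OF continuous_on_det _ subset_UNIV])
    then show ?thesis by (intro open_Collect_neq continuous_on_const)
  qed
  moreover have "open {X. (\<Prod>i\<in>P. norm ((dil s ** h) *v X $ i)) < \<tau>}" for P :: "'n set" and h :: "real^'n::_^'n::_"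
  proof -
    have "continuous_on UNIV (\<lambda>X::real^'n::_^'n::_. (dil s ** h) *v X $ i)" for i
      by (rule continuous_on_compose2[OF linear_continuous_on[OF linear_conv_bounded_linear[THEN iffD1, OF matrix_vector_mul_linear]]])
         (auto intro: continuous_intros)
    then show ?thesis by (intro open_Collect_less continuous_on_prod continuous_on_norm continuous_on_const)
  qed
  ultimately show ?thesis unfolding eq by (intro open_UN ballI open_Int) auto
qed

lemma hitting_short_open:
  assumes \<Lambda>: "\<Lambda> \<in> unimodular_lattices"
  shows "\<Lambda> \<in> hitting (short_open n s \<tau>) \<longleftrightarrow> (\<exists>P. \<exists>h\<in>block_SO n. short_system P (dil s ** h) \<Lambda> \<tau>)"
proof
  assume "\<Lambda> \<in> hitting (short_open n s \<tau>)"
  then show "\<exists>P. \<exists>h\<in>block_SO n. short_system P (dil s ** h) \<Lambda> \<tau>"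
    unfolding hitting_def short_open_def short_system_def by blast
next
  assume "\<exists>P. \<exists>h\<in>block_SO n. short_system P (dil s ** h) \<Lambda> \<tau>"
  then obtain P h w Y where h: "h \<in> block_SO n" and w: "\<forall>i\<in>P. w $ i \<in> \<Lambda>" and nz: "det (mix P w Y) \<noteq> 0"
    and pr: "(\<Prod>i\<in>P. norm ((dil s ** h) *v w $ i)) < \<tau>" unfolding short_system_def by blast
  define X where "X = mix P w 0"
  have "mix P X Y = mix P w Y" by (simp add: X_def vec_eq_iff)
  moreover have "(\<Prod>i\<in>P. norm ((dil s ** h) *v X $ i)) = (\<Prod>i\<in>P. norm ((dil s ** h) *v w $ i))"
    by (rule prod.cong) (auto simp: X_def)
  ultimately have nz': "det (mix P X Y) \<noteq> 0" and pr': "(\<Prod>i\<in>P. norm ((dil s ** h) *v X $ i)) < \<tau>" using nz pr by simp_all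
  have "X \<in> short_open n s \<tau>" unfolding short_open_def
    by (intro CollectI exI[of _ P] bexI[OF _ h] exI[of _ Y] conjI nz' pr')
  moreover have "\<forall>i. X $ i \<in> \<Lambda>" using w discrete_subgroup_0[OF unimodular_facts(1)[OF \<Lambda>]] by (simp add: X_def)
  ultimately show "\<Lambda> \<in> hitting (short_open n s \<tau>)" using \<Lambda> unfolding hitting_def by blast
qed

text \<open>
  Normalizing the determinant rescales the \<open>card P\<close> vectors by a factor that is bounded on
  \<open>near_id\<close>.
\<close>

lemma short_system_unimod:
  fixes A h :: "real^'n^'n"
  assumes A: "A \<in> near_id" and sh: "short_system P (dil s ** h) (act (unimod A) \<Lambda>) \<tau>" and tau: "0 < \<tau>"
  shows "short_system P (dil s ** h ** A) \<Lambda> (fact CARD('n) * 2 ^ CARD('n) * \<tau>)"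
proof -
  let ?N = "CARD('n)"
  obtain X Y where X: "\<forall>i\<in>P. X $ i \<in> act (unimod A) \<Lambda>" and nz: "det (mix P X Y) \<noteq> 0"
    and pr: "(\<Prod>i\<in>P. norm ((dil s ** h) *v X $ i)) < \<tau>" using sh unfolding short_system_def by blast
  obtain c0 where "c0 > 0" "\<forall>A\<in>near_id. c0 \<le> det (A :: real^'n^'n)" using near_id_det by (elim exE conjE)
  then have dA: "0 < det A" using A by force
  define D where "D = fact ?N * (2::real) ^ ?N"
  have dD: "det A \<le> D"
  proof -
    have "\<bar>A $ i $ j\<bar> \<le> 2" for i j
    proof -
      have "A $ i $ j = (A *v axis j 1) $ i" by (simp add: matrix_vector_mult_row inner_axis)
      then have "\<bar>A $ i $ j\<bar> \<le> norm (A *v axis j 1)" by (simp only: component_le_norm_cart)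
      also have "\<dots> \<le> 2" using near_id_bounds(1)[OF A, of "axis j 1"] by simp
      finally show ?thesis .
    qed
    then have "\<bar>det A\<bar> \<le> fact ?N * (\<Prod>i\<in>(UNIV :: 'n set). 2)" by (rule det_leibniz_bound)
    then show ?thesis by (simp add: D_def)
  qed
  have D1: "1 \<le> D"
  proof -
    have "1 * 1 \<le> fact ?N * (2::real) ^ ?N" by (intro mult_mono) auto
    then show ?thesis by (simp add: D_def)
  qed
  define c where "c = det A powr (- 1 / real ?N)"
  have c: "0 < c" using dA by (simp add: c_def)
  have "\<forall>i. \<exists>v. i \<in> P \<longrightarrow> v \<in> \<Lambda> \<and> X $ i = unimod A *v v" using X by (auto simp: act_def)
  then obtain f where f: "\<And>i. i \<in> P \<Longrightarrow> f i \<in> \<Lambda>" "\<And>i. i \<in> P \<Longrightarrow> X $ i = unimod A *v f i" by metis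
  define w where "w = (\<chi> i. f i)"
  have "det (unimod A) \<noteq> 0" using det_unimod[OF dA] by simp
  then obtain Y' where Y': "det (mix P w Y') \<noteq> 0"
    using det_mix_image[of P X "unimod A" w Y] f nz by (auto simp: w_def)
  have X2: "(dil s ** h) *v X $ i = c *\<^sub>R ((dil s ** h ** A) *v w $ i)" if "i \<in> P" for i
    using f(2)[OF that] by (simp add: w_def unimod_def c_def scaleR_matrix_vector_assoc[symmetric] matrix_vector_mult_scaleR matrix_vector_mul_assoc)
  have "(\<Prod>i\<in>P. norm ((dil s ** h) *v X $ i)) = (\<Prod>i\<in>P. c * norm ((dil s ** h ** A) *v w $ i))"
    by (rule prod.cong) (use X2 c in auto)
  also have "\<dots> = c ^ card P * (\<Prod>i\<in>P. norm ((dil s ** h ** A) *v w $ i))" by (simp add: prod.distrib)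
  finally have lt: "c ^ card P * (\<Prod>i\<in>P. norm ((dil s ** h ** A) *v w $ i)) < \<tau>" using pr by simp
  have cD: "1 \<le> D * c ^ card P"
  proof -
    have "c ^ card P = det A powr (- (real (card P) / real ?N))"
      using dA by (simp add: c_def powr_powr powr_realpow[symmetric])
    also have "\<dots> \<ge> D powr (- (real (card P) / real ?N))"
      using dA dD by (intro powr_mono2') auto
    also have "D powr (- (real (card P) / real ?N)) \<ge> D powr (- 1)"
      using D1 by (intro powr_mono) (auto simp: divide_le_eq card_mono)
    finally have "D powr (- 1) \<le> c ^ card P" by simp
    then have "D * D powr (- 1) \<le> D * c ^ card P" using D1 by (intro mult_left_mono) auto
    then show ?thesis using D1 by (simp add: powr_minus)
  qed
  have "(\<Prod>i\<in>P. norm ((dil s ** h ** A) *v w $ i)) \<le> D * c ^ card P * (\<Prod>i\<in>P. norm ((dil s ** h ** A) *v w $ i))"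
    using mult_right_mono[OF cD, of "\<Prod>i\<in>P. norm ((dil s ** h ** A) *v w $ i)"] by (simp add: prod_nonneg)
  also have "\<dots> = D * (c ^ card P * (\<Prod>i\<in>P. norm ((dil s ** h ** A) *v w $ i)))" by simp
  also have "\<dots> < D * \<tau>" using lt D1 by (intro mult_strict_left_mono) auto
  finally show ?thesis unfolding short_system_def D_def[symmetric]
    using f(1) Y' by (intro exI[of _ w] exI[of _ Y'] conjI) (auto simp: w_def)
qed

section \<open>The upper bound\<close>

lemma summable_poly_exp:
  fixes a c :: real
  assumes a: "0 \<le> a" and c: "0 < c"
  shows "summable (\<lambda>k::nat. (1 + real k * a) ^ m * exp (- (real k * c)))"
proof (cases "m = 0")
  case True
  have "summable (\<lambda>k. exp (- c) ^ k)" using c by (intro summable_geometric) simp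
  then show ?thesis using True by (simp add: exp_of_nat_mult[symmetric])
next
  case False
  \<comment> \<open>Chosen so that \<open>exp (d * (1 + k * a))\<close> uses up at most half of the decay \<open>exp (- k * c)\<close>.\<close>
  define d where "d = c / (2 * (a + 1))"
  have d: "0 < d" using a c by (simp add: d_def)
  have da: "d * a \<le> c / 2"
  proof -
    have "d * a \<le> d * (a + 1)" using d by simp
    also have "\<dots> = c / 2" using a by (simp add: d_def divide_simps)
    finally show ?thesis .
  qed
  define K where "K = (real m / d) ^ m * exp d"
  show ?thesis
  proof (rule summable_comparison_test')
    have "summable (\<lambda>k. exp (- (c / 2)) ^ k)" using c by (intro summable_geometric) simp
    then show "summable (\<lambda>k. K * exp (- (c / 2)) ^ k)" by (rule summable_mult)
    fix k :: nat
    define y where "y = 1 + real k * a"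
    have y: "0 \<le> y" using a by (simp add: y_def)
    have "d * y / real m \<le> exp (d * y / real m)" using exp_ge_add_one_self[of "d * y / real m"] by linarith
    then have "(d * y / real m) ^ m \<le> exp (d * y / real m) ^ m" using d y by (intro power_mono) auto
    also have "\<dots> = exp (d * y)" using False by (simp add: exp_of_nat_mult[symmetric])
    finally have "(real m / d) ^ m * (d * y / real m) ^ m \<le> (real m / d) ^ m * exp (d * y)"
      using d by (intro mult_left_mono) auto
    moreover have "(real m / d) ^ m * (d * y / real m) ^ m = y ^ m"
      using d False by (simp add: power_mult_distrib[symmetric])
    ultimately have "y ^ m \<le> (real m / d) ^ m * exp (d * y)" by simp
    then have "y ^ m * exp (- (real k * c)) \<le> (real m / d) ^ m * exp (d * y) * exp (- (real k * c))"
      by (intro mult_right_mono) auto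
    also have "\<dots> = (real m / d) ^ m * exp (d * y - real k * c)" by (simp add: exp_diff exp_minus divide_inverse)
    also have "\<dots> \<le> (real m / d) ^ m * exp (d + real k * (- (c / 2)))"
    proof -
      have "d * y = d + real k * (d * a)" by (simp add: y_def algebra_simps)
      also have "\<dots> \<le> d + real k * (c / 2)" by (intro add_left_mono mult_left_mono da) simp
      finally show ?thesis using d by (intro mult_left_mono) (auto simp: algebra_simps)
    qed
    also have "\<dots> = K * exp (- (c / 2)) ^ k" by (simp only: K_def exp_add exp_of_nat_mult mult.assoc)
    finally show "norm (y ^ m * exp (- (real k * c))) \<le> K * exp (- (c / 2)) ^ k" using y by (simp add: abs_mult)
  qed
qed

lemma spread_delta:
  fixes z :: "real^'n::{finite,wellorder}"
  assumes mono: "\<And>i j. i \<le> j \<Longrightarrow> z $ j \<le> z $ i" and t: "0 \<le> t"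
  shows "spread (first_coords n) (\<lambda>i. t * z $ i) = t * delta n z"
  unfolding spread_def delta_def sum_distrib_left
proof (rule sum.cong[OF refl], clarify)
  fix i j :: 'n assume "i < j"
  then have "0 \<le> t * (z $ i - z $ j)" using mono[of i j] t by simp
  then show "\<bar>t * z $ i - t * z $ j\<bar> = t * (z $ i - z $ j)" by (simp add: right_diff_distrib)
qed

lemma delta_nonneg:
  fixes z :: "real^'n::{finite,wellorder}"
  assumes mono: "\<And>i j. i \<le> j \<Longrightarrow> z $ j \<le> z $ i"
  shows "0 \<le> delta n z"
  unfolding delta_def by (rule sum_nonneg) (use mono in \<open>auto simp: less_imp_le\<close>)

text \<open>
  At the size \<open>exp (- k * (delta n z / N + \<epsilon>))\<close> the bound of
  \<open>short_system_measure\<close> is \<open>exp (- k * N * \<epsilon>)\<close> times a polynomial in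
  \<open>k\<close>, which is summable.
\<close>

lemma AE_eventually_no_short_system:
  fixes \<mu> :: "(real^'n::{finite,wellorder}) set measure" and z :: "real^'n::_"
  assumes mu: "SL_invariant_prob_measure \<mu>" and mono: "\<And>i j. i \<le> j \<Longrightarrow> z $ j \<le> z $ i"
    and z: "(\<Sum>i\<in>UNIV. z $ i) = 0" and e: "0 < \<epsilon>"
  shows "AE \<Lambda> in \<mu>. \<forall>\<^sub>F k in sequentially.
    \<Lambda> \<notin> hitting (short_open n (\<lambda>i. real k * z $ i) (exp (- (real k * (delta n z / CARD('n) + \<epsilon>)))))"
proof (rule AE_eventually_not_hitting[OF mu open_short_open])
  fix \<Lambda> :: "(real^'n::_) set" assume \<Lambda>: "\<Lambda> \<in> unimodular_lattices"
  let ?N = "CARD('n)" and ?s = "\<lambda>k i. real k * z $ i"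
  define \<tau> where "\<tau> k = exp (- (real k * (delta n z / ?N + \<epsilon>)))" for k :: nat
  define C0 :: real where "C0 = fact ?N * 2 ^ ?N"
  have C0: "0 < C0" by (simp add: C0_def)
  define Z where "Z = (\<Sum>i\<in>UNIV. \<bar>z $ i\<bar>)"
  have zZ: "\<bar>z $ i\<bar> \<le> Z" for i unfolding Z_def by (rule member_le_sum) auto
  have Z0: "0 \<le> Z" unfolding Z_def by (rule sum_nonneg) simp
  \<comment> \<open>The 1 serves the time \<open>k = 0\<close>, where all exponents vanish but \<open>\<kappa>\<close> must be at least one.\<close>
  define \<kappa> where "\<kappa> k = 1 + real k * Z" for k :: nat
  have k1: "1 \<le> \<kappa> k" for k using Z0 by (simp add: \<kappa>_def)
  have sk: "\<bar>?s k i\<bar> \<le> \<kappa> k" for k i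
    using mult_left_mono[OF zZ[of i], of "real k"] by (simp add: \<kappa>_def abs_mult)
  have s0: "(\<Sum>i\<in>UNIV. ?s k i) = 0" for k by (simp add: sum_distrib_left[symmetric] z)
  have d0: "0 \<le> delta n z" by (rule delta_nonneg[OF mono])
  obtain C where C: "0 \<le> C" and bound: "\<forall>G s \<kappa> \<tau>. G \<subseteq> block_orthogonal (first_coords n) \<longrightarrow> (\<Sum>i\<in>UNIV. s i) = 0 \<longrightarrow> (\<forall>i. \<bar>s i\<bar> \<le> \<kappa>) \<longrightarrow> 1 \<le> \<kappa>
    \<longrightarrow> 0 < \<tau> \<longrightarrow> \<tau> \<le> 1 \<longrightarrow> (\<exists>S\<in>sets borel. {A\<in>near_id. \<exists>P. \<exists>h\<in>G. short_system P (dil s ** h ** A) \<Lambda> \<tau>} \<subseteq> S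
      \<and> emeasure lborel S \<le> ennreal (C * \<kappa> ^ (2 * ?N) * exp (spread (first_coords n) s) * \<tau> ^ ?N))"
    using short_system_measure[OF unimodular_facts(1)[OF \<Lambda>], of "first_coords n"] by (elim exE conjE)
  define v where "v = measure lborel (near_id :: (real^'n::_^'n::_) set)"
  have v: "emeasure lborel (near_id :: (real^'n::_^'n::_) set) = ennreal v" "0 \<le> v"
    using emeasure_compact_finite[of "near_id :: (real^'n::_^'n::_) set"]
    by (auto simp: v_def near_id_def emeasure_eq_ennreal_measure)
  \<comment> \<open>The summand \<open>v\<close> covers the finitely many times at which \<open>C0 * \<tau> k > 1\<close> and the trivial bound by the whole ball is used.\<close>
  define b where "b k = (C + v) * \<kappa> k ^ (2 * ?N) * exp (spread (first_coords n) (?s k)) * (C0 * \<tau> k) ^ ?N" for k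
  have t0: "0 < \<tau> k" for k by (simp add: \<tau>_def)
  have beq: "b k = ((C + v) * C0 ^ ?N) * ((1 + real k * Z) ^ (2 * ?N) * exp (- (real k * (?N * \<epsilon>))))" for k
  proof -
    have "\<tau> k ^ ?N = exp (- (real k * delta n z) - real k * (?N * \<epsilon>))"
      by (simp add: \<tau>_def exp_of_nat_mult[symmetric] algebra_simps)
    then have "exp (spread (first_coords n) (?s k)) * \<tau> k ^ ?N = exp (- (real k * (?N * \<epsilon>)))"
      by (simp add: spread_delta[OF mono] exp_add[symmetric])
    then have "(C + v) * C0 ^ ?N * \<kappa> k ^ (2 * ?N) * (exp (spread (first_coords n) (?s k)) * \<tau> k ^ ?N)
        = (C + v) * C0 ^ ?N * \<kappa> k ^ (2 * ?N) * exp (- (real k * (?N * \<epsilon>)))" by (simp only:)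
    then show ?thesis by (simp only: b_def \<kappa>_def power_mult_distrib mult_ac)
  qed
  have sum: "summable b"
    unfolding beq[abs_def] by (intro summable_mult summable_poly_exp) (use Z0 e in auto)
  have S: "\<exists>S. S \<in> sets lborel \<and> {A\<in>near_id. act (unimod A) \<Lambda> \<in> hitting (short_open n (?s k) (\<tau> k))} \<subseteq> S
      \<and> emeasure lborel S \<le> ennreal (b k)" for k
  proof (cases "C0 * \<tau> k \<le> 1")
    case True
    have "\<exists>S\<in>sets borel. {A\<in>near_id. \<exists>P. \<exists>h\<in>block_SO n. short_system P (dil (?s k) ** h ** A) \<Lambda> (C0 * \<tau> k)} \<subseteq> S
      \<and> emeasure lborel S \<le> ennreal (C * \<kappa> k ^ (2 * ?N) * exp (spread (first_coords n) (?s k)) * (C0 * \<tau> k) ^ ?N)"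
      by (rule bound[rule_format, OF block_SO_block_orthogonal s0 sk k1 _ True]) (use C0 t0 in simp)
    then obtain S where S: "S \<in> sets borel"
      "{A\<in>near_id. \<exists>P. \<exists>h\<in>block_SO n. short_system P (dil (?s k) ** h ** A) \<Lambda> (C0 * \<tau> k)} \<subseteq> S"
      "emeasure lborel S \<le> ennreal (C * \<kappa> k ^ (2 * ?N) * exp (spread (first_coords n) (?s k)) * (C0 * \<tau> k) ^ ?N)"
      by (elim bexE conjE)
    have "{A\<in>near_id. act (unimod A) \<Lambda> \<in> hitting (short_open n (?s k) (\<tau> k))} \<subseteq> S"
    proof (rule subsetI)
      fix A :: "real^'n::_^'n::_" assume "A \<in> {A\<in>near_id. act (unimod A) \<Lambda> \<in> hitting (short_open n (?s k) (\<tau> k))}"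
      then have A: "A \<in> near_id" and hit: "act (unimod A) \<Lambda> \<in> hitting (short_open n (?s k) (\<tau> k))" by auto
      have "act (unimod A) \<Lambda> \<in> unimodular_lattices" using hit unfolding hitting_def by blast
      then obtain P h where h: "h \<in> block_SO n" and sh: "short_system P (dil (?s k) ** h) (act (unimod A) \<Lambda>) (\<tau> k)"
        using hit hitting_short_open by blast
      have "short_system P (dil (?s k) ** h ** A) \<Lambda> (C0 * \<tau> k)"
        unfolding C0_def by (rule short_system_unimod[OF A sh t0])
      then show "A \<in> S" using A h S(2) by blast
    qed
    moreover have "emeasure lborel S \<le> ennreal (b k)"
    proof (rule order_trans[OF S(3)], rule ennreal_leI)
      show "C * \<kappa> k ^ (2 * ?N) * exp (spread (first_coords n) (?s k)) * (C0 * \<tau> k) ^ ?N \<le> b k"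
        unfolding b_def using v(2) k1[of k] C0 t0[of k] by (intro mult_right_mono) auto
    qed
    ultimately show ?thesis using S(1) by (intro exI[of _ S] conjI) auto
  next
    case False
    have "v \<le> b k"
    proof -
      have "1 \<le> \<kappa> k ^ (2 * ?N)" by (rule one_le_power[OF k1])
      moreover have "1 \<le> (C0 * \<tau> k) ^ ?N" by (rule one_le_power) (use False in simp)
      moreover have "1 \<le> exp (spread (first_coords n) (?s k))"
        using d0 by (simp add: spread_delta[OF mono])
      ultimately have "1 * 1 * 1 \<le> \<kappa> k ^ (2 * ?N) * exp (spread (first_coords n) (?s k)) * (C0 * \<tau> k) ^ ?N"
        by (intro mult_mono) auto
      then have "(C + v) * 1 \<le> (C + v) * (\<kappa> k ^ (2 * ?N) * exp (spread (first_coords n) (?s k)) * (C0 * \<tau> k) ^ ?N)"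
        using C v(2) by (intro mult_left_mono) auto
      then show ?thesis unfolding b_def using C by (simp add: mult.assoc)
    qed
    then have "emeasure lborel (near_id :: (real^'n::_^'n::_) set) \<le> ennreal (b k)" unfolding v(1) by (rule ennreal_leI)
    moreover have "near_id \<in> sets (lborel :: (real^'n::_^'n::_) measure)" by (simp add: near_id_def)
    ultimately show ?thesis by (intro exI[of _ near_id] conjI) auto
  qed
  have "\<forall>k. \<exists>S. S \<in> sets lborel \<and> {A\<in>near_id. act (unimod A) \<Lambda> \<in> hitting (short_open n (?s k) (\<tau> k))} \<subseteq> S
      \<and> emeasure lborel S \<le> ennreal (b k)" using S by (rule allI)
  then obtain S where S': "\<forall>k. S k \<in> sets lborel \<and> {A\<in>near_id. act (unimod A) \<Lambda> \<in> hitting (short_open n (?s k) (\<tau> k))} \<subseteq> S k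
      \<and> emeasure lborel (S k) \<le> ennreal (b k)" unfolding choice_iff by (elim exE)
  have b0: "0 \<le> b k" for k unfolding b_def using C v(2) k1[of k] C0 t0[of k] by (intro mult_nonneg_nonneg) auto
  show "\<exists>S b. (\<forall>k. S k \<in> sets lborel) \<and> (\<forall>k. {A\<in>near_id. act (unimod A) \<Lambda> \<in>
        hitting (short_open n (?s k) (exp (- (real k * (delta n z / ?N + \<epsilon>)))))} \<subseteq> S k)
      \<and> (\<forall>k. emeasure lborel (S k) \<le> ennreal (b k)) \<and> (\<forall>k. 0 \<le> b k) \<and> summable b"
    using S' b0 sum unfolding \<tau>_def by (intro exI[of _ S] exI[of _ b] conjI allI) auto
qed

text \<open>
  A sublattice of the image lattice at time \<open>t\<close> has a reduced system with product of lengths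
  bounded by its covolume. Passing to the time \<open>a\<close>, at distance at most one, changes lengths by
  bounded factors, so integer times suffice in the almost sure statement.
\<close>

lemma covol_ge_of_no_short_system:
  fixes \<Lambda> :: "(real^'n::{finite,wellorder}) set" and z :: "real^'n::_"
  assumes \<Lambda>: "\<Lambda> \<in> unimodular_lattices" and h: "h \<in> block_SO n" and V: "lattice_in V (act (dil (\<lambda>i. t * z $ i) ** h) \<Lambda> \<inter> V)"
    and kt: "\<bar>a - t\<bar> \<le> 1" and Z: "\<And>i. \<bar>z $ i\<bar> \<le> Z" and Z0: "0 \<le> Z"
    and nh: "\<Lambda> \<notin> hitting (short_open n (\<lambda>i. a * z $ i) \<tau>)"
  shows "\<tau> \<le> exp Z ^ CARD('n) * real CARD('n) ^ CARD('n) * covol V (act (dil (\<lambda>i. t * z $ i) ** h) \<Lambda> \<inter> V)"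
proof -
  let ?N = "CARD('n)" and ?g = "dil (\<lambda>i. t * z $ i) ** h" and ?k = "dil (\<lambda>i. a * z $ i) ** h"
  let ?L = "act ?g \<Lambda> \<inter> V"
  have "dim V \<le> ?N" using dim_subset_UNIV[of V] by simp
  then obtain P :: "'n set" where P: "card P = dim V" using exists_card_subset by metis
  obtain F m where m: "\<forall>i\<in>P. m $ i \<in> ?L \<and> m $ i \<noteq> 0" and F: "frame P V F" and sp: "span ((\<lambda>i. m $ i) ` P) = V"
    and le: "(\<Prod>i\<in>P. norm (m $ i)) \<le> real ?N ^ ?N * covol V ?L"
    using reduced_le_covol[OF V P] by (elim exE conjE)
  have nz: "det (mix P m F) \<noteq> 0" by (rule det_mix_frame_nz) (simp only: sp F)
  have "\<forall>i. \<exists>v. i \<in> P \<longrightarrow> v \<in> \<Lambda> \<and> m $ i = ?g *v v" using m by (auto simp: act_def)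
  then obtain f where f: "\<forall>i. i \<in> P \<longrightarrow> f i \<in> \<Lambda> \<and> m $ i = ?g *v f i" unfolding choice_iff by (elim exE)
  define w :: "real^'n::_^'n::_" where "w = (\<chi> i. f i)"
  have w: "w $ i \<in> \<Lambda>" "m $ i = ?g *v w $ i" if "i \<in> P" for i using f that by (auto simp: w_def)
  obtain Y where Y: "det (mix P w Y) \<noteq> 0"
    using det_mix_image[of P m ?g w F, OF w(2) det_dil_nz[OF block_SO_orthogonal[OF h]] nz] by auto
  have nw: "norm (?k *v w $ i) \<le> exp Z * norm (m $ i)" if "i \<in> P" for i
  proof -
    have "?k *v w $ i = dil (\<lambda>i. (a - t) * z $ i) *v (?g *v w $ i)"
      by (simp add: matrix_vector_mul_assoc[symmetric] dil_dil algebra_simps)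
    moreover have "\<bar>(a - t) * z $ j\<bar> \<le> Z" for j
      using mult_mono[OF kt Z[of j]] by (simp add: abs_mult)
    ultimately show ?thesis using norm_dil_le[of "\<lambda>i. (a - t) * z $ i" Z "?g *v w $ i"] w(2)[OF that] by simp
  qed
  have "\<not> short_system P ?k \<Lambda> \<tau>" using nh hitting_short_open[OF \<Lambda>] h by blast
  then have "\<not> (\<Prod>i\<in>P. norm (?k *v w $ i)) < \<tau>" using w(1) Y unfolding short_system_def by blast
  then have "\<tau> \<le> (\<Prod>i\<in>P. norm (?k *v w $ i))" by simp
  also have "\<dots> \<le> (\<Prod>i\<in>P. exp Z * norm (m $ i))" by (intro prod_mono) (simp add: nw)
  also have "\<dots> = exp Z ^ card P * (\<Prod>i\<in>P. norm (m $ i))" by (simp add: prod.distrib)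
  also have "\<dots> \<le> exp Z ^ ?N * (\<Prod>i\<in>P. norm (m $ i))"
    using Z0 by (intro mult_right_mono power_increasing prod_nonneg) (auto simp: card_mono)
  also have "\<dots> \<le> exp Z ^ ?N * (real ?N ^ ?N * covol V ?L)" using le by (intro mult_left_mono) auto
  finally show ?thesis by (simp only: mult.assoc)
qed

lemma max_height_upper:
  fixes \<Lambda> :: "(real^'n::{finite,wellorder}) set" and z :: "real^'n::_"
  assumes \<Lambda>: "\<Lambda> \<in> unimodular_lattices" and N: "2 \<le> CARD('n)" and \<gamma>: "0 \<le> \<gamma>"
    and nh: "\<forall>\<^sub>F k in sequentially. \<Lambda> \<notin> hitting (short_open n (\<lambda>i. real k * z $ i) (exp (- (real k * \<gamma>))))"
  shows "\<exists>C>0. \<forall>\<^sub>F t in at_top. max_height n z t \<Lambda> \<le> C * exp (t * \<gamma>)"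
proof -
  let ?N = "CARD('n)"
  define Z where "Z = (\<Sum>i\<in>UNIV. \<bar>z $ i\<bar>)"
  have zZ: "\<bar>z $ i\<bar> \<le> Z" for i unfolding Z_def by (rule member_le_sum) auto
  have Z0: "0 \<le> Z" unfolding Z_def by (rule sum_nonneg) simp
  define C where "C = exp Z ^ ?N * real ?N ^ ?N"
  have C: "0 < C" by (simp add: C_def)
  obtain K where K: "\<And>k. K \<le> k \<Longrightarrow> \<Lambda> \<notin> hitting (short_open n (\<lambda>i. real k * z $ i) (exp (- (real k * \<gamma>))))"
    using nh unfolding eventually_sequentially by blast
  have "max_height n z t \<Lambda> \<le> C * exp (t * \<gamma>)" if t: "real K + 1 \<le> t" for t
  proof -
    define k where "k = nat \<lfloor>t\<rfloor>"
    have rk: "real k = of_int \<lfloor>t\<rfloor>" using t by (simp add: k_def)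
    have kt: "real k \<le> t" "t < real k + 1" unfolding rk by linarith+
    have "K \<le> k" using t kt by linarith
    note nhk = K[OF this]
    have "max_height n z t \<Lambda> \<le> 1 / (exp (- (t * \<gamma>)) / C)"
    proof (rule max_height_le[OF unimodular_facts(1)[OF \<Lambda>] N unimodular_facts(2)[OF \<Lambda>]])
      show "0 < exp (- (t * \<gamma>)) / C" using C by simp
      fix h V assume h: "h \<in> block_SO n" and V: "lattice_in V (act (dil (\<lambda>i. t * z $ i) ** h) \<Lambda> \<inter> V)"
      have "exp (- (t * \<gamma>)) \<le> exp (- (real k * \<gamma>))" using kt \<gamma> by (simp add: mult_right_mono)
      also have "\<dots> \<le> C * covol V (act (dil (\<lambda>i. t * z $ i) ** h) \<Lambda> \<inter> V)"
        unfolding C_def by (rule covol_ge_of_no_short_system[OF \<Lambda> h V _ zZ Z0 nhk]) (use kt in linarith)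
      finally show "exp (- (t * \<gamma>)) / C \<le> covol V (act (dil (\<lambda>i. t * z $ i) ** h) \<Lambda> \<inter> V)"
        using C by (simp add: divide_le_eq mult.commute)
    qed
    then show ?thesis by (simp add: exp_minus field_simps)
  qed
  then show ?thesis using C unfolding eventually_at_top_linorder by blast
qed

lemma log_rate_tendsto: "((\<lambda>t::real. ereal (\<gamma> + ln c / t)) \<longlongrightarrow> ereal \<gamma>) at_top"
proof -
  have "((\<lambda>t::real. \<gamma> + ln c / t) \<longlongrightarrow> \<gamma> + 0) at_top"
    by (intro tendsto_add tendsto_const tendsto_divide_0[OF tendsto_const] filterlim_at_top_imp_at_infinity filterlim_ident)
  then show ?thesis by simp
qed

section \<open>The growth rates\<close>

theorem mainTheorem4:
  fixes n :: nat
    and z :: "real^'N::{finite,wellorder}"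
    and \<mu> :: "(real^'N::_) set measure"
  assumes "2 \<le> n" and "n \<le> CARD('N)"
    and "\<And>i j. i \<le> j \<Longrightarrow> z $ j \<le> z $ i"
    and "(\<Sum>i\<in>UNIV. z $ i) = 0"
    and "SL_invariant_prob_measure \<mu>"
  shows "AE \<Lambda> in \<mu>.
      ereal (rho n z / real CARD('N))
        \<le> Liminf at_top (\<lambda>t::real. ereal (1 / t * ln (max_height n z t \<Lambda>))) \<and>
      Liminf at_top (\<lambda>t::real. ereal (1 / t * ln (max_height n z t \<Lambda>)))
        \<le> Limsup at_top (\<lambda>t::real. ereal (1 / t * ln (max_height n z t \<Lambda>))) \<and>
      Limsup at_top (\<lambda>t::real. ereal (1 / t * ln (max_height n z t \<Lambda>)))
        \<le> ereal (delta n z / real CARD('N))"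
proof -
  let ?R = "rho n z / real CARD('N)" and ?D = "delta n z / real CARD('N)"
  let ?f = "\<lambda>\<Lambda> (t::real). ereal (1 / t * ln (max_height n z t \<Lambda>))"
  have N: "2 \<le> CARD('N)" and n1: "1 \<le> n" using assms(1,2) by auto
  have sp: "space \<mu> = unimodular_lattices"
  proof -
    have "sets \<mu> = sets borel_lattices" using assms(5) by (simp add: SL_invariant_prob_measure_def)
    then have "space \<mu> = space borel_lattices" by (rule sets_eq_imp_space_eq)
    then show ?thesis by (simp add: borel_lattices_def space_measure_of_conv)
  qed
  have D0: "0 \<le> ?D" using delta_nonneg[OF assms(3)] by simp
  have ae: "AE \<Lambda> in \<mu>. \<forall>r. \<forall>\<^sub>F k in sequentially.
    \<Lambda> \<notin> hitting (short_open n (\<lambda>i. real k * z $ i) (exp (- (real k * (?D + 1 / (real r + 1))))))"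
    unfolding AE_all_countable
  proof (intro allI AE_eventually_no_short_system[OF assms(5,3,4)])
    fix r :: nat show "0 < 1 / (real r + 1)" by (intro divide_pos_pos) linarith+
  qed
  show ?thesis
  proof (rule AE_mp[OF ae], rule AE_I2, rule impI)
    fix \<Lambda> assume "\<Lambda> \<in> space \<mu>"
      and nh: "\<forall>r. \<forall>\<^sub>F k in sequentially.
        \<Lambda> \<notin> hitting (short_open n (\<lambda>i. real k * z $ i) (exp (- (real k * (?D + 1 / (real r + 1))))))"
    then have \<Lambda>: "\<Lambda> \<in> unimodular_lattices" by (simp only: sp)
    obtain c where c: "0 < c" and lower: "\<forall>t. c * exp (t * ?R) \<le> max_height n z t \<Lambda>"
      using max_height_lower[OF \<Lambda> N n1 assms(2,4)] by (elim exE conjE)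
    have pos: "0 < max_height n z t \<Lambda>" for t
      using lower[rule_format, of t] c by (meson exp_gt_zero less_le_trans mult_pos_pos)
    have "ereal ?R = Liminf at_top (\<lambda>t::real. ereal (?R + ln c / t))"
      by (rule lim_imp_Liminf[OF _ log_rate_tendsto, symmetric]) simp
    also have "\<dots> \<le> Liminf at_top (?f \<Lambda>)"
    proof (rule Liminf_mono, rule eventually_mono[OF eventually_gt_at_top[of 0]])
      fix t :: real assume t: "0 < t"
      have "ln (c * exp (t * ?R)) \<le> ln (max_height n z t \<Lambda>)"
        using lower c by (intro ln_mono) auto
      then have "ln c + t * ?R \<le> ln (max_height n z t \<Lambda>)" using c by (simp only: ln_mult_pos[OF c exp_gt_zero] ln_exp)
      then have "1 / t * (ln c + t * ?R) \<le> 1 / t * ln (max_height n z t \<Lambda>)" using t by (intro mult_left_mono) auto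
      moreover have "1 / t * (ln c + t * ?R) = ?R + ln c / t" using t by (simp add: distrib_left)
      ultimately show "ereal (?R + ln c / t) \<le> ?f \<Lambda> t" by (simp only: ereal_less_eq)
    qed
    finally have 1: "ereal ?R \<le> Liminf at_top (?f \<Lambda>)" .
    have 2: "Liminf at_top (?f \<Lambda>) \<le> Limsup at_top (?f \<Lambda>)" by (rule Liminf_le_Limsup) simp
    have upper: "Limsup at_top (?f \<Lambda>) \<le> ereal (?D + 1 / (real r + 1))" for r :: nat
    proof -
      let ?\<gamma> = "?D + 1 / (real r + 1)"
      have g0: "0 \<le> ?\<gamma>" using D0 by simp
      obtain C where C: "0 < C" and up: "\<forall>\<^sub>F t in at_top. max_height n z t \<Lambda> \<le> C * exp (t * ?\<gamma>)"
        using max_height_upper[OF \<Lambda> N g0 nh[rule_format, of r]] by (elim exE conjE)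
      have "Limsup at_top (?f \<Lambda>) \<le> Limsup at_top (\<lambda>t::real. ereal (?\<gamma> + ln C / t))"
      proof (rule Limsup_mono, rule eventually_mono[OF eventually_conj[OF up eventually_gt_at_top[of 0]]])
        fix t :: real assume "max_height n z t \<Lambda> \<le> C * exp (t * ?\<gamma>) \<and> 0 < t"
        then have le: "max_height n z t \<Lambda> \<le> C * exp (t * ?\<gamma>)" and t: "0 < t" by auto
        have "ln (max_height n z t \<Lambda>) \<le> ln (C * exp (t * ?\<gamma>))" using le pos by (intro ln_mono) auto
        then have "ln (max_height n z t \<Lambda>) \<le> ln C + t * ?\<gamma>" by (simp only: ln_mult_pos[OF C exp_gt_zero] ln_exp)
        then have "1 / t * ln (max_height n z t \<Lambda>) \<le> 1 / t * (ln C + t * ?\<gamma>)" using t by (intro mult_left_mono) auto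
        moreover have "1 / t * (ln C + t * ?\<gamma>) = ?\<gamma> + ln C / t" using t by (simp add: distrib_left)
        ultimately show "?f \<Lambda> t \<le> ereal (?\<gamma> + ln C / t)" by (simp only: ereal_less_eq)
      qed
      also have "\<dots> = ereal ?\<gamma>" by (rule lim_imp_Limsup[OF _ log_rate_tendsto]) simp
      finally show ?thesis .
    qed
    have "Limsup at_top (?f \<Lambda>) \<le> ereal ?D"
    proof (rule LIMSEQ_le_const)
      have "(\<lambda>r. ?D + 1 / (real r + 1)) \<longlonglongrightarrow> ?D + 0"
        using LIMSEQ_inverse_real_of_nat by (intro tendsto_add tendsto_const) (simp add: inverse_eq_divide add.commute)
      then show "(\<lambda>r. ereal (?D + 1 / (real r + 1))) \<longlonglongrightarrow> ereal ?D" by simp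
      show "\<exists>r0. \<forall>r\<ge>r0. Limsup at_top (?f \<Lambda>) \<le> ereal (?D + 1 / (real r + 1))" using upper by blast
    qed
    with 1 2 show "ereal ?R \<le> Liminf at_top (?f \<Lambda>) \<and> Liminf at_top (?f \<Lambda>) \<le> Limsup at_top (?f \<Lambda>)
      \<and> Limsup at_top (?f \<Lambda>) \<le> ereal ?D" by (intro conjI)
  qed
qed

end
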